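(* Let $0<\alpha<d$ and $1<p\leq q<\infty$ with $\frac{1}{q}+\frac{\alpha}{d}=\frac{1}{p}$, let $\mathcal{S}$ be a sparse collection of dyadic cubes in $\mathbb{R}^d$, and let $w$ be a weight. Then $$\|\mathcal{A}_{\alpha,2}^{\mathcal{S}}\|_{L^{p}(w^{p})\rightarrow L^{q,\infty}(w^{q})}\lesssim[w]_{A_{p,q}}^{\frac{1}{q}}\cdot \begin{cases} [w^{-p'}]_{A_{\infty}}^{\frac{1}{q}}, & \text{if } 2\leq q\leq\dfrac{2}{1-\frac{2\alpha}{d}},\\[2mm] [w^{q}]_{A_{\infty}}^{(\frac{1}{2}-\frac{1}{p})_{+}}, & \text{in all other cases,} \end{cases}$$ where $\frac{2}{1-2\alpha/d}$ is read as $+\infty$ when $2\alpha\ge d$.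
   Context: A weight on $\mathbb{R}^d$ is a locally integrable function $w:\mathbb{R}^d\to(0,\infty)$; $L^p(w^p)$ and $L^{q,\infty}(w^q)$ are taken with respect to the measures $w^p\,dx$ and $w^q\,dx$. Dyadic cubes are those of a fixed dyadic grid on $\mathbb{R}^d$. A collection $\mathcal{S}$ of dyadic cubes is sparse (with parameter $0<\gamma<1$) if for each $Q\in\mathcal{S}$ there is $E_Q\subset Q$ with $|E_Q|\geq\gamma|Q|$, the sets $E_Q$, $Q\in\mathcal S$, being pairwise disjoint. For nonnegative $f$ set $$\langle f\rangle_{\alpha,Q}=\frac{1}{|Q|^{1-\alpha/d}}\int_Q f,\qquad \mathcal{A}_{\alpha,2}^{\mathcal{S}}(f)=\Big(\sum_{Q\in\mathcal{S}}\langle f\rangle_{\alpha,Q}^{2}\mathbf{1}_Q\Big)^{1/2}.$$ The norm $\|\mathcal{A}_{\alpha,2}^{\mathcal{S}}\|_{L^{p}(w^{p})\rightarrow L^{q,\infty}(w^{q})}$ is the least $C\in[0,\infty]$ with $\|\mathcal{A}_{\alpha,2}^{\mathcal{S}}(f)\|_{L^{q,\infty}(w^q)}\le C\|f\|_{L^p(w^p)}$ for all nonnegative $f\in L^p(w^p)$. With $1/p+1/p'=1$, $$[w]_{A_{p,q}}=\sup_Q\Big(\frac{1}{|Q|}\int_Q w^q\Big)\Big(\frac{1}{|Q|}\int_Q w^{-p'}\Big)^{q/p'},\qquad [u]_{A_\infty}=\sup_Q\frac{1}{u(Q)}\int_Q M(\mathbf{1}_Q u),$$ where $u(Q)=\int_Q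 u$, $M$ is the Hardy–Littlewood maximal function, and by convention all suprema over cubes are over dyadic cubes. Here $x_+=\max(x,0)$ and $[u]_{A_\infty}^0$ is interpreted as $1$. The notation $\lesssim$ means inequality up to a constant depending only on $p,q,\alpha,d$ and the sparsity parameter $\gamma$. *)

theory Defs
  imports "HOL-Analysis.Analysis"
begin

text \<open>
  Euclidean space is \<^typ>\<open>real ^ 'n\<close>, of dimension \<open>d = CARD('n)\<close>.  All integrals are Lebesgue
  integrals with values in \<^typ>\<open>ennreal\<close>, so that averages, norms and weight characteristics
  may be infinite.
\<close>

text \<open>Powers with real exponent on \<open>[0,\<infinity>]\<close>, meant for \<open>a \<ge> 0\<close>; every zeroth power is \<open>1\<close>.\<close>

definition epowr :: "ennreal \<Rightarrow> real \<Rightarrow> ennreal"  (infixr "epowr" 80) where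
  "x epowr a = (if a = 0 then 1 else if x = \<infinity> then \<infinity> else ennreal (enn2real x powr a))"

definition conj_exp :: "real \<Rightarrow> real" where
  "conj_exp p = p / (p - 1)"

subsection \<open>Dyadic grids and sparse collections\<close>

definition cube :: "real ^ 'n \<Rightarrow> real \<Rightarrow> (real ^ 'n) set" where
  "cube a l = {x. \<forall>i. a $ i \<le> x $ i \<and> x $ i < a $ i + l}"

definition dyadic_grid :: "(real ^ 'n) set set \<Rightarrow> bool" where
  "dyadic_grid D \<longleftrightarrow>
     (\<forall>Q\<in>D. \<exists>a. \<exists>k::int. Q = cube a (2 powi k)) \<and>
     (\<forall>Q\<in>D. \<forall>R\<in>D. Q \<inter> R \<in> {Q, R, {}}) \<and>
     (\<forall>k::int. partition_on UNIV {Q\<in>D. \<exists>a. Q = cube a (2 powi k)})"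

definition sparse_collection :: "real \<Rightarrow> (real ^ 'n) set set \<Rightarrow> bool" where
  "sparse_collection \<gamma> S \<longleftrightarrow>
     (\<exists>E. (\<forall>Q\<in>S. E Q \<subseteq> Q \<and> E Q \<in> sets lebesgue \<and>
                  measure lebesgue (E Q) \<ge> \<gamma> * measure lebesgue Q) \<and>
          disjoint_family_on E S)"

subsection \<open>The sparse operator\<close>

definition frac_avg :: "real \<Rightarrow> (real ^ 'n) set \<Rightarrow> (real ^ 'n \<Rightarrow> real) \<Rightarrow> ennreal" where
  "frac_avg \<alpha> Q f =
     (\<integral>\<^sup>+x\<in>Q. ennreal (f x) \<partial>lebesgue) / ennreal (measure lebesgue Q powr (1 - \<alpha> / real CARD('n)))"

definition sparse_op ::
  "real \<Rightarrow> (real ^ 'n) set set \<Rightarrow> (real ^ 'n \<Rightarrow> real) \<Rightarrow> real ^ 'n \<Rightarrow> ennreal" where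
  "sparse_op \<alpha> S f x = (\<Sum>\<^sub>\<infinity>Q\<in>S. (frac_avg \<alpha> Q f)\<^sup>2 * indicator Q x) epowr (1 / 2)"

subsection \<open>Weights, weighted norms and operator norms\<close>

definition weight :: "(real ^ 'n \<Rightarrow> real) \<Rightarrow> bool" where
  "weight w \<longleftrightarrow> (\<forall>x. 0 < w x) \<and> w \<in> borel_measurable lebesgue \<and>
     (\<forall>K. compact K \<longrightarrow> set_integrable lebesgue K w)"

definition weighted :: "(real ^ 'n \<Rightarrow> real) \<Rightarrow> (real ^ 'n) measure" where
  "weighted u = density lebesgue (\<lambda>x. ennreal (u x))"

definition Lp_norm :: "real \<Rightarrow> 'a measure \<Rightarrow> ('a \<Rightarrow> real) \<Rightarrow> ennreal" where
  "Lp_norm p \<mu> f = (\<integral>\<^sup>+x. ennreal (\<bar>f x\<bar> powr p) \<partial>\<mu>) epowr (1 / p)"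

text \<open>The function \<open>g\<close> takes values in \<open>[0,\<infinity>]\<close>, as the sparse operator may be infinite.\<close>

definition weak_norm :: "real \<Rightarrow> 'a measure \<Rightarrow> ('a \<Rightarrow> ennreal) \<Rightarrow> ennreal" where
  "weak_norm q \<mu> g = (SUP t\<in>{0<..}. ennreal t * emeasure \<mu> {x \<in> space \<mu>. ennreal t < g x} epowr (1 / q))"

definition weak_type_norm ::
  "real \<Rightarrow> real \<Rightarrow> (real ^ 'n \<Rightarrow> real) \<Rightarrow> ((real ^ 'n \<Rightarrow> real) \<Rightarrow> real ^ 'n \<Rightarrow> ennreal) \<Rightarrow> ennreal" where
  "weak_type_norm p q w T =
     Inf {C. \<forall>f. f \<in> borel_measurable lebesgue \<and> (\<forall>x. 0 \<le> f x) \<and>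
                 Lp_norm p (weighted (\<lambda>x. w x powr p)) f < \<infinity> \<longrightarrow>
               weak_norm q (weighted (\<lambda>x. w x powr q)) (T f)
                 \<le> C * Lp_norm p (weighted (\<lambda>x. w x powr p)) f}"

subsection \<open>Weight characteristics\<close>

definition avg :: "(real ^ 'n) set \<Rightarrow> (real ^ 'n \<Rightarrow> real) \<Rightarrow> ennreal" where
  "avg Q f = (\<integral>\<^sup>+x\<in>Q. ennreal (f x) \<partial>lebesgue) / emeasure lebesgue Q"

definition dyadic_maximal ::
  "(real ^ 'n) set set \<Rightarrow> (real ^ 'n \<Rightarrow> real) \<Rightarrow> real ^ 'n \<Rightarrow> ennreal" where
  "dyadic_maximal D f x = (SUP Q\<in>{Q\<in>D. x \<in> Q}. avg Q (\<lambda>y. \<bar>f y\<bar>))"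

definition Apq_const ::
  "(real ^ 'n) set set \<Rightarrow> real \<Rightarrow> real \<Rightarrow> (real ^ 'n \<Rightarrow> real) \<Rightarrow> ennreal" where
  "Apq_const D p q w =
     (SUP Q\<in>D. avg Q (\<lambda>x. w x powr q)
                * avg Q (\<lambda>x. w x powr (- conj_exp p)) epowr (q / conj_exp p))"

text \<open>
  For \<open>u > 0\<close> with \<open>u(Q) < \<infinity>\<close> for every dyadic cube the first branch never applies.  If
  \<open>u(Q) = \<infinity>\<close> then \<open>u\<close> is not a weight and the quotient has the form \<open>\<infinity>/\<infinity>\<close>, which \<^typ>\<open>ennreal\<close>
  division would evaluate to \<open>0\<close>; the characteristic is then taken to be \<open>\<infinity>\<close>.
\<close>

definition Ainfty_const ::
  "(real ^ 'n) set set \<Rightarrow> (real ^ 'n \<Rightarrow> real) \<Rightarrow> ennreal" where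
  "Ainfty_const D u =
     (SUP Q\<in>D. if (\<integral>\<^sup>+x\<in>Q. ennreal (u x) \<partial>lebesgue) = \<infinity> then \<infinity>
                else (\<integral>\<^sup>+x\<in>Q. dyadic_maximal D (\<lambda>y. indicator Q y * u y) x \<partial>lebesgue)
                       / (\<integral>\<^sup>+x\<in>Q. ennreal (u x) \<partial>lebesgue))"

end

theory Submission
  imports Defs
begin

text \<open>
  Write \<open>\<sigma> = w\<^sup>-\<^sup>p\<^sup>'\<close>, \<open>\<omega> = w\<^sup>q\<close>, \<open>F(Q) = \<integral>\<^sub>Q f\<close> and \<open>\<beta> = 1 - \<alpha>/d = 1/p' + 1/q\<close>.  The \<open>A\<^sub>p\<^sub>,\<^sub>q\<close> condition says
  that \<open>A(Q) = |Q|\<^sup>-\<^sup>\<beta> \<sigma>(Q)\<^sup>1\<^sup>/\<^sup>p\<^sup>' \<omega>(Q)\<^sup>1\<^sup>/\<^sup>q\<close> is at most \<open>K = [w]\<^sup>1\<^sup>/\<^sup>q\<close>, and the two regimes of the statement are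
  \<open>p \<le> 2 \<le> q\<close> and its complement.  By monotone convergence the collection may be taken finite.

  Group the cubes by the dyadic size of \<open>F(Q)/\<sigma>(Q)\<close>.  The maximal cubes of the class \<open>F/\<sigma> \<sim> 2\<^sup>m\<close> carry half
  of their mass where \<open>f/\<sigma> > 2\<^sup>m\<^sup>-\<^sup>1\<close>, so \<open>\<Sum>\<^sub>m 2\<^sup>m\<^sup>p \<Sum>\<^sub>R \<sigma>(R)\<close> is bounded by \<open>\<integral> f\<^sup>p w\<^sup>p\<close>.  The sum over the
  smaller cubes of a class is controlled by its maximal cubes, because \<open>\<alpha> > 0\<close> leaves room for a positive
  power of \<open>|Q|\<close>, which makes generations decay geometrically; no sparsity is needed for this.

  For \<open>q < 2\<close>, group also by the size of the fractional average and use Chebyshev's inequality; for \<open>q = 2\<close>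
  the sum over a class is instead a Carleson sum for \<open>\<sigma>\<close>.  For \<open>q > 2\<close> the space \<open>L\<^sup>q\<^sup>/\<^sup>2\<^sup>,\<^sup>\<infinity>\<close> is normable, so
  it suffices to bound \<open>\<Sum> (|Q|\<^sup>-\<^sup>\<beta> F(Q))\<^sup>2 \<omega>(Q \<inter> E)\<close> by a multiple of \<open>\<omega>(E)\<^sup>1\<^sup>-\<^sup>2\<^sup>/\<^sup>q\<close>; here one groups by the sizes of
  \<open>A(Q)\<close> and \<open>\<omega>(Q \<inter> E)/\<omega>(Q)\<close> as well and is left with \<open>\<Sum>\<^sub>m 2\<^sup>2\<^sup>m \<Sum>\<^sub>R \<sigma>(R)\<^sup>2\<^sup>/\<^sup>p \<omega>(R)\<^sup>1\<^sup>-\<^sup>2\<^sup>/\<^sup>q\<close> over maximal cubes.  If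
  \<open>p \<le> 2\<close>, this is summed directly; if \<open>p > 2\<close>, Hoelder's inequality in \<open>(m, R)\<close> leaves a Carleson sum for
  \<open>\<omega>\<close>, raised to the power \<open>1 - 2/p\<close>, which accounts for the \<open>A\<^sub>\<infinity>\<close> constant.
\<close>

subsection \<open>Geometric sums and superadditive set functions\<close>

text \<open>The sum of the geometric series with ratio \<open>2 powr (- \<theta>)\<close>: the price
  of one summation over dyadic levels.\<close>

definition geo :: "real \<Rightarrow> real" where
  "geo \<theta> = 1 / (1 - 2 powr (- \<theta>))"

lemma geo_pos: "\<theta> > 0 \<Longrightarrow> geo \<theta> > 0"
  by (simp add: geo_def powr_less_one)

text \<open>The numbers \<open>n - i\<close> are distinct naturals, so after factoring out
  \<open>2 powr (\<theta> * n)\<close> a subsum of the geometric series remains.\<close>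

lemma sum_powr_le_geo:
  fixes I :: "int set"
  assumes "finite I" "\<And>i. i \<in> I \<Longrightarrow> i \<le> n" "\<theta> > 0"
  shows "(\<Sum>i\<in>I. 2 powr (\<theta> * of_int i)) \<le> geo \<theta> * 2 powr (\<theta> * of_int n)"
proof -
  define r :: real where "r = 2 powr (- \<theta>)"
  have r: "0 \<le> r" "r < 1" using assms(3) by (auto simp: r_def powr_less_one)
  have term_eq: "2 powr (\<theta> * of_int i) = 2 powr (\<theta> * of_int n) * r ^ nat (n - i)" if "i \<in> I" for i
  proof -
    have "r ^ nat (n - i) = r powr real (nat (n - i))"
      by (rule powr_realpow[symmetric]) (simp add: r_def)
    also have "\<dots> = 2 powr (- \<theta> * of_int (n - i))"
      using assms(2)[OF that] by (simp add: r_def powr_powr)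
    finally have "2 powr (\<theta> * of_int n) * r ^ nat (n - i) = 2 powr (\<theta> * of_int n + - \<theta> * of_int (n - i))"
      by (metis powr_add)
    also have "\<theta> * of_int n + - \<theta> * of_int (n - i) = \<theta> * of_int i"
      by (simp add: algebra_simps)
    finally show ?thesis by simp
  qed
  have inj: "inj_on (\<lambda>i. nat (n - i)) I" using assms(2)
    by (metis (mono_tags, lifting) inj_onI diff_ge_0_iff_ge eq_nat_nat_iff diff_left_imp_eq)
  have "(\<Sum>i\<in>I. r ^ nat (n - i)) = (\<Sum>k\<in>(\<lambda>i. nat (n - i)) ` I. r ^ k)"
    by (simp add: sum.reindex[OF inj])
  also have "\<dots> \<le> (\<Sum>k. r ^ k)"
    using r assms(1) by (intro sum_le_suminf summable_geometric) auto
  also have "\<dots> = geo \<theta>" using r by (simp add: suminf_geometric geo_def r_def)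
  finally have "(\<Sum>i\<in>I. r ^ nat (n - i)) \<le> geo \<theta>" .
  then have "2 powr (\<theta> * of_int n) * (\<Sum>i\<in>I. r ^ nat (n - i)) \<le> 2 powr (\<theta> * of_int n) * geo \<theta>"
    by (intro mult_left_mono) auto
  moreover have "(\<Sum>i\<in>I. 2 powr (\<theta> * of_int i)) = 2 powr (\<theta> * of_int n) * (\<Sum>i\<in>I. r ^ nat (n - i))"
    unfolding sum_distrib_left by (rule sum.cong[OF refl term_eq])
  ultimately show ?thesis by (simp add: mult.commute)
qed

text \<open>Class bounds that grow geometrically with the level are dominated by the top level,
  however many levels occur.\<close>

lemma sum_levels_le_geo:
  fixes l :: "'a \<Rightarrow> int"
  assumes "finite A" "\<And>x. x \<in> A \<Longrightarrow> l x \<le> n" "\<theta> > 0" "B \<ge> 0"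
    and "\<And>k. k \<in> l ` A \<Longrightarrow> (\<Sum>x\<in>{x\<in>A. l x = k}. g x) \<le> B * 2 powr (\<theta> * of_int k)"
  shows "(\<Sum>x\<in>A. g x) \<le> B * geo \<theta> * 2 powr (\<theta> * of_int n)"
proof -
  have "(\<Sum>x\<in>A. g x) = (\<Sum>k\<in>l ` A. \<Sum>x\<in>{x\<in>A. l x = k}. g x)"
    by (rule sum.image_gen[OF assms(1)])
  also have "\<dots> \<le> (\<Sum>k\<in>l ` A. B * 2 powr (\<theta> * of_int k))" by (intro sum_mono assms(5))
  also have "\<dots> \<le> B * (geo \<theta> * 2 powr (\<theta> * of_int n))"
    unfolding sum_distrib_left[symmetric]
    by (intro mult_left_mono sum_powr_le_geo) (use assms in auto)
  finally show ?thesis by (simp add: mult.assoc)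
qed

section \<open>Dyadic levels of positive numbers\<close>

definition level :: "real \<Rightarrow> int" where
  "level y = \<lfloor>log 2 y\<rfloor>"

lemma level_bounds:
  assumes "y > 0"
  shows "2 powr of_int (level y) \<le> y" "y < 2 * 2 powr of_int (level y)"
proof -
  have "of_int (level y) \<le> log 2 y" "log 2 y < of_int (level y) + 1"
    by (auto simp: level_def)
  then have "2 powr of_int (level y) \<le> 2 powr log 2 y" "2 powr log 2 y < 2 powr (of_int (level y) + 1)"
    by (auto intro: powr_mono)
  then show "2 powr of_int (level y) \<le> y" "y < 2 * 2 powr of_int (level y)"
    using assms by (auto simp: powr_add)
qed

lemma level_mono: "0 < x \<Longrightarrow> x \<le> y \<Longrightarrow> level x \<le> level y"
  by (simp add: level_def floor_mono)

text \<open>Young's inequality applies to the exponents rescaled to total 1. The resulting product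
  \<open>?z\<close> is at most 1, so raising it to the power \<open>a + b \<ge> 1\<close> can only
  decrease it.\<close>

lemma powr_mult_powr_le_sum:
  fixes x y a b :: real
  assumes "0 < x" "x \<le> 1" "0 < y" "y \<le> 1" "0 \<le> a" "0 \<le> b" "a + b \<ge> 1"
  shows "x powr a * y powr b \<le> (a / (a + b)) * x + (b / (a + b)) * y"
proof -
  let ?c = "a + b"
  let ?z = "x powr (a / ?c) * y powr (b / ?c)"
  have z: "?z \<le> (a / ?c) * x + (b / ?c) * y"
    using assms by (intro Youngs_inequality_0) (auto simp: add_divide_distrib[symmetric])
  have "?z \<le> 1 * 1" by (intro mult_mono powr_le1) (use assms in auto)
  then have z1: "0 \<le> ?z" "?z \<le> 1" by auto
  have "x powr a * y powr b = ?z powr ?c"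
    using assms by (simp add: powr_mult powr_powr)
  also have "\<dots> \<le> ?z powr 1"
  proof (cases "?z = 0")
    case False
    then show ?thesis using z1 assms(7) by (intro powr_mono') auto
  qed auto
  finally show ?thesis using z z1 by simp
qed

text \<open>Hoelder's inequality with exponents of total at least 1 rather than exactly 1: for sums
  the surplus is harmless, because a single term never exceeds the total.\<close>

lemma sum_powr_mult_powr_le:
  fixes x y :: "'a \<Rightarrow> real"
  assumes "finite I" "\<And>i. i \<in> I \<Longrightarrow> 0 < x i" "\<And>i. i \<in> I \<Longrightarrow> 0 < y i"
    and "0 \<le> a" "0 \<le> b" "a + b \<ge> 1"
  shows "(\<Sum>i\<in>I. x i powr a * y i powr b) \<le> (\<Sum>i\<in>I. x i) powr a * (\<Sum>i\<in>I. y i) powr b"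
proof (cases "I = {}")
  case False
  define X where "X = (\<Sum>i\<in>I. x i)"
  define Y where "Y = (\<Sum>i\<in>I. y i)"
  have pos: "X > 0" "Y > 0" unfolding X_def Y_def using assms False by (auto intro: sum_pos)
  have le: "x i \<le> X" "y i \<le> Y" if "i \<in> I" for i
    unfolding X_def Y_def by (rule member_le_sum; use that assms in \<open>auto intro: less_imp_le\<close>)+
  \<comment> \<open>Dividing by the totals brings every factor into (0, 1], where the pointwise
    inequality applies; its right-hand sides add up to exactly 1.\<close>
  have "(\<Sum>i\<in>I. (x i / X) powr a * (y i / Y) powr b)
      \<le> (\<Sum>i\<in>I. (a / (a + b)) * (x i / X) + (b / (a + b)) * (y i / Y))"
    using assms pos le by (intro sum_mono powr_mult_powr_le_sum) (auto simp: less_imp_le)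
  also have "\<dots> = (a / (a + b)) * (X / X) + (b / (a + b)) * (Y / Y)"
    unfolding sum.distrib sum_distrib_left[symmetric] sum_divide_distrib[symmetric]
    by (simp only: X_def[symmetric] Y_def[symmetric])
  also have "\<dots> = 1" using pos assms by (simp flip: add_divide_distrib)
  finally have "(\<Sum>i\<in>I. x i powr a * y i powr b) / (X powr a * Y powr b) \<le> 1"
    using assms pos by (simp add: powr_divide less_imp_le sum_divide_distrib cong: sum.cong)
  then show ?thesis using pos unfolding X_def[symmetric] Y_def[symmetric]
    by (simp add: divide_le_eq)
qed auto

lemma sum_powr_le_powr_sum:
  fixes x :: "'a \<Rightarrow> real"
  assumes "finite I" "\<And>i. i \<in> I \<Longrightarrow> 0 \<le> x i" "1 \<le> s"
  shows "(\<Sum>i\<in>I. x i powr s) \<le> (\<Sum>i\<in>I. x i) powr s"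
proof -
  \<comment> \<open>Hoelder's inequality above wants positive terms; on \<open>J\<close> the factor
    with exponent 0 is 1.\<close>
  define J where "J = {i\<in>I. x i > 0}"
  have "(\<Sum>i\<in>I. x i powr s) = (\<Sum>i\<in>J. x i powr s * x i powr 0)"
    using assms by (intro sum.mono_neutral_cong_right) (auto simp: J_def less_le)
  also have "\<dots> \<le> (\<Sum>i\<in>J. x i) powr s * (\<Sum>i\<in>J. x i) powr 0"
    using assms by (intro sum_powr_mult_powr_le) (auto simp: J_def)
  also have "\<dots> \<le> (\<Sum>i\<in>J. x i) powr s" by simp
  also have "(\<Sum>i\<in>J. x i) = (\<Sum>i\<in>I. x i)"
    using assms by (intro sum.mono_neutral_cong_left) (auto simp: J_def less_le)
  finally show ?thesis .
qed

text \<open>The trait of measures on which the discrete estimates rest. Unlike additivity, it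
  survives the products of powers that occur for \<open>q > 2\<close>.\<close>

definition superadditive :: "'a set set \<Rightarrow> ('a set \<Rightarrow> real) \<Rightarrow> bool" where
  "superadditive D v \<longleftrightarrow> (\<forall>Q\<in>D. 0 \<le> v Q) \<and>
     (\<forall>\<A> R. finite \<A> \<and> \<A> \<subseteq> D \<and> disjoint \<A> \<and> R \<in> D \<and> \<Union>\<A> \<subseteq> R \<longrightarrow> sum v \<A> \<le> v R)"

lemma superadditiveD:
  assumes "superadditive D v" "finite \<A>" "\<A> \<subseteq> D" "disjoint \<A>" "R \<in> D" "\<And>Q. Q \<in> \<A> \<Longrightarrow> Q \<subseteq> R"
  shows "sum v \<A> \<le> v R"
  using assms by (auto simp: superadditive_def Union_least)

text \<open>Hoelder's inequality over the family, then superadditivity of each factor.\<close>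

lemma superadditive_powr_mult_powr:
  assumes "superadditive D u" "superadditive D v" "\<And>Q. Q \<in> D \<Longrightarrow> 0 < u Q" "\<And>Q. Q \<in> D \<Longrightarrow> 0 < v Q"
    and "0 \<le> a" "0 \<le> b" "a + b \<ge> 1"
  shows "superadditive D (\<lambda>Q. u Q powr a * v Q powr b)"
  unfolding superadditive_def
proof (intro conjI ballI allI impI)
  fix \<A> R assume A: "finite \<A> \<and> \<A> \<subseteq> D \<and> disjoint \<A> \<and> R \<in> D \<and> \<Union>\<A> \<subseteq> R"
  have "(\<Sum>Q\<in>\<A>. u Q powr a * v Q powr b) \<le> sum u \<A> powr a * sum v \<A> powr b"
    using A assms by (intro sum_powr_mult_powr_le) auto
  also have "\<dots> \<le> u R powr a * v R powr b"
  proof (intro mult_mono powr_mono2)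
    show "sum u \<A> \<le> u R" "sum v \<A> \<le> v R"
      using A by (auto intro: superadditiveD[OF assms(1)] superadditiveD[OF assms(2)])
    show "0 \<le> sum u \<A>" "0 \<le> sum v \<A>"
      using A assms(3,4) by (auto intro!: sum_nonneg dest!: subsetD less_imp_le)
  qed (use assms in auto)
  finally show "(\<Sum>Q\<in>\<A>. u Q powr a * v Q powr b) \<le> u R powr a * v R powr b" .
qed auto

section \<open>Maximal members of a finite family of sets\<close>

definition maximal_sets :: "'a set set \<Rightarrow> 'a set set" where
  "maximal_sets \<A> = {R\<in>\<A>. \<forall>Q\<in>\<A>. R \<subseteq> Q \<longrightarrow> Q = R}"

lemma maximal_sets_subset: "maximal_sets \<A> \<subseteq> \<A>"
  by (auto simp: maximal_sets_def)

lemma maximal_sets_above: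
  assumes "finite \<A>" "Q \<in> \<A>"
  obtains R where "R \<in> maximal_sets \<A>" "Q \<subseteq> R"
proof -
  obtain R where R: "R \<in> \<A>" "Q \<subseteq> R" "\<forall>X\<in>\<A>. R \<subseteq> X \<longrightarrow> R = X"
    using finite_has_maximal2[OF assms] by auto
  show ?thesis
    by (rule that[of R]) (use R in \<open>auto simp: maximal_sets_def\<close>)
qed

text \<open>Every member lies below some maximal one. In general it may lie below several, hence an
  inequality, and for nonnegative terms.\<close>

lemma sum_le_sum_maximal_sets:
  fixes g :: "'a set \<Rightarrow> real"
  assumes "finite \<A>" "\<And>Q. Q \<in> \<A> \<Longrightarrow> 0 \<le> g Q"
  shows "sum g \<A> \<le> (\<Sum>R\<in>maximal_sets \<A>. \<Sum>Q\<in>{Q\<in>\<A>. Q \<subseteq> R}. g Q)"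
proof -
  have fin: "finite (maximal_sets \<A>)" using assms(1) finite_subset maximal_sets_subset by metis
  have "g Q \<le> (\<Sum>R\<in>{R\<in>maximal_sets \<A>. Q \<subseteq> R}. g Q)" if Q: "Q \<in> \<A>" for Q
  proof -
    obtain R where R: "R \<in> maximal_sets \<A>" "Q \<subseteq> R"
      by (rule maximal_sets_above[OF assms(1) Q])
    show ?thesis
      by (rule member_le_sum[of R]) (use R fin assms(2)[OF Q] in auto)
  qed
  then have "sum g \<A> \<le> (\<Sum>Q\<in>\<A>. \<Sum>R\<in>{R\<in>maximal_sets \<A>. Q \<subseteq> R}. g Q)"
    by (rule sum_mono)
  also have "\<dots> = (\<Sum>R\<in>maximal_sets \<A>. \<Sum>Q\<in>{Q\<in>\<A>. Q \<subseteq> R}. g Q)"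
    by (rule sum.swap_restrict[OF assms(1) fin])
  finally show ?thesis .
qed

subsection \<open>Dyadic cubes\<close>

lemma box_subset_cube: "box a (\<chi> i. a $ i + l) \<subseteq> cube a l"
  and cube_subset_cbox: "cube a l \<subseteq> cbox a (\<chi> i. a $ i + l)"
  by (auto simp: cube_def mem_box_cart less_imp_le)

lemma cube_borel: "cube a l \<in> sets borel"
proof -
  have "cube a l = (\<Inter>i. {x. a $ i \<le> x $ i} \<inter> {x. x $ i < a $ i + l})"
    by (auto simp: cube_def)
  moreover have "{x. a $ i \<le> x $ i} \<in> sets borel" "{x. x $ i < a $ i + l} \<in> sets borel" for i
    by (auto intro!: borel_closed borel_open closed_halfspace_component_ge_cart open_halfspace_component_lt_cart
        closed_Collect_le open_Collect_less continuous_intros)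
  ultimately show ?thesis by (auto intro!: sets.countable_INT')
qed

text \<open>The half-open cube is squeezed between the open and the closed box, which have equal
  volume.\<close>

lemma emeasure_cube:
  fixes a :: "real ^ 'n"
  assumes "0 < l"
  shows "emeasure lebesgue (cube a l) = ennreal (l ^ CARD('n))"
proof -
  let ?b = "\<chi> i. a $ i + l"
  have ne: "cbox a ?b \<noteq> {}" using assms by (auto simp: interval_ne_empty_cart)
  have "measure lebesgue (cbox a ?b) = (\<Prod>i\<in>UNIV. ?b $ i - a $ i)"
    using content_cbox_cart[OF ne] by simp
  also have "\<dots> = l ^ CARD('n)" by simp
  finally have c: "measure lebesgue (cbox a ?b) = l ^ CARD('n)" .
  have cb: "emeasure lebesgue (cbox a ?b) = ennreal (l ^ CARD('n))"
    by (subst emeasure_eq_ennreal_measure) (auto simp: c[symmetric] emeasure_lborel_cbox_eq)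
  have bx: "emeasure lebesgue (box a ?b) = emeasure lebesgue (cbox a ?b)"
    by (simp add: emeasure_lborel_box_eq emeasure_lborel_cbox_eq)
  have "emeasure lebesgue (cube a l) \<le> emeasure lebesgue (cbox a ?b)"
    by (intro emeasure_mono cube_subset_cbox) auto
  moreover have "emeasure lebesgue (box a ?b) \<le> emeasure lebesgue (cube a l)"
    by (intro emeasure_mono box_subset_cube sets_completionI_sets) (simp add: cube_borel)
  ultimately show ?thesis using cb bx by (metis antisym)
qed

lemma dyadic_grid_cube: "dyadic_grid D \<Longrightarrow> Q \<in> D \<Longrightarrow> \<exists>a. \<exists>k::int. Q = cube a (2 powi k)"
  by (simp add: dyadic_grid_def)

locale dyadic_lattice =
  fixes D :: "(real ^ 'n) set set"
  assumes grid: "dyadic_grid D"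
begin

text \<open>The binary logarithm of the side length. The choice is harmless, since the volume of the
  cube determines it.\<close>

definition generation :: "(real ^ 'n) set \<Rightarrow> int" where
  "generation Q = (SOME k. \<exists>a. Q = cube a (2 powi k))"

lemma cube_generation:
  assumes "Q \<in> D"
  obtains a where "Q = cube a (2 powi (generation Q))"
proof -
  have "\<exists>k::int. \<exists>a. Q = cube a (2 powi k)" using dyadic_grid_cube[OF grid assms] by blast
  then have "\<exists>a. Q = cube a (2 powi (generation Q))"
    unfolding generation_def by (rule someI_ex)
  then show ?thesis using that by blast
qed

lemma sets_D: "Q \<in> D \<Longrightarrow> Q \<in> sets lebesgue"
  by (metis cube_generation cube_borel sets_completionI_sets sets_lborel)

lemma emeasure_D: "Q \<in> D \<Longrightarrow> emeasure lebesgue Q = ennreal (2 powr (real CARD('n) * of_int (generation Q)))"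
proof -
  assume "Q \<in> D"
  then obtain a where a: "Q = cube a (2 powi (generation Q))" by (rule cube_generation)
  have "emeasure lebesgue Q = ennreal ((2 powi (generation Q)) ^ CARD('n))"
    by (subst a) (simp add: emeasure_cube)
  also have "(2 powi (generation Q) :: real) ^ CARD('n) = 2 powr (real CARD('n) * of_int (generation Q))"
    by (simp add: powr_real_of_int'[symmetric] powr_powr mult.commute flip: powr_realpow)
  finally show ?thesis .
qed

lemma measure_D: "Q \<in> D \<Longrightarrow> measure lebesgue Q = 2 powr (real CARD('n) * of_int (generation Q))"
  by (simp add: measure_def emeasure_D)

lemma measure_D_pos: "Q \<in> D \<Longrightarrow> 0 < measure lebesgue Q"
  by (simp add: measure_D)

lemma emeasure_D_eq: "Q \<in> D \<Longrightarrow> emeasure lebesgue Q = ennreal (measure lebesgue Q)"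
  by (simp add: emeasure_D measure_D)

lemma D_nonempty: "D \<noteq> {}"
proof -
  have "partition_on UNIV {Q\<in>D. \<exists>a. Q = cube a (2 powi (0::int))}"
    using grid unfolding dyadic_grid_def by blast
  then have "\<Union>{Q\<in>D. \<exists>a. Q = cube a (2 powi (0::int))} = UNIV" by (simp add: partition_on_def)
  then show ?thesis by auto
qed

lemma nested_D: "Q \<in> D \<Longrightarrow> R \<in> D \<Longrightarrow> Q \<inter> R \<noteq> {} \<Longrightarrow> Q \<subseteq> R \<or> R \<subseteq> Q"
  using grid unfolding dyadic_grid_def by blast

lemma same_generation_D:
  assumes "Q \<in> D" "R \<in> D" "generation Q = generation R" "Q \<inter> R \<noteq> {}"
  shows "Q = R"
proof -
  let ?P = "{X\<in>D. \<exists>a. X = cube a (2 powi (generation Q))}"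
  have "partition_on UNIV ?P" using grid unfolding dyadic_grid_def by blast
  then have "disjoint ?P" by (simp add: partition_on_def)
  moreover obtain a where "Q = cube a (2 powi (generation Q))"
    by (rule cube_generation[OF assms(1)])
  then have "Q \<in> ?P" using assms(1) by blast
  moreover obtain b where "R = cube b (2 powi (generation R))"
    by (rule cube_generation[OF assms(2)])
  then have "R \<in> ?P" using assms(2,3) by auto
  ultimately show ?thesis using assms(4) by (meson disjointD)
qed

lemma generation_mono:
  assumes "Q \<in> D" "R \<in> D" "Q \<subseteq> R"
  shows "generation Q \<le> generation R"
proof -
  have "measure lebesgue Q \<le> measure lebesgue R"
    unfolding measure_def
    by (intro enn2real_mono emeasure_mono assms(3) sets_D assms(2)) (simp add: emeasure_D assms(2))
  then show ?thesis using assms by (simp add: measure_D mult_le_cancel_left_pos)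
qed

lemma disjoint_generation: "\<A> \<subseteq> D \<Longrightarrow> disjoint {Q\<in>\<A>. generation Q = k}"
  by (rule disjointI) (use same_generation_D in auto)

text \<open>Dyadic cubes that meet are nested, and of two nested cubes only the larger can be
  maximal.\<close>

lemma disjoint_maximal_sets: "\<A> \<subseteq> D \<Longrightarrow> disjoint (maximal_sets \<A>)"
proof (rule disjointI)
  fix Q R assume A: "\<A> \<subseteq> D" and QR: "Q \<in> maximal_sets \<A>" "R \<in> maximal_sets \<A>" "Q \<noteq> R"
  then have "\<not> Q \<subseteq> R" "\<not> R \<subseteq> Q" by (auto simp: maximal_sets_def)
  then show "Q \<inter> R = {}"
    using nested_D[of Q R] QR A maximal_sets_subset[of \<A>] by blast
qed

text \<open>A generation consists of disjoint cubes with nonempty interior. Countability later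
  permits exhaustion by finite collections.\<close>

lemma countable_D: "countable D"
proof -
  have "D \<subseteq> (\<Union>k. {Q\<in>D. generation Q = k})" by auto
  moreover have "countable {Q\<in>D. generation Q = k}" for k
  proof (rule countable_disjoint_nonempty_interior_subsets)
    show "pairwise disjnt {Q\<in>D. generation Q = k}" by (rule disjoint_generation) simp
    fix Q assume Q: "Q \<in> {Q\<in>D. generation Q = k}" and e: "interior Q = {}"
    obtain a where a: "Q = cube a (2 powi k)" using Q cube_generation by auto
    have "box a (\<chi> i. a $ i + 2 powi k) \<subseteq> interior Q"
      unfolding a by (intro interior_maximal box_subset_cube open_box)
    moreover have "box a (\<chi> i. a $ i + 2 powi k) \<noteq> {}" by (simp add: interval_ne_empty_cart)
    ultimately show "Q = {}" using e by blast
  qed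
  then have "countable (\<Union>k. {Q\<in>D. generation Q = k})" by (intro countable_UN) auto
  ultimately show ?thesis by (rule countable_subset)
qed

text \<open>A nontrivial power of the volume makes the contributions of successive generations decay
  geometrically.\<close>

lemma packing:
  assumes "superadditive D v" "R \<in> D" "finite \<A>" "\<A> \<subseteq> D" "\<And>Q. Q \<in> \<A> \<Longrightarrow> Q \<subseteq> R" "0 < \<epsilon>"
  shows "(\<Sum>Q\<in>\<A>. measure lebesgue Q powr \<epsilon> * v Q)
    \<le> geo (real CARD('n) * \<epsilon>) * measure lebesgue R powr \<epsilon> * v R"
proof -
  let ?\<theta> = "real CARD('n) * \<epsilon>"
  have vol: "measure lebesgue Q powr \<epsilon> = 2 powr (?\<theta> * of_int (generation Q))" if "Q \<in> D" for Q
    using that by (simp add: measure_D powr_powr mult.commute mult.left_commute)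
  have "(\<Sum>Q\<in>\<A>. measure lebesgue Q powr \<epsilon> * v Q) \<le> v R * geo ?\<theta> * 2 powr (?\<theta> * of_int (generation R))"
  proof (rule sum_levels_le_geo[where l = generation])
    show "generation Q \<le> generation R" if "Q \<in> \<A>" for Q using that assms by (intro generation_mono) auto
    show "0 \<le> v R" using assms(1,2) by (simp add: superadditive_def)
    fix k
    \<comment> \<open>Cubes of one generation share their volume and are disjoint, so
      superadditivity bounds their total by \<open>v R\<close>.\<close>
    have "(\<Sum>Q\<in>{Q\<in>\<A>. generation Q = k}. measure lebesgue Q powr \<epsilon> * v Q)
        = (\<Sum>Q\<in>{Q\<in>\<A>. generation Q = k}. 2 powr (?\<theta> * of_int k) * v Q)"
      using assms(4) by (intro sum.cong) (auto simp: vol subset_iff)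
    also have "\<dots> = 2 powr (?\<theta> * of_int k) * sum v {Q\<in>\<A>. generation Q = k}"
      by (simp add: sum_distrib_left)
    also have "\<dots> \<le> 2 powr (?\<theta> * of_int k) * v R"
      using assms disjoint_generation[OF assms(4)]
      by (intro mult_left_mono superadditiveD[OF assms(1)]) auto
    finally show "(\<Sum>Q\<in>{Q\<in>\<A>. generation Q = k}. measure lebesgue Q powr \<epsilon> * v Q)
        \<le> v R * 2 powr (?\<theta> * of_int k)" by (simp add: mult.commute)
  qed (use assms in auto)
  then show ?thesis using vol[OF assms(2)] by (simp add: mult_ac)
qed

end

subsection \<open>Discrete weak-type estimates\<close>

text \<open>The first two factors are lost in packing the cubes of a class; \<open>2 powr q\<close>
  is lost in replacing \<open>F / \<sigma>\<close> by its dyadic level.\<close>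

definition low_const :: "real \<Rightarrow> real \<Rightarrow> real \<Rightarrow> real \<Rightarrow> real" where
  "low_const d p q \<beta> = 2 powr (q / p - 1) * geo (d * (\<beta> * (q / p - 1))) * 2 powr q"

text \<open>The discrete problem. On cubes, \<open>\<sigma>\<close> and \<open>\<omega>\<close> will
  be the masses of \<open>w powr (- conj_exp p)\<close> and \<open>w powr q\<close>,
  \<open>F\<close> the mass of \<open>f\<close> divided by the height of the level set, and
  \<open>K\<close> the q-th root of the A_(p,q) constant. The norm of \<open>f\<close> enters only
  through \<open>N\<close>, by way of \<open>level_sum\<close>: disjoint families at different
  levels of \<open>F / \<sigma>\<close> share one budget.\<close>

locale fractional_setting = dyadic_lattice D
  for D :: "(real ^ 'n) set set" +
  fixes \<sigma> \<omega> F :: "(real ^ 'n) set \<Rightarrow> real" and p q \<beta> K N :: real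
  assumes superadditive_\<sigma>: "superadditive D \<sigma>" and superadditive_\<omega>: "superadditive D \<omega>"
    and superadditive_F: "superadditive D F"
    and \<sigma>_pos: "\<And>Q. Q \<in> D \<Longrightarrow> 0 < \<sigma> Q" and \<omega>_pos: "\<And>Q. Q \<in> D \<Longrightarrow> 0 < \<omega> Q"
    and exponents: "1 < p" "p < q" "\<beta> = 1 - 1 / p + 1 / q" "\<beta> < 1"
    and K_pos: "0 < K" and N_nonneg: "0 \<le> N"
    and two_weight: "\<And>Q. Q \<in> D \<Longrightarrow>
      measure lebesgue Q powr (- \<beta>) * \<sigma> Q powr (1 - 1 / p) * \<omega> Q powr (1 / q) \<le> K"
    and level_sum: "\<And>M \<P>. finite M \<Longrightarrow> (\<And>m. m \<in> M \<Longrightarrow> finite (\<P> m) \<and> \<P> m \<subseteq> D \<and> disjoint (\<P> m))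
      \<Longrightarrow> (\<And>m Q. m \<in> M \<Longrightarrow> Q \<in> \<P> m \<Longrightarrow> 2 powr of_int m * \<sigma> Q \<le> F Q)
      \<Longrightarrow> (\<Sum>m\<in>M. \<Sum>Q\<in>\<P> m. 2 powr (p * of_int m) * \<sigma> Q) \<le> N"
begin

abbreviation vol :: "(real ^ 'n) set \<Rightarrow> real" where
  "vol Q \<equiv> measure lebesgue Q"

definition favg :: "(real ^ 'n) set \<Rightarrow> real" where
  "favg Q = vol Q powr (- \<beta>) * F Q"

text \<open>The q-th root of the A_(p,q) quotient at a single cube.\<close>

definition two_weight_at :: "(real ^ 'n) set \<Rightarrow> real" where
  "two_weight_at Q = vol Q powr (- \<beta>) * \<sigma> Q powr (1 - 1 / p) * \<omega> Q powr (1 / q)"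

lemma F_nonneg: "Q \<in> D \<Longrightarrow> 0 \<le> F Q"
  using superadditive_F by (simp add: superadditive_def)

lemma \<beta>_pos: "0 < \<beta>"
proof -
  have "1 / p < 1" "0 < 1 / q" using exponents by auto
  then show ?thesis using exponents by linarith
qed

lemma two_weight_at_pos: "Q \<in> D \<Longrightarrow> 0 < two_weight_at Q"
  unfolding two_weight_at_def using \<sigma>_pos \<omega>_pos measure_D_pos by (metis mult_pos_pos powr_gt_zero less_irrefl)

lemma two_weight_at_le: "Q \<in> D \<Longrightarrow> two_weight_at Q \<le> K"
  unfolding two_weight_at_def by (rule two_weight)

lemma favg_pos: "Q \<in> D \<Longrightarrow> 0 < F Q \<Longrightarrow> 0 < favg Q"
  using measure_D_pos[of Q] by (simp add: favg_def)

text \<open>For \<open>s \<ge> 1\<close> a sum of powers is at most the power of the sum. The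
  exponents to come are \<open>q / p\<close> and, when \<open>p \<le> 2\<close>,
  \<open>2 / p\<close>.\<close>

lemma sum_powr_levels_le:
  assumes "finite M" "\<And>m. m \<in> M \<Longrightarrow> finite (\<P> m) \<and> \<P> m \<subseteq> D \<and> disjoint (\<P> m)"
    and "\<And>m Q. m \<in> M \<Longrightarrow> Q \<in> \<P> m \<Longrightarrow> 2 powr of_int m * \<sigma> Q \<le> F Q" and "1 \<le> s"
  shows "(\<Sum>m\<in>M. (\<Sum>Q\<in>\<P> m. 2 powr (p * of_int m) * \<sigma> Q) powr s) \<le> N powr s"
proof -
  have nonneg: "0 \<le> (\<Sum>Q\<in>\<P> m. 2 powr (p * of_int m) * \<sigma> Q)" if "m \<in> M" for m
    using assms(2)[OF that] by (intro sum_nonneg mult_nonneg_nonneg less_imp_le[OF \<sigma>_pos]) auto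
  have "(\<Sum>m\<in>M. (\<Sum>Q\<in>\<P> m. 2 powr (p * of_int m) * \<sigma> Q) powr s)
      \<le> (\<Sum>m\<in>M. \<Sum>Q\<in>\<P> m. 2 powr (p * of_int m) * \<sigma> Q) powr s"
    using assms(1,4) nonneg by (intro sum_powr_le_powr_sum)
  also have "\<dots> \<le> N powr s"
    using assms(4) by (intro powr_mono2 level_sum assms sum_nonneg nonneg) auto
  finally show ?thesis .
qed

lemma sum_sum_powr_levels_le:
  assumes "finite M" "\<And>m. m \<in> M \<Longrightarrow> finite (\<P> m) \<and> \<P> m \<subseteq> D \<and> disjoint (\<P> m)"
    and "\<And>m Q. m \<in> M \<Longrightarrow> Q \<in> \<P> m \<Longrightarrow> 2 powr of_int m * \<sigma> Q \<le> F Q" and "1 \<le> s"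
  shows "(\<Sum>m\<in>M. \<Sum>Q\<in>\<P> m. (2 powr (p * of_int m) * \<sigma> Q) powr s) \<le> N powr s"
proof -
  have "(\<Sum>m\<in>M. \<Sum>Q\<in>\<P> m. (2 powr (p * of_int m) * \<sigma> Q) powr s)
      \<le> (\<Sum>m\<in>M. (\<Sum>Q\<in>\<P> m. 2 powr (p * of_int m) * \<sigma> Q) powr s)"
  proof (intro sum_mono sum_powr_le_powr_sum)
    fix m Q assume "m \<in> M" "Q \<in> \<P> m"
    then have "Q \<in> D" using assms(2) by auto
    then show "0 \<le> 2 powr (p * of_int m) * \<sigma> Q" using \<sigma>_pos by (simp add: less_imp_le)
  qed (use assms in auto)
  also have "\<dots> \<le> N powr s" by (rule sum_powr_levels_le) (use assms in auto)
  finally show ?thesis .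
qed

definition ratio_level :: "(real ^ 'n) set \<Rightarrow> int" where
  "ratio_level Q = level (F Q / \<sigma> Q)"

lemma ratio_level_bounds:
  assumes "Q \<in> D" "0 < F Q"
  shows "2 powr of_int (ratio_level Q) * \<sigma> Q \<le> F Q" "F Q \<le> 2 * 2 powr of_int (ratio_level Q) * \<sigma> Q"
  using level_bounds[of "F Q / \<sigma> Q"] assms \<sigma>_pos[OF assms(1)]
  by (auto simp: ratio_level_def field_simps)

text \<open>The maximal cubes of the ratio classes are an admissible input for
  \<open>level_sum\<close>.\<close>

lemma ratio_class:
  assumes "finite \<A>" "\<A> \<subseteq> D" "\<And>Q. Q \<in> \<A> \<Longrightarrow> 0 < F Q"
  defines "\<P> \<equiv> (\<lambda>m. maximal_sets {Q\<in>\<A>. ratio_level Q = m})"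
  shows "finite (\<P> m) \<and> \<P> m \<subseteq> D \<and> disjoint (\<P> m)"
    and "Q \<in> \<P> m \<Longrightarrow> 2 powr of_int m * \<sigma> Q \<le> F Q"
proof -
  have sub: "\<P> m \<subseteq> {Q\<in>\<A>. ratio_level Q = m}" unfolding \<P>_def by (rule maximal_sets_subset)
  have "disjoint (\<P> m)" unfolding \<P>_def using assms(2) by (intro disjoint_maximal_sets) auto
  moreover have "finite (\<P> m)" by (rule finite_subset[OF sub]) (use assms(1) in simp)
  moreover have "\<P> m \<subseteq> D" using sub assms(2) by auto
  ultimately show "finite (\<P> m) \<and> \<P> m \<subseteq> D \<and> disjoint (\<P> m)" by simp
  show "2 powr of_int m * \<sigma> Q \<le> F Q" if "Q \<in> \<P> m"
  proof -
    have "Q \<in> \<A>" "ratio_level Q = m" using subsetD[OF sub that] by auto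
    then show ?thesis using ratio_level_bounds(1)[of Q] assms(2,3) by auto
  qed
qed

subsection \<open>The case \<open>q < 2\<close>\<close>

text \<open>Splits off the A_(p,q) quantity. What remains is a power of \<open>F / \<sigma>\<close>,
  which the ratio level controls, and the power \<open>q / p > 1\<close> of
  \<open>F\<close>.\<close>

lemma favg_powr_eq:
  assumes "Q \<in> D" "0 < F Q"
  shows "favg Q powr q * \<omega> Q = two_weight_at Q powr q * (F Q / \<sigma> Q) powr (q * (1 - 1 / p)) * F Q powr (q / p)"
proof -
  have pos: "0 < vol Q" "0 < \<sigma> Q" "0 < \<omega> Q" "0 < F Q" "0 < p" "0 < q"
    using assms \<sigma>_pos \<omega>_pos measure_D_pos exponents by auto
  \<comment> \<open>Both sides are positive, so their logarithms may be compared; this is an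
    identity between exponents.\<close>
  show ?thesis
    by (rule ln_inj_iff[THEN iffD1])
      (use pos in \<open>simp_all add: favg_def two_weight_at_def ln_mult ln_powr ln_div field_simps\<close>)
qed

text \<open>With the level of the fractional average fixed, \<open>F Q\<close> is comparable to a
  constant times \<open>vol Q powr \<beta>\<close>. The surplus \<open>F Q powr (q / p - 1)\<close>
  becomes a positive power of the volume, so packing applies to the superadditive \<open>F\<close>;
  at the maximal cube the volume is turned back into \<open>F R\<close>.\<close>

lemma favg_powr_sum_class:
  assumes "finite \<A>" "\<A> \<subseteq> D" "\<And>Q. Q \<in> \<A> \<Longrightarrow> 0 < F Q"
    and k: "\<And>Q. Q \<in> \<A> \<Longrightarrow> level (favg Q) = k" and m: "\<And>Q. Q \<in> \<A> \<Longrightarrow> ratio_level Q = m"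
  shows "(\<Sum>Q\<in>\<A>. favg Q powr q * \<omega> Q)
    \<le> low_const (real CARD('n)) p q \<beta> * K powr q * (\<Sum>R\<in>maximal_sets \<A>. (2 powr (p * of_int m) * \<sigma> R) powr (q / p))"
proof -
  define s where "s = q / p - 1"
  define x :: real where "x = 2 powr of_int k"
  define y :: real where "y = 2 powr of_int m"
  define g where "g = geo (real CARD('n) * (\<beta> * s))"
  have s: "0 < s" using exponents by (simp add: s_def)
  have pq: "0 < p" "0 < q" "0 < 1 - 1 / p" using exponents by auto
  have g: "0 < g" using s \<beta>_pos by (auto simp: g_def intro!: geo_pos)
  have xy: "0 < x" "0 < y" by (auto simp: x_def y_def)
  have AD: "Q \<in> D" if "Q \<in> \<A>" for Q using that assms(2) by auto
  have fb: "x \<le> favg Q" "favg Q < 2 * x" if "Q \<in> \<A>" for Q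
    using level_bounds[OF favg_pos[OF AD[OF that] assms(3)[OF that]]] k[OF that] by (auto simp: x_def)
  have rb: "F Q \<le> 2 * y * \<sigma> Q" if "Q \<in> \<A>" for Q
    using ratio_level_bounds[OF AD[OF that] assms(3)[OF that]] m[OF that] by (auto simp: y_def)
  have FV: "x * vol Q powr \<beta> \<le> F Q" "F Q \<le> 2 * x * vol Q powr \<beta>" if "Q \<in> \<A>" for Q
  proof -
    have "F Q = favg Q * vol Q powr \<beta>"
      using measure_D_pos[OF AD[OF that]] by (simp add: favg_def powr_minus field_simps)
    then show "x * vol Q powr \<beta> \<le> F Q" "F Q \<le> 2 * x * vol Q powr \<beta>"
      using fb[OF that] by (auto intro!: mult_right_mono)
  qed
  have step1: "favg Q powr q * \<omega> Q \<le> K powr q * (2 * y) powr (q * (1 - 1 / p)) * F Q powr (q / p)"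
    if "Q \<in> \<A>" for Q
    unfolding favg_powr_eq[OF AD[OF that] assms(3)[OF that]]
    using two_weight_at_le[OF AD[OF that]] two_weight_at_pos[OF AD[OF that]] rb[OF that]
      \<sigma>_pos[OF AD[OF that]] assms(3)[OF that] pq
    by (intro mult_mono powr_mono2) (auto simp: field_simps)
  \<comment> \<open>The surplus exponent \<open>s\<close> is positive because
    \<open>p < q\<close>.\<close>
  have step2: "F Q powr (q / p) \<le> (2 * x) powr s * (vol Q powr (\<beta> * s) * F Q)" if "Q \<in> \<A>" for Q
  proof -
    have "F Q powr (q / p) = F Q powr s * F Q powr 1"
      unfolding powr_add[symmetric] by (simp add: s_def)
    also have "\<dots> \<le> (2 * x * vol Q powr \<beta>) powr s * F Q powr 1"
      using FV[OF that] assms(3)[OF that] s by (intro mult_right_mono powr_mono2) auto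
    finally show ?thesis using assms(3)[OF that] xy by (simp add: powr_mult powr_powr)
  qed
  \<comment> \<open>The size \<open>x\<close> of the averages cancels: it enters with the upper
    bound at \<open>Q\<close> and leaves with the lower bound at \<open>R\<close>.\<close>
  have step3: "(\<Sum>Q\<in>{Q\<in>\<A>. Q \<subseteq> R}. F Q powr (q / p)) \<le> 2 powr s * g * (2 * y * \<sigma> R) powr (q / p)"
    if R: "R \<in> \<A>" for R
  proof -
    have "(\<Sum>Q\<in>{Q\<in>\<A>. Q \<subseteq> R}. F Q powr (q / p))
        \<le> (\<Sum>Q\<in>{Q\<in>\<A>. Q \<subseteq> R}. (2 * x) powr s * (vol Q powr (\<beta> * s) * F Q))"
      by (intro sum_mono step2) auto
    also have "\<dots> = (2 * x) powr s * (\<Sum>Q\<in>{Q\<in>\<A>. Q \<subseteq> R}. vol Q powr (\<beta> * s) * F Q)"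
      by (simp add: sum_distrib_left)
    also have "\<dots> \<le> (2 * x) powr s * (g * vol R powr (\<beta> * s) * F R)"
      unfolding g_def using assms(1,2) s \<beta>_pos AD[OF R]
      by (intro mult_left_mono packing superadditive_F) auto
    also have "\<dots> = 2 powr s * g * ((x * vol R powr \<beta>) powr s * F R)"
      using xy by (simp add: powr_mult powr_powr)
    also have "\<dots> \<le> 2 powr s * g * (F R powr s * F R powr 1)"
      using FV[OF R] s xy assms(3)[OF R] g
      by (intro mult_left_mono mult_mono powr_mono2) auto
    also have "F R powr s * F R powr 1 = F R powr (q / p)"
      unfolding powr_add[symmetric] by (simp add: s_def)
    also have "2 powr s * g * F R powr (q / p) \<le> 2 powr s * g * (2 * y * \<sigma> R) powr (q / p)"
      using rb[OF R] assms(3)[OF R] pq s g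
      by (intro mult_left_mono powr_mono2) auto
    finally show ?thesis .
  qed
  let ?E = "K powr q * (2 * y) powr (q * (1 - 1 / p))"
  have "(\<Sum>Q\<in>\<A>. favg Q powr q * \<omega> Q) \<le> (\<Sum>Q\<in>\<A>. ?E * F Q powr (q / p))"
    by (intro sum_mono step1)
  also have "\<dots> = ?E * (\<Sum>Q\<in>\<A>. F Q powr (q / p))" by (simp add: sum_distrib_left)
  also have "\<dots> \<le> ?E * (\<Sum>R\<in>maximal_sets \<A>. \<Sum>Q\<in>{Q\<in>\<A>. Q \<subseteq> R}. F Q powr (q / p))"
    by (intro mult_left_mono sum_le_sum_maximal_sets assms(1)) auto
  also have "\<dots> \<le> ?E * (\<Sum>R\<in>maximal_sets \<A>. 2 powr s * g * (2 * y * \<sigma> R) powr (q / p))"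
    using maximal_sets_subset[of \<A>] by (intro mult_left_mono sum_mono step3) auto
  also have "\<dots> = (\<Sum>R\<in>maximal_sets \<A>. low_const (real CARD('n)) p q \<beta> * K powr q * (2 powr (p * of_int m) * \<sigma> R) powr (q / p))"
    unfolding sum_distrib_left
  proof (rule sum.cong[OF refl])
    fix R assume "R \<in> maximal_sets \<A>"
    then have sR: "0 < \<sigma> R" using maximal_sets_subset[of \<A>] AD \<sigma>_pos by auto
    \<comment> \<open>The exponents of \<open>2 * y\<close> add up to \<open>q\<close>, which
      produces the quantity of \<open>level_sum\<close> to the power \<open>q / p\<close>.\<close>
    have "(2 * y) powr (q * (1 - 1 / p)) * (2 * y * \<sigma> R) powr (q / p)
        = (2 * y) powr (q * (1 - 1 / p) + q / p) * \<sigma> R powr (q / p)"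
      using xy sR by (simp add: powr_mult powr_add)
    also have "q * (1 - 1 / p) + q / p = q" by (simp add: algebra_simps)
    also have "(2 * y) powr q * \<sigma> R powr (q / p) = 2 powr q * (2 powr (p * of_int m) * \<sigma> R) powr (q / p)"
      using sR pq by (simp add: y_def powr_mult powr_powr mult.commute)
    finally have eq: "(2 * y) powr (q * (1 - 1 / p)) * (2 * y * \<sigma> R) powr (q / p)
        = 2 powr q * (2 powr (p * of_int m) * \<sigma> R) powr (q / p)" .
    have "?E * (2 powr s * g * (2 * y * \<sigma> R) powr (q / p))
        = K powr q * 2 powr s * g * ((2 * y) powr (q * (1 - 1 / p)) * (2 * y * \<sigma> R) powr (q / p))"
      by (simp only: mult_ac)
    then show "?E * (2 powr s * g * (2 * y * \<sigma> R) powr (q / p))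
        = low_const (real CARD('n)) p q \<beta> * K powr q * (2 powr (p * of_int m) * \<sigma> R) powr (q / p)"
      unfolding eq by (simp only: low_const_def g_def s_def mult_ac)
  qed
  finally show ?thesis by (simp add: sum_distrib_left)
qed


text \<open>The sum over ratio levels costs nothing because \<open>q / p \<ge> 1\<close>. The bound
  is the same for every \<open>k\<close>; decay in \<open>k\<close> comes from the truncation in
  \<open>weak_type_low\<close>.\<close>

lemma favg_powr_sum_level:
  assumes "finite \<A>" "\<A> \<subseteq> D" "\<And>Q. Q \<in> \<A> \<Longrightarrow> 0 < F Q"
    and k: "\<And>Q. Q \<in> \<A> \<Longrightarrow> level (favg Q) = k"
  shows "(\<Sum>Q\<in>\<A>. favg Q powr q * \<omega> Q) \<le> low_const (real CARD('n)) p q \<beta> * K powr q * N powr (q / p)"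
proof -
  let ?A = "\<lambda>m. {Q\<in>\<A>. ratio_level Q = m}"
  have "(\<Sum>Q\<in>\<A>. favg Q powr q * \<omega> Q) = (\<Sum>m\<in>ratio_level ` \<A>. \<Sum>Q\<in>?A m. favg Q powr q * \<omega> Q)"
    by (rule sum.image_gen[OF assms(1)])
  also have "\<dots> \<le> (\<Sum>m\<in>ratio_level ` \<A>. low_const (real CARD('n)) p q \<beta> * K powr q *
      (\<Sum>R\<in>maximal_sets (?A m). (2 powr (p * of_int m) * \<sigma> R) powr (q / p)))"
    using assms by (intro sum_mono favg_powr_sum_class) auto
  also have "\<dots> = low_const (real CARD('n)) p q \<beta> * K powr q * (\<Sum>m\<in>ratio_level ` \<A>.
      \<Sum>R\<in>maximal_sets (?A m). (2 powr (p * of_int m) * \<sigma> R) powr (q / p))"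
    by (simp add: sum_distrib_left)
  also have "\<dots> \<le> low_const (real CARD('n)) p q \<beta> * K powr q * N powr (q / p)"
  proof (intro mult_left_mono sum_sum_powr_levels_le)
    have "0 < \<beta> * (q / p - 1)" using exponents \<beta>_pos by simp
    then show "0 \<le> low_const (real CARD('n)) p q \<beta> * K powr q"
      unfolding low_const_def by (intro mult_nonneg_nonneg less_imp_le[OF geo_pos]) auto
    show "1 \<le> q / p" using exponents by simp
  qed (use assms(1) ratio_class[OF assms(1-3)] in auto)
  finally show ?thesis .
qed

text \<open>The square is truncated at 1 because one cube with a large average already puts its
  points into the level set. Small averages gain from \<open>2 - q > 0\<close>, large ones from the
  truncation.\<close>

theorem weak_type_low:
  assumes "q < 2" "finite \<S>" "\<S> \<subseteq> D"
  shows "(\<Sum>Q\<in>\<S>. min 1 ((favg Q)\<^sup>2) * \<omega> Q)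
    \<le> low_const (real CARD('n)) p q \<beta> * (2 powr (2 - q) * geo (2 - q) + geo q) * K powr q * N powr (q / p)"
proof -
  define B where "B = low_const (real CARD('n)) p q \<beta> * K powr q * N powr (q / p)"
  define \<A> where "\<A> = {Q\<in>\<S>. 0 < F Q}"
  define \<A>1 where "\<A>1 = {Q\<in>\<A>. level (favg Q) < 0}"
  define \<A>2 where "\<A>2 = {Q\<in>\<A>. \<not> level (favg Q) < 0}"
  have fin: "finite \<A>" "finite \<A>1" "finite \<A>2" using assms(2) by (auto simp: \<A>_def \<A>1_def \<A>2_def)
  have AD: "Q \<in> D" "0 < favg Q" "0 < \<omega> Q" "0 < F Q" if "Q \<in> \<A>" for Q
    using that assms(3) favg_pos \<omega>_pos by (auto simp: \<A>_def)
  have low_nonneg: "0 \<le> low_const (real CARD('n)) p q \<beta>"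
  proof -
    have "0 < \<beta> * (q / p - 1)" using exponents \<beta>_pos by simp
    then show ?thesis unfolding low_const_def by (intro mult_nonneg_nonneg less_imp_le[OF geo_pos]) auto
  qed
  then have B: "0 \<le> B" by (simp add: B_def)
  have level: "(\<Sum>Q\<in>{Q\<in>\<A>'. level (favg Q) = k}. favg Q powr q * \<omega> Q) \<le> B" if "\<A>' \<subseteq> \<A>" for \<A>' k
    unfolding B_def using finite_subset[OF that fin(1)] that AD
    by (intro favg_powr_sum_level) auto
  have "(\<Sum>Q\<in>\<S>. min 1 ((favg Q)\<^sup>2) * \<omega> Q) = (\<Sum>Q\<in>\<A>. min 1 ((favg Q)\<^sup>2) * \<omega> Q)"
    using F_nonneg assms(2,3)
    by (intro sum.mono_neutral_right) (auto simp: \<A>_def favg_def less_le dest!: subsetD)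
  also have "\<dots> = (\<Sum>Q\<in>\<A>1. min 1 ((favg Q)\<^sup>2) * \<omega> Q) + (\<Sum>Q\<in>\<A>2. min 1 ((favg Q)\<^sup>2) * \<omega> Q)"
    using fin by (subst sum.union_disjoint[symmetric]) (auto simp: \<A>1_def \<A>2_def intro!: sum.cong)
  \<comment> \<open>Averages below 1: the square is \<open>favg Q powr q\<close> times the power
    \<open>2 - q\<close> of the average, which decays towards low levels.\<close>
  also have "(\<Sum>Q\<in>\<A>1. min 1 ((favg Q)\<^sup>2) * \<omega> Q) \<le> (2 powr (2 - q) * B) * geo (2 - q) * 2 powr ((2 - q) * of_int 0)"
  proof (rule sum_levels_le_geo[where l = "\<lambda>Q. level (favg Q)"])
    fix k
    let ?A = "{Q\<in>\<A>1. level (favg Q) = k}"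
    have "(\<Sum>Q\<in>?A. min 1 ((favg Q)\<^sup>2) * \<omega> Q)
      \<le> (\<Sum>Q\<in>?A. (2 powr (2 - q) * 2 powr ((2 - q) * of_int k)) * (favg Q powr q * \<omega> Q))"
    proof (rule sum_mono)
      fix Q assume "Q \<in> ?A"
      then have Q: "Q \<in> \<A>" "level (favg Q) = k" by (auto simp: \<A>1_def)
      have "min 1 ((favg Q)\<^sup>2) \<le> favg Q powr (2 - q) * favg Q powr q"
        unfolding powr_add[symmetric] using AD(2)[OF Q(1)] by (simp add: min.coboundedI2)
      also have "\<dots> \<le> (2 * 2 powr of_int k) powr (2 - q) * favg Q powr q"
        using level_bounds[OF AD(2)[OF Q(1)]] Q(2) assms(1) AD(2)[OF Q(1)]
        by (intro mult_right_mono powr_mono2) auto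
      also have "(2 * 2 powr of_int k) powr (2 - q) = 2 powr (2 - q) * 2 powr ((2 - q) * of_int k)"
        by (simp add: powr_mult powr_powr mult.commute)
      finally show "min 1 ((favg Q)\<^sup>2) * \<omega> Q
          \<le> (2 powr (2 - q) * 2 powr ((2 - q) * of_int k)) * (favg Q powr q * \<omega> Q)"
        using AD(3)[OF Q(1)] by (simp add: mult.assoc[symmetric])
    qed
    also have "\<dots> = (2 powr (2 - q) * 2 powr ((2 - q) * of_int k)) * (\<Sum>Q\<in>?A. favg Q powr q * \<omega> Q)"
      by (simp add: sum_distrib_left)
    also have "\<dots> \<le> (2 powr (2 - q) * 2 powr ((2 - q) * of_int k)) * B"
      by (intro mult_left_mono level) (auto simp: \<A>1_def)
    finally show "(\<Sum>Q\<in>?A. min 1 ((favg Q)\<^sup>2) * \<omega> Q) \<le> 2 powr (2 - q) * B * 2 powr ((2 - q) * of_int k)"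
      by (simp add: mult_ac)
  qed (use fin assms(1) B in \<open>auto simp: \<A>1_def\<close>)
  \<comment> \<open>Averages of at least 1: the cap 1 is small compared with
    \<open>favg Q powr q\<close>. Levels are negated so that they are bounded above by 0.\<close>
  also have "(\<Sum>Q\<in>\<A>2. min 1 ((favg Q)\<^sup>2) * \<omega> Q) \<le> B * geo q * 2 powr (q * of_int 0)"
  proof (rule sum_levels_le_geo[where l = "\<lambda>Q. - level (favg Q)"])
    fix k
    let ?A = "{Q\<in>\<A>2. - level (favg Q) = k}"
    have "(\<Sum>Q\<in>?A. min 1 ((favg Q)\<^sup>2) * \<omega> Q) \<le> (\<Sum>Q\<in>?A. 2 powr (q * of_int k) * (favg Q powr q * \<omega> Q))"
    proof (rule sum_mono)
      fix Q assume "Q \<in> ?A"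
      then have Q: "Q \<in> \<A>" "level (favg Q) = - k" by (auto simp: \<A>2_def)
      have "min 1 ((favg Q)\<^sup>2) \<le> 2 powr (q * of_int k) * (2 powr of_int (-k)) powr q"
        by (simp add: powr_powr mult.commute flip: powr_add)
      also have "\<dots> \<le> 2 powr (q * of_int k) * favg Q powr q"
        using level_bounds[OF AD(2)[OF Q(1)]] Q(2) exponents
        by (intro mult_left_mono powr_mono2) auto
      finally show "min 1 ((favg Q)\<^sup>2) * \<omega> Q \<le> 2 powr (q * of_int k) * (favg Q powr q * \<omega> Q)"
        using AD(3)[OF Q(1)] by (simp add: mult.assoc[symmetric])
    qed
    also have "\<dots> = 2 powr (q * of_int k) * (\<Sum>Q\<in>?A. favg Q powr q * \<omega> Q)"
      by (simp add: sum_distrib_left)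
    also have "\<dots> \<le> 2 powr (q * of_int k) * B"
    proof (rule mult_left_mono)
      have "?A = {Q\<in>\<A>2. level (favg Q) = - k}" by auto
      then show "(\<Sum>Q\<in>?A. favg Q powr q * \<omega> Q) \<le> B" using level[of \<A>2 "- k"] by (simp add: \<A>2_def)
    qed simp
    finally show "(\<Sum>Q\<in>?A. min 1 ((favg Q)\<^sup>2) * \<omega> Q) \<le> B * 2 powr (q * of_int k)"
      by (simp add: mult.commute)
  qed (use fin exponents B in \<open>auto simp: \<A>2_def\<close>)
  finally show ?thesis by (simp add: B_def algebra_simps)
qed

subsection \<open>The case \<open>q = 2\<close>\<close>

text \<open>Below a maximal set, the power \<open>s - 1\<close> of \<open>v Q\<close> is replaced by
  that of \<open>v R\<close>, and the Carleson condition sums the remaining factor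
  \<open>v Q\<close>.\<close>

lemma sum_powr_carleson:
  assumes "finite \<A>" "\<A> \<subseteq> D" "superadditive D v" "\<And>Q. Q \<in> D \<Longrightarrow> 0 < v Q" "1 \<le> s"
    and "\<And>R \<B>. R \<in> D \<Longrightarrow> finite \<B> \<Longrightarrow> \<B> \<subseteq> \<A> \<Longrightarrow> (\<And>Q. Q \<in> \<B> \<Longrightarrow> Q \<subseteq> R) \<Longrightarrow> sum v \<B> \<le> \<Lambda> * v R"
  shows "(\<Sum>Q\<in>\<A>. v Q powr s) \<le> \<Lambda> * (\<Sum>R\<in>maximal_sets \<A>. v R powr s)"
proof -
  have "(\<Sum>Q\<in>\<A>. v Q powr s) \<le> (\<Sum>R\<in>maximal_sets \<A>. \<Sum>Q\<in>{Q\<in>\<A>. Q \<subseteq> R}. v Q powr s)"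
    by (intro sum_le_sum_maximal_sets assms(1)) auto
  also have "\<dots> \<le> (\<Sum>R\<in>maximal_sets \<A>. \<Lambda> * v R powr s)"
  proof (rule sum_mono)
    fix R assume "R \<in> maximal_sets \<A>"
    then have R: "R \<in> D" using maximal_sets_subset[of \<A>] assms(2) by auto
    have "(\<Sum>Q\<in>{Q\<in>\<A>. Q \<subseteq> R}. v Q powr s) \<le> (\<Sum>Q\<in>{Q\<in>\<A>. Q \<subseteq> R}. v R powr (s - 1) * v Q)"
    proof (rule sum_mono)
      fix Q assume Q: "Q \<in> {Q\<in>\<A>. Q \<subseteq> R}"
      then have QD: "Q \<in> D" using assms(2) by auto
      have "v Q \<le> v R" using superadditiveD[OF assms(3), of "{Q}" R] Q QD R by simp
      then have "v Q powr (s - 1) * v Q powr 1 \<le> v R powr (s - 1) * v Q powr 1"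
        using assms(4)[OF QD] assms(5) by (intro mult_right_mono powr_mono2) auto
      then show "v Q powr s \<le> v R powr (s - 1) * v Q"
        unfolding powr_add[symmetric] using assms(4)[OF QD] by simp
    qed
    also have "\<dots> = v R powr (s - 1) * sum v {Q\<in>\<A>. Q \<subseteq> R}" by (simp add: sum_distrib_left)
    also have "\<dots> \<le> v R powr (s - 1) * (\<Lambda> * v R)"
      using assms(1) R by (intro mult_left_mono assms(6)) auto
    also have "\<dots> = \<Lambda> * (v R powr (s - 1) * v R powr 1)" using assms(4)[OF R] by simp
    also have "v R powr (s - 1) * v R powr 1 = v R powr s" unfolding powr_add[symmetric] by simp
    finally show "(\<Sum>Q\<in>{Q\<in>\<A>. Q \<subseteq> R}. v Q powr s) \<le> \<Lambda> * v R powr s" .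
  qed
  finally show ?thesis by (simp add: sum_distrib_left)
qed

text \<open>At \<open>q = 2\<close> the decay exponent \<open>2 - q\<close> vanishes. Instead the
  averages are bounded through their ratio level alone, and the cubes of a class are summed by the
  Carleson condition on \<open>\<sigma>\<close> with exponent \<open>2 / p \<ge> 1\<close>. The
  factor 4 is the square of the dyadic loss in the ratio.\<close>

theorem weak_type_two:
  assumes "q = 2" "finite \<S>" "\<S> \<subseteq> D" "0 \<le> \<Lambda>"
    and carleson: "\<And>R \<B>. R \<in> D \<Longrightarrow> finite \<B> \<Longrightarrow> \<B> \<subseteq> \<S> \<Longrightarrow> (\<And>Q. Q \<in> \<B> \<Longrightarrow> Q \<subseteq> R) \<Longrightarrow> sum \<sigma> \<B> \<le> \<Lambda> * \<sigma> R"
  shows "(\<Sum>Q\<in>\<S>. (favg Q)\<^sup>2 * \<omega> Q) \<le> 4 * \<Lambda> * K\<^sup>2 * N powr (2 / p)"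
proof -
  define \<A> where "\<A> = {Q\<in>\<S>. 0 < F Q}"
  let ?A = "\<lambda>m. {Q\<in>\<A>. ratio_level Q = m}"
  have fin: "finite \<A>" using assms(2) by (auto simp: \<A>_def)
  have AD: "\<A> \<subseteq> D" "\<And>Q. Q \<in> \<A> \<Longrightarrow> 0 < F Q" using assms(3) by (auto simp: \<A>_def)
  have p: "0 < p" using exponents by simp
  have "(\<Sum>Q\<in>\<S>. (favg Q)\<^sup>2 * \<omega> Q) = (\<Sum>Q\<in>\<A>. (favg Q)\<^sup>2 * \<omega> Q)"
    using F_nonneg assms(2,3)
    by (intro sum.mono_neutral_right) (auto simp: \<A>_def favg_def less_le dest!: subsetD)
  also have "\<dots> = (\<Sum>m\<in>ratio_level ` \<A>. \<Sum>Q\<in>?A m. (favg Q)\<^sup>2 * \<omega> Q)"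
    by (rule sum.image_gen[OF fin])
  also have "\<dots> \<le> (\<Sum>m\<in>ratio_level ` \<A>. 4 * \<Lambda> * K\<^sup>2 * (\<Sum>R\<in>maximal_sets (?A m). (2 powr (p * of_int m) * \<sigma> R) powr (2 / p)))"
  proof (rule sum_mono)
    fix m
    let ?y = "2 powr of_int m :: real"
    have "(\<Sum>Q\<in>?A m. (favg Q)\<^sup>2 * \<omega> Q) \<le> (\<Sum>Q\<in>?A m. K\<^sup>2 * (2 * ?y)\<^sup>2 * \<sigma> Q powr (2 / p))"
    proof (rule sum_mono)
      fix Q assume "Q \<in> ?A m"
      then have Q: "Q \<in> D" "0 < F Q" "ratio_level Q = m" using AD by auto
      note pos = \<sigma>_pos[OF Q(1)] \<omega>_pos[OF Q(1)]
      have "(favg Q)\<^sup>2 * \<omega> Q = two_weight_at Q powr 2 * (F Q / \<sigma> Q) powr (2 * (1 - 1 / p)) * F Q powr (2 / p)"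
        using favg_powr_eq[OF Q(1,2)] favg_pos[OF Q(1,2)] assms(1) by simp
      also have "\<dots> = (two_weight_at Q)\<^sup>2 * (F Q / \<sigma> Q)\<^sup>2 * \<sigma> Q powr (2 / p)"
      proof -
        have "(F Q / \<sigma> Q) powr 2 * \<sigma> Q powr (2 / p)
            = (F Q / \<sigma> Q) powr (2 * (1 - 1 / p)) * F Q powr (2 / p)"
          by (rule ln_inj_iff[THEN iffD1])
            (use pos Q(2) p in \<open>simp_all add: ln_mult ln_powr ln_div ln_realpow field_simps\<close>)
        then have "(F Q / \<sigma> Q)\<^sup>2 * \<sigma> Q powr (2 / p)
            = (F Q / \<sigma> Q) powr (2 * (1 - 1 / p)) * F Q powr (2 / p)"
          using pos Q(2) by simp
        then show ?thesis using two_weight_at_pos[OF Q(1)] by (simp add: mult.assoc)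
      qed
      also have "\<dots> \<le> K\<^sup>2 * (2 * ?y)\<^sup>2 * \<sigma> Q powr (2 / p)"
        using two_weight_at_le[OF Q(1)] two_weight_at_pos[OF Q(1)] ratio_level_bounds[OF Q(1,2)] Q pos
        by (intro mult_right_mono mult_mono power_mono) (auto simp: field_simps)
      finally show "(favg Q)\<^sup>2 * \<omega> Q \<le> K\<^sup>2 * (2 * ?y)\<^sup>2 * \<sigma> Q powr (2 / p)" .
    qed
    also have "\<dots> = K\<^sup>2 * (2 * ?y)\<^sup>2 * (\<Sum>Q\<in>?A m. \<sigma> Q powr (2 / p))" by (simp add: sum_distrib_left)
    also have "\<dots> \<le> K\<^sup>2 * (2 * ?y)\<^sup>2 * (\<Lambda> * (\<Sum>R\<in>maximal_sets (?A m). \<sigma> R powr (2 / p)))"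
    proof (intro mult_left_mono sum_powr_carleson)
      fix R \<B> assume "R \<in> D" "finite \<B>" "\<B> \<subseteq> ?A m" "\<And>Q. Q \<in> \<B> \<Longrightarrow> Q \<subseteq> R"
      then show "sum \<sigma> \<B> \<le> \<Lambda> * \<sigma> R" by (intro carleson) (auto simp: \<A>_def)
    qed (use fin AD assms(1) exponents in \<open>auto intro: superadditive_\<sigma> \<sigma>_pos\<close>)
    also have "\<dots> = 4 * \<Lambda> * K\<^sup>2 * (\<Sum>R\<in>maximal_sets (?A m). ?y\<^sup>2 * \<sigma> R powr (2 / p))"
      by (simp add: sum_distrib_left power_mult_distrib mult_ac)
    also have "(\<Sum>R\<in>maximal_sets (?A m). ?y\<^sup>2 * \<sigma> R powr (2 / p))
        = (\<Sum>R\<in>maximal_sets (?A m). (2 powr (p * of_int m) * \<sigma> R) powr (2 / p))"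
    proof (rule sum.cong[OF refl])
      fix R assume "R \<in> maximal_sets (?A m)"
      then have "R \<in> D" using maximal_sets_subset[of "?A m"] AD(1) by auto
      then show "?y\<^sup>2 * \<sigma> R powr (2 / p) = (2 powr (p * of_int m) * \<sigma> R) powr (2 / p)"
        using \<sigma>_pos[of R] p by (simp add: powr_mult powr_powr power2_eq_square mult.commute flip: powr_add)
    qed
    finally show "(\<Sum>Q\<in>?A m. (favg Q)\<^sup>2 * \<omega> Q)
        \<le> 4 * \<Lambda> * K\<^sup>2 * (\<Sum>R\<in>maximal_sets (?A m). (2 powr (p * of_int m) * \<sigma> R) powr (2 / p))" .
  qed
  also have "\<dots> = 4 * \<Lambda> * K\<^sup>2 * (\<Sum>m\<in>ratio_level ` \<A>. \<Sum>R\<in>maximal_sets (?A m). (2 powr (p * of_int m) * \<sigma> R) powr (2 / p))"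
    by (simp add: sum_distrib_left)
  also have "\<dots> \<le> 4 * \<Lambda> * K\<^sup>2 * N powr (2 / p)"
    using fin ratio_class[OF fin AD] exponents assms(1,4)
    by (intro mult_left_mono sum_sum_powr_levels_le) auto
  finally show ?thesis .
qed

end

subsection \<open>The case \<open>q > 2\<close>\<close>

text \<open>For \<open>2 < t \<le> q\<close> with \<open>t \<beta> \<le> 2\<close> one has
  \<open>|Q|\<^sup>-\<^sup>2\<^sup>\<beta> \<sigma>\<^sup>2 \<omega> = A(Q)\<^sup>t |Q|\<^sup>(\<^sup>t\<^sup>-\<^sup>2\<^sup>)\<^sup>\<beta> \<sigma>\<^sup>a \<omega>\<^sup>b\<close> with \<open>a, b \<ge> 0\<close> and \<open>a + b \<ge> 1\<close>: the power of the volume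
  becomes positive, and \<open>\<sigma>\<^sup>a \<omega>\<^sup>b\<close> is still superadditive.\<close>

definition mixing_exponent :: "real \<Rightarrow> real \<Rightarrow> real" where
  "mixing_exponent q \<beta> = min q (2 / \<beta>)"

text \<open>The first factor is the loss in replacing the A_(p,q) quantity by its dyadic level, the
  second the loss in \<open>packing\<close>.\<close>

definition packing_const :: "real \<Rightarrow> real \<Rightarrow> real \<Rightarrow> real" where
  "packing_const d q \<beta> = 2 powr mixing_exponent q \<beta> * geo (d * ((mixing_exponent q \<beta> - 2) * \<beta>))"

text \<open>Of the 8, a factor 4 comes from squaring the ratio level and 2 from the level of
  \<open>e / \<omega>\<close>. The two values of \<open>geo\<close> come from summing over the
  levels of \<open>e / \<omega>\<close> and of \<open>two_weight_at\<close>.\<close>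

definition high_const :: "real \<Rightarrow> real \<Rightarrow> real \<Rightarrow> real" where
  "high_const d q \<beta> = 8 * packing_const d q \<beta> * geo (2 / q) * geo 2"

context fractional_setting
begin

abbreviation mixing_exp :: real where "mixing_exp \<equiv> mixing_exponent q \<beta>"

text \<open>The condition \<open>\<beta> < 1\<close>, that is \<open>\<alpha> > 0\<close>, leaves
  room above 2.\<close>

lemma mixing_exp_gt:
  assumes "2 < q"
  shows "2 < mixing_exp"
proof -
  have "2 < 2 / \<beta>" using \<beta>_pos exponents(4) by (simp add: less_divide_eq)
  then show ?thesis using assms by (simp add: mixing_exponent_def)
qed

text \<open>The upper bound on the A_(p,q) quantity frees a positive power of the volume, so each
  maximal cube controls the cubes below it. At the maximal cube the lower bound absorbs the volume
  again, and \<open>B\<close> is left with the power 2.\<close>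

lemma packing_two_weight_class:
  assumes "2 < q" "finite \<A>" "\<A> \<subseteq> D" "0 < B"
    and within: "\<And>Q. Q \<in> \<A> \<Longrightarrow> B \<le> two_weight_at Q" "\<And>Q. Q \<in> \<A> \<Longrightarrow> two_weight_at Q \<le> 2 * B"
  shows "(\<Sum>Q\<in>\<A>. vol Q powr (- 2 * \<beta>) * (\<sigma> Q)\<^sup>2 * \<omega> Q)
    \<le> packing_const (real CARD('n)) q \<beta> * B\<^sup>2 * (\<Sum>R\<in>maximal_sets \<A>. \<sigma> R powr (2 / p) * \<omega> R powr (1 - 2 / q))"
proof -
  define t where "t = mixing_exp"
  define a where "a = 2 - t * (1 - 1 / p)"
  define b where "b = 1 - t / q"
  define v where "v = (\<lambda>Q. \<sigma> Q powr a * \<omega> Q powr b)"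
  define g where "g = geo (real CARD('n) * ((t - 2) * \<beta>))"
  have pq: "0 < p" "0 < q" "0 < 1 - 1 / p" using exponents by auto
  have t2: "2 < t" unfolding t_def by (rule mixing_exp_gt[OF assms(1)])
  have "t \<le> q" "t \<le> 2 / \<beta>" by (auto simp: t_def mixing_exponent_def)
  then have tq: "t \<le> q" "t * \<beta> \<le> 2" using \<beta>_pos by (auto simp: le_divide_eq)
  have g: "0 < g" using t2 \<beta>_pos by (auto simp: g_def intro!: geo_pos)
  have "t * \<beta> = t * (1 - 1 / p) + t / q" unfolding exponents(3) by (simp add: algebra_simps)
  \<comment> \<open>\<open>t * \<beta> \<le> 2\<close> gives \<open>a \<ge> 0\<close> and
    \<open>a + b = 3 - t * \<beta> \<ge> 1\<close>, while \<open>t \<le> q\<close> gives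
    \<open>b \<ge> 0\<close>.\<close>
  then have ab: "0 \<le> a" "0 \<le> b" "1 \<le> a + b"
    using tq t2 pq by (auto simp: a_def b_def) (smt (verit) divide_nonneg_nonneg)+
  have v: "superadditive D v"
    unfolding v_def by (intro superadditive_powr_mult_powr superadditive_\<sigma> superadditive_\<omega> \<sigma>_pos \<omega>_pos ab)
  have AD: "Q \<in> D" if "Q \<in> \<A>" for Q using that assms(3) by auto
  have split1: "vol Q powr (- 2 * \<beta>) * (\<sigma> Q)\<^sup>2 * \<omega> Q
      = two_weight_at Q powr t * (vol Q powr ((t - 2) * \<beta>) * v Q)"
    and split2: "two_weight_at Q powr (t - 2) * (vol Q powr ((t - 2) * \<beta>) * v Q)
      = \<sigma> Q powr (2 / p) * \<omega> Q powr (1 - 2 / q)" if "Q \<in> D" for Q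
  proof -
    note pos = measure_D_pos[OF that] \<sigma>_pos[OF that] \<omega>_pos[OF that]
    show "vol Q powr (- 2 * \<beta>) * (\<sigma> Q)\<^sup>2 * \<omega> Q
      = two_weight_at Q powr t * (vol Q powr ((t - 2) * \<beta>) * v Q)"
      by (rule ln_inj_iff[THEN iffD1])
        (use pos pq in \<open>simp_all add: two_weight_at_def v_def a_def b_def ln_mult ln_powr ln_realpow field_simps\<close>)
    show "two_weight_at Q powr (t - 2) * (vol Q powr ((t - 2) * \<beta>) * v Q)
      = \<sigma> Q powr (2 / p) * \<omega> Q powr (1 - 2 / q)"
      by (rule ln_inj_iff[THEN iffD1])
        (use pos pq in \<open>simp_all add: two_weight_at_def v_def a_def b_def ln_mult ln_powr ln_realpow field_simps\<close>)
  qed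
  have "(\<Sum>Q\<in>\<A>. vol Q powr (- 2 * \<beta>) * (\<sigma> Q)\<^sup>2 * \<omega> Q)
      \<le> (\<Sum>Q\<in>\<A>. (2 * B) powr t * (vol Q powr ((t - 2) * \<beta>) * v Q))"
  proof (rule sum_mono)
    fix Q assume Q: "Q \<in> \<A>"
    show "vol Q powr (- 2 * \<beta>) * (\<sigma> Q)\<^sup>2 * \<omega> Q \<le> (2 * B) powr t * (vol Q powr ((t - 2) * \<beta>) * v Q)"
      unfolding split1[OF AD[OF Q]] using within[OF Q] assms(4) t2
      by (intro mult_right_mono powr_mono2) (auto simp: v_def)
  qed
  also have "\<dots> = (2 * B) powr t * (\<Sum>Q\<in>\<A>. vol Q powr ((t - 2) * \<beta>) * v Q)"
    by (simp add: sum_distrib_left)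
  also have "\<dots> \<le> (2 * B) powr t * (\<Sum>R\<in>maximal_sets \<A>. \<Sum>Q\<in>{Q\<in>\<A>. Q \<subseteq> R}. vol Q powr ((t - 2) * \<beta>) * v Q)"
    by (intro mult_left_mono sum_le_sum_maximal_sets assms(2)) (auto simp: v_def)
  also have "\<dots> \<le> (2 * B) powr t * (\<Sum>R\<in>maximal_sets \<A>. g * vol R powr ((t - 2) * \<beta>) * v R)"
  proof (intro mult_left_mono sum_mono)
    fix R assume "R \<in> maximal_sets \<A>"
    then have "R \<in> D" using maximal_sets_subset[of \<A>] AD by auto
    then show "(\<Sum>Q\<in>{Q\<in>\<A>. Q \<subseteq> R}. vol Q powr ((t - 2) * \<beta>) * v Q) \<le> g * vol R powr ((t - 2) * \<beta>) * v R"
      unfolding g_def using assms(2,3) t2 \<beta>_pos by (intro packing v) auto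
  qed auto
  also have "\<dots> \<le> (2 * B) powr t * (\<Sum>R\<in>maximal_sets \<A>. g * (B powr (2 - t) * (\<sigma> R powr (2 / p) * \<omega> R powr (1 - 2 / q))))"
  proof (intro mult_left_mono sum_mono)
    fix R assume "R \<in> maximal_sets \<A>"
    then have R: "R \<in> \<A>" using maximal_sets_subset[of \<A>] by auto
    \<comment> \<open>Since \<open>t > 2\<close>, the power \<open>t - 2\<close> of
      \<open>two_weight_at R / B\<close> may be inserted; by \<open>split2\<close> it cancels the
      volume.\<close>
    have "1 \<le> B powr (2 - t) * two_weight_at R powr (t - 2)"
    proof -
      have "B powr (2 - t) * B powr (t - 2) = 1" unfolding powr_add[symmetric] using assms(4) by simp
      then show ?thesis
        using within(1)[OF R] t2 assms(4) by (metis mult_left_mono powr_mono2 powr_ge_zero less_imp_le diff_ge_0_iff_ge)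
    qed
    moreover have "0 \<le> vol R powr ((t - 2) * \<beta>) * v R" by (simp add: v_def)
    ultimately have "1 * (vol R powr ((t - 2) * \<beta>) * v R)
        \<le> (B powr (2 - t) * two_weight_at R powr (t - 2)) * (vol R powr ((t - 2) * \<beta>) * v R)"
      by (rule mult_right_mono)
    also have "\<dots> = B powr (2 - t) * (\<sigma> R powr (2 / p) * \<omega> R powr (1 - 2 / q))"
      unfolding split2[OF AD[OF R], symmetric] by (simp only: mult.assoc)
    finally show "g * vol R powr ((t - 2) * \<beta>) * v R \<le> g * (B powr (2 - t) * (\<sigma> R powr (2 / p) * \<omega> R powr (1 - 2 / q)))"
      using g by (simp only: mult.assoc mult_1 mult_le_cancel_left_pos)
  qed auto
  also have "\<dots> = 2 powr t * g * (B powr t * B powr (2 - t)) * (\<Sum>R\<in>maximal_sets \<A>. \<sigma> R powr (2 / p) * \<omega> R powr (1 - 2 / q))"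
    using assms(4) by (simp add: sum_distrib_left[symmetric] powr_mult mult_ac)
  also have "B powr t * B powr (2 - t) = B\<^sup>2" unfolding powr_add[symmetric] using assms(4) by simp
  finally show ?thesis by (simp add: packing_const_def g_def t_def)
qed

lemma packing_const_nonneg: "2 < q \<Longrightarrow> 0 \<le> packing_const (real CARD('n)) q \<beta>"
proof -
  assume "2 < q"
  then have "0 < (mixing_exp - 2) * \<beta>"
    using \<beta>_pos mixing_exp_gt by simp
  then show ?thesis unfolding packing_const_def by (intro mult_nonneg_nonneg less_imp_le[OF geo_pos]) auto
qed

text \<open>The only place where the position of \<open>p\<close> relative to \<open>2\<close> matters; \<open>V\<close> bounds the total
  \<open>\<omega>\<close>-mass of disjoint families.\<close>

definition maximal_bound :: "(real ^ 'n) set set \<Rightarrow> real \<Rightarrow> bool" where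
  "maximal_bound \<S> \<Gamma> \<longleftrightarrow> (\<forall>\<A> V. \<A> \<subseteq> \<S> \<and> (\<forall>Q\<in>\<A>. 0 < F Q) \<and> 0 \<le> V \<and>
      (\<forall>\<B>\<subseteq>\<A>. disjoint \<B> \<longrightarrow> sum \<omega> \<B> \<le> V) \<longrightarrow>
      (\<Sum>m\<in>ratio_level ` \<A>. \<Sum>R\<in>maximal_sets {Q\<in>\<A>. ratio_level Q = m}.
          (2 powr (p * of_int m) * \<sigma> R) powr (2 / p) * \<omega> R powr (1 - 2 / q))
        \<le> \<Gamma> * N powr (2 / p) * V powr (1 - 2 / q))"

text \<open>For each \<open>m\<close>, Hoelder's inequality applies to the maximal cubes, since
  \<open>2 / p\<close> and \<open>1 - 2 / q\<close> have total at least 1. The factor with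
  \<open>V\<close> is then common to all \<open>m\<close>, and the sum over \<open>m\<close>
  converges by \<open>2 / p \<ge> 1\<close>, so no A_infinity constant appears.\<close>

lemma maximal_bound_small_p:
  assumes "2 < q" "p \<le> 2" "finite \<S>" "\<S> \<subseteq> D"
  shows "maximal_bound \<S> 1"
  unfolding maximal_bound_def
proof (intro allI impI)
  fix \<A> V
  assume A: "\<A> \<subseteq> \<S> \<and> (\<forall>Q\<in>\<A>. 0 < F Q) \<and> 0 \<le> V \<and> (\<forall>\<B>\<subseteq>\<A>. disjoint \<B> \<longrightarrow> sum \<omega> \<B> \<le> V)"
  let ?P = "\<lambda>m. maximal_sets {Q\<in>\<A>. ratio_level Q = m}"
  have fin: "finite \<A>" using A assms(3) finite_subset by auto
  have AD: "\<A> \<subseteq> D" "\<And>Q. Q \<in> \<A> \<Longrightarrow> 0 < F Q" using A assms(4) by auto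
  have sub: "?P m \<subseteq> \<A>" for m using maximal_sets_subset[of "{Q\<in>\<A>. ratio_level Q = m}"] by auto
  have pos: "0 < \<sigma> R" "0 < \<omega> R" if "R \<in> ?P m" for R m
    using that sub[of m] AD(1) \<sigma>_pos \<omega>_pos by auto
  have "2 / p \<ge> 1" using assms(2) exponents by simp
  moreover have "2 / q < 1" using assms(1) by simp
  ultimately have e: "0 \<le> 2 / p" "0 \<le> 1 - 2 / q" "1 \<le> 2 / p + (1 - 2 / q)" by linarith+
  have "(\<Sum>R\<in>?P m. (2 powr (p * of_int m) * \<sigma> R) powr (2 / p) * \<omega> R powr (1 - 2 / q))
      \<le> (\<Sum>R\<in>?P m. 2 powr (p * of_int m) * \<sigma> R) powr (2 / p) * V powr (1 - 2 / q)" for m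
  proof -
    have "(\<Sum>R\<in>?P m. (2 powr (p * of_int m) * \<sigma> R) powr (2 / p) * \<omega> R powr (1 - 2 / q))
      \<le> (\<Sum>R\<in>?P m. 2 powr (p * of_int m) * \<sigma> R) powr (2 / p) * sum \<omega> (?P m) powr (1 - 2 / q)"
      using pos[of _ m] e ratio_class(1)[OF fin AD] by (intro sum_powr_mult_powr_le) auto
    also have "sum \<omega> (?P m) \<le> V" using A sub[of m] ratio_class(1)[OF fin AD, of m] by auto
    then have "(\<Sum>R\<in>?P m. 2 powr (p * of_int m) * \<sigma> R) powr (2 / p) * sum \<omega> (?P m) powr (1 - 2 / q)
        \<le> (\<Sum>R\<in>?P m. 2 powr (p * of_int m) * \<sigma> R) powr (2 / p) * V powr (1 - 2 / q)"
      using e by (intro mult_left_mono powr_mono2 sum_nonneg less_imp_le[OF pos(2)]) auto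
    finally show ?thesis .
  qed
  then have "(\<Sum>m\<in>ratio_level ` \<A>. \<Sum>R\<in>?P m. (2 powr (p * of_int m) * \<sigma> R) powr (2 / p) * \<omega> R powr (1 - 2 / q))
      \<le> (\<Sum>m\<in>ratio_level ` \<A>. (\<Sum>R\<in>?P m. 2 powr (p * of_int m) * \<sigma> R) powr (2 / p) * V powr (1 - 2 / q))"
    by (intro sum_mono)
  also have "\<dots> = (\<Sum>m\<in>ratio_level ` \<A>. (\<Sum>R\<in>?P m. 2 powr (p * of_int m) * \<sigma> R) powr (2 / p)) * V powr (1 - 2 / q)"
    by (simp add: sum_distrib_right)
  also have "\<dots> \<le> N powr (2 / p) * V powr (1 - 2 / q)"
    using fin ratio_class[OF fin AD] \<open>2 / p \<ge> 1\<close> by (intro mult_right_mono sum_powr_levels_le) auto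
  finally show "(\<Sum>m\<in>ratio_level ` \<A>. \<Sum>R\<in>?P m.
          (2 powr (p * of_int m) * \<sigma> R) powr (2 / p) * \<omega> R powr (1 - 2 / q))
        \<le> 1 * N powr (2 / p) * V powr (1 - 2 / q)" by simp
qed

text \<open>Now \<open>2 / p < 1\<close>, so the factor with \<open>\<omega>\<close> must help with
  the sum over \<open>m\<close>. Hoelder's inequality with exponents \<open>2 / p\<close> and
  \<open>1 - 2 / p\<close> over all pairs \<open>(m, R)\<close> separates a sum bounded by
  \<open>level_sum\<close> from a sum of powers of \<open>\<omega>\<close>.\<close>

lemma maximal_bound_large_p:
  assumes "2 < p" "finite \<S>" "\<S> \<subseteq> D" "0 \<le> \<Lambda>"
    and carleson: "\<And>R \<B>. R \<in> D \<Longrightarrow> finite \<B> \<Longrightarrow> \<B> \<subseteq> \<S> \<Longrightarrow> (\<And>Q. Q \<in> \<B> \<Longrightarrow> Q \<subseteq> R) \<Longrightarrow> sum \<omega> \<B> \<le> \<Lambda> * \<omega> R"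
  shows "maximal_bound \<S> (\<Lambda> powr (1 - 2 / p))"
  unfolding maximal_bound_def
proof (intro allI impI)
  fix \<A> V
  assume A: "\<A> \<subseteq> \<S> \<and> (\<forall>Q\<in>\<A>. 0 < F Q) \<and> 0 \<le> V \<and> (\<forall>\<B>\<subseteq>\<A>. disjoint \<B> \<longrightarrow> sum \<omega> \<B> \<le> V)"
  let ?A = "\<lambda>m. {Q\<in>\<A>. ratio_level Q = m}"
  let ?P = "\<lambda>m. maximal_sets (?A m)"
  let ?I = "Sigma (ratio_level ` \<A>) ?P"
  \<comment> \<open>Chosen so that \<open>(\<omega> R powr \<rho>) powr (1 - 2 / p)\<close> is the
    given power of \<open>\<omega> R\<close>; \<open>\<rho> \<ge> 1\<close> because
    \<open>p < q\<close>.\<close>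
  define \<rho> where "\<rho> = (1 - 2 / q) / (1 - 2 / p)"
  have pq: "0 < 1 - 2 / p" "1 - 2 / p \<le> 1 - 2 / q" using assms(1) exponents by (auto simp: field_simps)
  have \<rho>: "1 \<le> \<rho>" "\<rho> * (1 - 2 / p) = 1 - 2 / q" using pq by (auto simp: \<rho>_def le_divide_eq)
  have fin: "finite \<A>" using A assms(2) finite_subset by auto
  have AD: "\<A> \<subseteq> D" "\<And>Q. Q \<in> \<A> \<Longrightarrow> 0 < F Q" using A assms(3) by auto
  have sub: "?P m \<subseteq> ?A m" for m by (rule maximal_sets_subset)
  have finP: "finite (?P m)" for m by (rule finite_subset[OF sub]) (use fin in simp)
  have pos: "0 < \<sigma> R" "0 < \<omega> R" if "R \<in> ?P m" for R m
    using that sub[of m] AD(1) \<sigma>_pos \<omega>_pos by auto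
  \<comment> \<open>A cube has only one ratio level, so the double sum is part of the sum over
    \<open>\<A>\<close>. The Carleson condition reduces that to the maximal cubes of
    \<open>\<A>\<close>, which are disjoint and have mass at most \<open>V\<close>.\<close>
  have "(\<Sum>m\<in>ratio_level ` \<A>. \<Sum>R\<in>?P m. \<omega> R powr \<rho>) \<le> (\<Sum>m\<in>ratio_level ` \<A>. \<Sum>R\<in>?A m. \<omega> R powr \<rho>)"
    using fin sub by (intro sum_mono sum_mono2) auto
  also have "\<dots> = (\<Sum>Q\<in>\<A>. \<omega> Q powr \<rho>)" by (rule sum.image_gen[OF fin, symmetric])
  also have "\<dots> \<le> \<Lambda> * (\<Sum>R\<in>maximal_sets \<A>. \<omega> R powr \<rho>)"
  proof (rule sum_powr_carleson)
    fix R \<B> assume "R \<in> D" "finite \<B>" "\<B> \<subseteq> \<A>" "\<And>Q. Q \<in> \<B> \<Longrightarrow> Q \<subseteq> R"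
    then show "sum \<omega> \<B> \<le> \<Lambda> * \<omega> R" using A by (intro carleson) auto
  qed (use fin AD superadditive_\<omega> \<omega>_pos \<rho> in auto)
  also have "\<dots> \<le> \<Lambda> * sum \<omega> (maximal_sets \<A>) powr \<rho>"
  proof (intro mult_left_mono sum_powr_le_powr_sum \<rho> assms(4))
    show "finite (maximal_sets \<A>)" by (rule finite_subset[OF maximal_sets_subset fin])
    show "0 \<le> \<omega> R" if "R \<in> maximal_sets \<A>" for R
      using that maximal_sets_subset[of \<A>] AD(1) by (auto intro!: less_imp_le[OF \<omega>_pos])
  qed
  also have "\<dots> \<le> \<Lambda> * V powr \<rho>"
  proof (intro mult_left_mono powr_mono2 assms(4))
    show "sum \<omega> (maximal_sets \<A>) \<le> V" using A maximal_sets_subset[of \<A>] disjoint_maximal_sets[OF AD(1)] by auto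
    show "0 \<le> sum \<omega> (maximal_sets \<A>)"
      using maximal_sets_subset[of \<A>] AD(1) by (auto intro!: sum_nonneg less_imp_le[OF \<omega>_pos])
  qed (use \<rho> in simp)
  finally have \<omega>_sum: "(\<Sum>m\<in>ratio_level ` \<A>. \<Sum>R\<in>?P m. \<omega> R powr \<rho>) \<le> \<Lambda> * V powr \<rho>" .
  have \<sigma>_sum: "(\<Sum>m\<in>ratio_level ` \<A>. \<Sum>R\<in>?P m. 2 powr (p * of_int m) * \<sigma> R) \<le> N"
    using fin ratio_class[OF fin AD] by (intro level_sum) auto
  have "(\<Sum>m\<in>ratio_level ` \<A>. \<Sum>R\<in>?P m. (2 powr (p * of_int m) * \<sigma> R) powr (2 / p) * \<omega> R powr (1 - 2 / q))
      = (\<Sum>x\<in>?I. (2 powr (p * of_int (fst x)) * \<sigma> (snd x)) powr (2 / p) * (\<omega> (snd x) powr \<rho>) powr (1 - 2 / p))"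
    using fin finP by (subst sum.Sigma) (auto simp: powr_powr \<rho>(2) split_beta)
  also have "\<dots> \<le> (\<Sum>x\<in>?I. 2 powr (p * of_int (fst x)) * \<sigma> (snd x)) powr (2 / p)
      * (\<Sum>x\<in>?I. \<omega> (snd x) powr \<rho>) powr (1 - 2 / p)"
    using fin finP pq assms(1) by (intro sum_powr_mult_powr_le) (auto dest: pos)
  also have "\<dots> = (\<Sum>m\<in>ratio_level ` \<A>. \<Sum>R\<in>?P m. 2 powr (p * of_int m) * \<sigma> R) powr (2 / p)
      * (\<Sum>m\<in>ratio_level ` \<A>. \<Sum>R\<in>?P m. \<omega> R powr \<rho>) powr (1 - 2 / p)"
    using fin finP by (simp add: sum.Sigma split_beta)
  also have "\<dots> \<le> N powr (2 / p) * (\<Lambda> * V powr \<rho>) powr (1 - 2 / p)"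
    using \<sigma>_sum \<omega>_sum pq assms(1)
    by (intro mult_mono powr_mono2 sum_nonneg mult_nonneg_nonneg less_imp_le[OF pos(1)]) auto
  also have "\<dots> = \<Lambda> powr (1 - 2 / p) * N powr (2 / p) * V powr (1 - 2 / q)"
    using assms(4) by (simp add: powr_mult powr_powr \<rho>(2))
  finally show "(\<Sum>m\<in>ratio_level ` \<A>. \<Sum>R\<in>?P m.
          (2 powr (p * of_int m) * \<sigma> R) powr (2 / p) * \<omega> R powr (1 - 2 / q))
        \<le> \<Lambda> powr (1 - 2 / p) * N powr (2 / p) * V powr (1 - 2 / q)" .
qed

text \<open>Later \<open>e Q\<close> is the \<open>\<omega>\<close>-mass of the part of
  \<open>Q\<close> in the level set, and \<open>W\<close> that of the level set. Where
  \<open>e\<close> is about \<open>h * \<omega>\<close>, disjoint families have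
  \<open>\<omega>\<close>-mass at most \<open>W / h\<close>. The factor \<open>h\<close> supplied by
  \<open>e\<close> outweighs \<open>h powr (- (1 - 2 / q))\<close>, which leaves the decay
  \<open>h powr (2 / q)\<close>.\<close>

lemma weak_type_high_class:
  assumes "2 < q" "finite \<S>" "\<S> \<subseteq> D" "maximal_bound \<S> \<Gamma>" "0 \<le> \<Gamma>" "0 \<le> W"
    and e_sum: "\<And>\<B>. finite \<B> \<Longrightarrow> \<B> \<subseteq> D \<Longrightarrow> disjoint \<B> \<Longrightarrow> sum e \<B> \<le> W"
    and \<A>: "\<A> \<subseteq> \<S>" "\<And>Q. Q \<in> \<A> \<Longrightarrow> 0 < F Q" "\<And>Q. Q \<in> \<A> \<Longrightarrow> 0 < e Q"
    and i: "\<And>Q. Q \<in> \<A> \<Longrightarrow> level (e Q / \<omega> Q) = i"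
    and j: "\<And>Q. Q \<in> \<A> \<Longrightarrow> level (two_weight_at Q) = j"
  shows "(\<Sum>Q\<in>\<A>. (favg Q)\<^sup>2 * e Q)
    \<le> (8 * packing_const (real CARD('n)) q \<beta> * \<Gamma> * N powr (2 / p) * W powr (1 - 2 / q)) * (2 powr of_int j)\<^sup>2 * 2 powr (2 / q * of_int i)"
proof -
  define h B :: real where "h = 2 powr of_int i" and "B = 2 powr of_int j"
  let ?A = "\<lambda>m. {Q\<in>\<A>. ratio_level Q = m}"
  let ?w = "\<lambda>Q. vol Q powr (- 2 * \<beta>) * (\<sigma> Q)\<^sup>2 * \<omega> Q"
  let ?z = "\<lambda>R. \<sigma> R powr (2 / p) * \<omega> R powr (1 - 2 / q)"
  have p: "0 < p" using exponents by simp
  have h: "0 < h" "0 < B" by (auto simp: h_def B_def)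
  have fin: "finite \<A>" using \<A>(1) assms(2) finite_subset by auto
  have AD: "\<A> \<subseteq> D" using \<A>(1) assms(3) by auto
  have eb: "h * \<omega> Q \<le> e Q" "e Q \<le> 2 * h * \<omega> Q" if "Q \<in> \<A>" for Q
  proof -
    have "0 < \<omega> Q" using that AD \<omega>_pos by auto
    then show "h * \<omega> Q \<le> e Q" "e Q \<le> 2 * h * \<omega> Q"
      using level_bounds[of "e Q / \<omega> Q"] \<A>(3)[OF that] i[OF that] by (auto simp: h_def field_simps)
  qed
  have Bb: "B \<le> two_weight_at Q" "two_weight_at Q \<le> 2 * B" if "Q \<in> \<A>" for Q
    using level_bounds[of "two_weight_at Q"] j[OF that] two_weight_at_pos[of Q] that AD by (auto simp: B_def)
  have per_level: "(\<Sum>Q\<in>?A m. (favg Q)\<^sup>2 * e Q) \<le> 8 * packing_const (real CARD('n)) q \<beta> * h * B\<^sup>2 *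
      (\<Sum>R\<in>maximal_sets (?A m). (2 powr (p * of_int m) * \<sigma> R) powr (2 / p) * \<omega> R powr (1 - 2 / q))" for m
  proof -
    let ?y = "2 powr of_int m :: real"
    have "(\<Sum>Q\<in>?A m. (favg Q)\<^sup>2 * e Q) \<le> (\<Sum>Q\<in>?A m. (2 * ?y)\<^sup>2 * (2 * h) * ?w Q)"
    proof (rule sum_mono)
      fix Q assume "Q \<in> ?A m"
      then have Q: "Q \<in> \<A>" "ratio_level Q = m" "Q \<in> D" using AD by auto
      have "(favg Q)\<^sup>2 = vol Q powr (- 2 * \<beta>) * (F Q)\<^sup>2"
        using measure_D_pos[OF Q(3)]
        by (simp add: favg_def power_mult_distrib power2_eq_square[of "_ powr _"] flip: powr_add)
      moreover have "(F Q)\<^sup>2 \<le> (2 * ?y * \<sigma> Q)\<^sup>2"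
        using ratio_level_bounds[OF Q(3) \<A>(2)[OF Q(1)]] \<A>(2)[OF Q(1)] Q(2) by (intro power_mono) auto
      ultimately have "(favg Q)\<^sup>2 * e Q \<le> (vol Q powr (- 2 * \<beta>) * (2 * ?y * \<sigma> Q)\<^sup>2) * (2 * h * \<omega> Q)"
        using eb[OF Q(1)] \<A>(3)[OF Q(1)] by (intro mult_mono) (auto intro!: mult_left_mono)
      also have "\<dots> = (2 * ?y)\<^sup>2 * (2 * h) * ?w Q" by (simp add: power_mult_distrib mult_ac)
      finally show "(favg Q)\<^sup>2 * e Q \<le> (2 * ?y)\<^sup>2 * (2 * h) * ?w Q" .
    qed
    also have "\<dots> = (2 * ?y)\<^sup>2 * (2 * h) * (\<Sum>Q\<in>?A m. ?w Q)" by (simp add: sum_distrib_left)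
    also have "\<dots> \<le> (2 * ?y)\<^sup>2 * (2 * h) * (packing_const (real CARD('n)) q \<beta> * B\<^sup>2 * (\<Sum>R\<in>maximal_sets (?A m). ?z R))"
      using assms(1) fin AD h Bb by (intro mult_left_mono packing_two_weight_class) auto
    also have "\<dots> = 8 * packing_const (real CARD('n)) q \<beta> * h * B\<^sup>2 * (\<Sum>R\<in>maximal_sets (?A m). ?y\<^sup>2 * ?z R)"
      by (simp add: sum_distrib_left power_mult_distrib mult_ac)
    also have "(\<Sum>R\<in>maximal_sets (?A m). ?y\<^sup>2 * ?z R)
        = (\<Sum>R\<in>maximal_sets (?A m). (2 powr (p * of_int m) * \<sigma> R) powr (2 / p) * \<omega> R powr (1 - 2 / q))"
    proof (rule sum.cong[OF refl])
      fix R assume "R \<in> maximal_sets (?A m)"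
      then have "R \<in> D" using maximal_sets_subset[of "?A m"] AD by auto
      then show "?y\<^sup>2 * ?z R = (2 powr (p * of_int m) * \<sigma> R) powr (2 / p) * \<omega> R powr (1 - 2 / q)"
        using \<sigma>_pos[of R] p by (simp add: powr_mult powr_powr power2_eq_square mult.commute flip: powr_add)
    qed
    finally show ?thesis .
  qed
  \<comment> \<open>\<open>W / h\<close> takes the place of \<open>V\<close> in
    \<open>maximal_bound\<close>.\<close>
  have mass: "sum \<omega> \<B> \<le> W / h" if "\<B> \<subseteq> \<A>" "disjoint \<B>" for \<B>
  proof -
    have "h * sum \<omega> \<B> \<le> sum e \<B>"
      unfolding sum_distrib_left using eb(1) that(1) by (intro sum_mono) auto
    also have "\<dots> \<le> W" using that fin AD finite_subset by (intro e_sum) auto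
    finally show ?thesis using h by (simp add: field_simps)
  qed
  have "(\<Sum>Q\<in>\<A>. (favg Q)\<^sup>2 * e Q) = (\<Sum>m\<in>ratio_level ` \<A>. \<Sum>Q\<in>?A m. (favg Q)\<^sup>2 * e Q)"
    by (rule sum.image_gen[OF fin])
  also have "\<dots> \<le> (\<Sum>m\<in>ratio_level ` \<A>. 8 * packing_const (real CARD('n)) q \<beta> * h * B\<^sup>2 *
      (\<Sum>R\<in>maximal_sets (?A m). (2 powr (p * of_int m) * \<sigma> R) powr (2 / p) * \<omega> R powr (1 - 2 / q)))"
    by (intro sum_mono per_level)
  also have "\<dots> = 8 * packing_const (real CARD('n)) q \<beta> * h * B\<^sup>2 * (\<Sum>m\<in>ratio_level ` \<A>.
      \<Sum>R\<in>maximal_sets (?A m). (2 powr (p * of_int m) * \<sigma> R) powr (2 / p) * \<omega> R powr (1 - 2 / q))"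
    by (simp add: sum_distrib_left)
  also have "\<dots> \<le> 8 * packing_const (real CARD('n)) q \<beta> * h * B\<^sup>2 * (\<Gamma> * N powr (2 / p) * (W / h) powr (1 - 2 / q))"
  proof (rule mult_left_mono)
    have "\<A> \<subseteq> \<S> \<and> (\<forall>Q\<in>\<A>. 0 < F Q) \<and> 0 \<le> W / h \<and> (\<forall>\<B>\<subseteq>\<A>. disjoint \<B> \<longrightarrow> sum \<omega> \<B> \<le> W / h)"
      using \<A> mass assms(6) h by simp
    then show "(\<Sum>m\<in>ratio_level ` \<A>. \<Sum>R\<in>maximal_sets (?A m).
        (2 powr (p * of_int m) * \<sigma> R) powr (2 / p) * \<omega> R powr (1 - 2 / q))
      \<le> \<Gamma> * N powr (2 / p) * (W / h) powr (1 - 2 / q)"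
      using assms(4) unfolding maximal_bound_def by (elim allE impE) simp_all
    show "0 \<le> 8 * packing_const (real CARD('n)) q \<beta> * h * B\<^sup>2" using packing_const_nonneg[OF assms(1)] h by simp
  qed
  also have "\<dots> = (8 * packing_const (real CARD('n)) q \<beta> * \<Gamma> * N powr (2 / p) * W powr (1 - 2 / q)) * B\<^sup>2 * (h * h powr (- (1 - 2 / q)))"
  proof -
    have "(W / h) powr (1 - 2 / q) = W powr (1 - 2 / q) * h powr (- (1 - 2 / q))"
      unfolding powr_divide powr_minus by (rule divide_inverse)
    then show ?thesis by (simp only: mult_ac)
  qed
  also have "h * h powr (- (1 - 2 / q)) = h powr 1 * h powr (- (1 - 2 / q))" using h by simp
  also have "\<dots> = 2 powr (2 / q * of_int i)"
    unfolding powr_add[symmetric] by (simp add: h_def powr_powr mult.commute)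
  finally show ?thesis by (simp add: B_def)
qed

text \<open>The dual form of the weak-type bound, with the square sum tested against the mass of a
  set. Two geometric sums combine the classes: levels of \<open>two_weight_at\<close> are capped by
  that of \<open>K\<close>, levels of \<open>e / \<omega>\<close> by 0.\<close>

theorem weak_type_high:
  assumes "2 < q" "finite \<S>" "\<S> \<subseteq> D" "maximal_bound \<S> \<Gamma>" "0 \<le> \<Gamma>" "0 \<le> W"
    and e_sum: "\<And>\<B>. finite \<B> \<Longrightarrow> \<B> \<subseteq> D \<Longrightarrow> disjoint \<B> \<Longrightarrow> sum e \<B> \<le> W"
    and e: "\<And>Q. Q \<in> D \<Longrightarrow> 0 \<le> e Q" "\<And>Q. Q \<in> D \<Longrightarrow> e Q \<le> \<omega> Q"
  shows "(\<Sum>Q\<in>\<S>. (favg Q)\<^sup>2 * e Q) \<le> high_const (real CARD('n)) q \<beta> * \<Gamma> * K\<^sup>2 * N powr (2 / p) * W powr (1 - 2 / q)"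
proof -
  define \<A> where "\<A> = {Q\<in>\<S>. 0 < F Q \<and> 0 < e Q}"
  define E where "E = 8 * packing_const (real CARD('n)) q \<beta> * \<Gamma> * N powr (2 / p) * W powr (1 - 2 / q)"
  let ?i = "\<lambda>Q. level (e Q / \<omega> Q)" and ?j = "\<lambda>Q. level (two_weight_at Q)"
  have E: "0 \<le> E" using packing_const_nonneg[OF assms(1)] assms(5) by (simp add: E_def)
  have fin: "finite \<A>" using assms(2) by (auto simp: \<A>_def)
  have AD: "\<A> \<subseteq> \<S>" "\<A> \<subseteq> D" using assms(3) by (auto simp: \<A>_def)
  have pos: "0 < F Q" "0 < e Q" if "Q \<in> \<A>" for Q using that by (auto simp: \<A>_def)
  have "(\<Sum>Q\<in>\<S>. (favg Q)\<^sup>2 * e Q) = (\<Sum>Q\<in>\<A>. (favg Q)\<^sup>2 * e Q)"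
    using F_nonneg e assms(2,3)
    by (intro sum.mono_neutral_right) (auto simp: \<A>_def favg_def less_le dest!: subsetD)
  also have "\<dots> \<le> (E * geo (2 / q)) * geo 2 * 2 powr (2 * of_int (level K))"
  proof (rule sum_levels_le_geo[where l = ?j])
    show "?j Q \<le> level K" if "Q \<in> \<A>" for Q
      using that AD(2) by (intro level_mono two_weight_at_pos two_weight_at_le) auto
    show "0 \<le> E * geo (2 / q)" using E assms(1) by (intro mult_nonneg_nonneg less_imp_le[OF geo_pos]) auto
    fix j
    let ?A = "{Q\<in>\<A>. ?j Q = j}"
    have "(\<Sum>Q\<in>?A. (favg Q)\<^sup>2 * e Q) \<le> (E * (2 powr of_int j)\<^sup>2) * geo (2 / q) * 2 powr (2 / q * of_int 0)"
    proof (rule sum_levels_le_geo[where l = ?i])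
      show "?i Q \<le> 0" if "Q \<in> ?A" for Q
      proof -
        have Q: "Q \<in> D" "0 < e Q" using that AD(2) pos by auto
        have "?i Q \<le> level 1"
          using Q \<omega>_pos[OF Q(1)] e(2)[OF Q(1)] by (intro level_mono) auto
        then show ?thesis by (simp add: level_def)
      qed
      fix i
      show "(\<Sum>Q\<in>{Q\<in>?A. ?i Q = i}. (favg Q)\<^sup>2 * e Q) \<le> E * (2 powr of_int j)\<^sup>2 * 2 powr (2 / q * of_int i)"
        unfolding E_def
        by (rule weak_type_high_class[OF assms(1-6) e_sum]) (use AD pos in auto)
    qed (use fin assms(1) E in auto)
    also have "\<dots> = E * geo (2 / q) * 2 powr (2 * of_int j)"
      by (simp add: power2_eq_square flip: powr_add)
    finally show "(\<Sum>Q\<in>?A. (favg Q)\<^sup>2 * e Q) \<le> E * geo (2 / q) * 2 powr (2 * of_int j)" .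
  qed (use fin in auto)
  also have "2 powr (2 * of_int (level K)) = (2 powr of_int (level K) :: real)\<^sup>2"
    by (simp add: power2_eq_square flip: powr_add)
  also have "(E * geo (2 / q)) * geo 2 * (2 powr of_int (level K))\<^sup>2 \<le> (E * geo (2 / q)) * geo 2 * K\<^sup>2"
    using E assms(1) level_bounds(1)[OF K_pos]
    by (intro mult_left_mono power_mono mult_nonneg_nonneg less_imp_le[OF geo_pos]) auto
  finally show ?thesis by (simp add: high_const_def E_def mult_ac)
qed

end

subsection \<open>Weighted measures\<close>

lemma space_sets_weighted [simp]: "space (weighted u) = UNIV" "sets (weighted u) = sets lebesgue"
  by (simp_all add: weighted_def)

lemma emeasure_weighted:
  assumes "u \<in> borel_measurable lebesgue" "A \<in> sets lebesgue"
  shows "emeasure (weighted u) A = (\<integral>\<^sup>+x\<in>A. ennreal (u x) \<partial>lebesgue)"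
  unfolding weighted_def using assms by (intro emeasure_density) auto

lemma ennreal_divide_mult_cancel:
  fixes a b :: ennreal
  assumes "0 < b" "b < top"
  shows "a / b * b = a"
  using assms by (simp add: ennreal_divide_times)

context dyadic_lattice
begin

lemma disjoint_family_D: "disjoint \<A> \<Longrightarrow> disjoint_family_on (\<lambda>Q. Q) \<A>"
  by (auto simp: disjoint_family_on_def disjoint_def)

lemma sum_emeasure_le:
  assumes "sets M = sets lebesgue" "finite \<A>" "\<A> \<subseteq> D" "disjoint \<A>" "R \<in> sets lebesgue" "\<Union>\<A> \<subseteq> R"
  shows "(\<Sum>Q\<in>\<A>. emeasure M Q) \<le> emeasure M R"
proof -
  have "(\<Sum>Q\<in>\<A>. emeasure M Q) = emeasure M (\<Union>Q\<in>\<A>. Q)"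
    using assms sets_D by (intro sum_emeasure disjoint_family_D) auto
  also have "\<dots> \<le> emeasure M R" using assms by (intro emeasure_mono) auto
  finally show ?thesis .
qed

lemma superadditive_measure:
  assumes "sets M = sets lebesgue" "\<And>Q. Q \<in> D \<Longrightarrow> emeasure M Q < \<infinity>"
  shows "superadditive D (measure M)"
  unfolding superadditive_def
proof (intro conjI ballI allI impI)
  fix \<A> R assume A: "finite \<A> \<and> \<A> \<subseteq> D \<and> disjoint \<A> \<and> R \<in> D \<and> \<Union>\<A> \<subseteq> R"
  have eq: "emeasure M Q = ennreal (measure M Q)" if "Q \<in> D" for Q
    using assms(2)[OF that] by (intro emeasure_eq_ennreal_measure) auto
  have "(\<Sum>Q\<in>\<A>. emeasure M Q) = (\<Sum>Q\<in>\<A>. ennreal (measure M Q))"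
    using A eq by (intro sum.cong) auto
  then have "ennreal (sum (measure M) \<A>) = (\<Sum>Q\<in>\<A>. emeasure M Q)" by simp
  also have "\<dots> \<le> emeasure M R" using A sets_D by (intro sum_emeasure_le assms(1)) auto
  also have "\<dots> = ennreal (measure M R)" using A eq by auto
  finally show "sum (measure M) \<A> \<le> measure M R" by (simp add: measure_nonneg)
qed auto

text \<open>If the mean of \<open>f / s\<close> over \<open>Q\<close> is at least \<open>2\<^sup>m\<close>, then half of the mass of \<open>f\<close> sits where
  \<open>f / s > 2\<^sup>m\<^sup>-\<^sup>1\<close>; for fixed \<open>x\<close> the levels \<open>m\<close> with this property form a geometric progression.\<close>

lemma level_sum_measure:
  fixes f s :: "real ^ 'n \<Rightarrow> real"
  assumes meas: "f \<in> borel_measurable lebesgue" "s \<in> borel_measurable lebesgue"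
    and pos: "\<And>x. 0 \<le> f x" "\<And>x. 0 < s x" and p: "1 < p"
    and fin: "\<And>Q. Q \<in> D \<Longrightarrow> emeasure (weighted f) Q < \<infinity>" "\<And>Q. Q \<in> D \<Longrightarrow> emeasure (weighted s) Q < \<infinity>"
    and M: "finite M" "\<And>m. m \<in> M \<Longrightarrow> finite (\<P> m) \<and> \<P> m \<subseteq> D \<and> disjoint (\<P> m)"
    and large: "\<And>m Q. m \<in> M \<Longrightarrow> Q \<in> \<P> m \<Longrightarrow> 2 powr of_int m * measure (weighted s) Q \<le> measure (weighted f) Q"
  shows "ennreal (\<Sum>m\<in>M. \<Sum>Q\<in>\<P> m. 2 powr (p * of_int m) * measure (weighted s) Q)
    \<le> ennreal (2 powr p * geo (p - 1)) * (\<integral>\<^sup>+x. ennreal (f x powr p * s x powr (1 - p)) \<partial>lebesgue)"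
proof -
  define h where "h = (\<lambda>m x. if f x > 2 powr (of_int m - 1) * s x then f x else 0)"
  have h_meas [measurable]: "h m \<in> borel_measurable lebesgue" for m
    unfolding h_def using meas by measurable
  have h_le: "0 \<le> h m x" "h m x \<le> f x" for m x using pos by (auto simp: h_def)
  have eqs: "emeasure (weighted s) Q = ennreal (measure (weighted s) Q)"
    "emeasure (weighted f) Q = ennreal (measure (weighted f) Q)" if "Q \<in> D" for Q
    using fin[OF that] by (auto intro!: emeasure_eq_ennreal_measure)
  \<comment> \<open>The part of \<open>f\<close> that \<open>h m\<close> discards has mass at most
    \<open>2 powr (m - 1)\<close> times that of \<open>s\<close>, hence at most half the mass of
    \<open>f\<close>.\<close>
  have half: "ennreal (2 powr of_int m * measure (weighted s) Q) \<le> 2 * emeasure (weighted (h m)) Q"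
    if m: "m \<in> M" and Q: "Q \<in> \<P> m" for m Q
  proof -
    let ?S = "measure (weighted s) Q" and ?y = "2 powr (of_int m - 1) :: real"
    have QD: "Q \<in> D" using M(2)[OF m] Q by auto
    have y: "2 powr of_int m = 2 * ?y" by (simp add: powr_diff)
    have "emeasure (weighted (h m)) Q \<le> emeasure (weighted f) Q"
      using meas sets_D[OF QD] h_le
      by (subst (1 2) emeasure_weighted) (auto intro!: nn_integral_mono mult_right_mono ennreal_leI)
    then have "emeasure (weighted (h m)) Q < \<infinity>" using fin(1)[OF QD] by (rule le_less_trans)
    then have eqh: "emeasure (weighted (h m)) Q = ennreal (measure (weighted (h m)) Q)"
      by (intro emeasure_eq_ennreal_measure) auto
    have "emeasure (weighted f) Q \<le> (\<integral>\<^sup>+x. (ennreal (h m x) * indicator Q x + ennreal ?y * (ennreal (s x) * indicator Q x)) \<partial>lebesgue)"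
      unfolding emeasure_weighted[OF meas(1) sets_D[OF QD]]
      using less_imp_le[OF pos(2)] pos(1)
      by (intro nn_integral_mono)
        (auto simp: h_def indicator_def ennreal_mult'[symmetric] not_less intro!: ennreal_leI)
    also have "\<dots> = (\<integral>\<^sup>+x\<in>Q. ennreal (h m x) \<partial>lebesgue) + ennreal ?y * (\<integral>\<^sup>+x\<in>Q. ennreal (s x) \<partial>lebesgue)"
      using meas sets_D[OF QD] by (subst nn_integral_add) (auto simp: nn_integral_cmult)
    also have "\<dots> = emeasure (weighted (h m)) Q + ennreal ?y * emeasure (weighted s) Q"
      using meas sets_D[OF QD] by (simp add: emeasure_weighted)
    also have "\<dots> = ennreal (measure (weighted (h m)) Q + ?y * ?S)"
      by (simp add: eqh eqs QD ennreal_mult)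
    finally have "measure (weighted f) Q \<le> measure (weighted (h m)) Q + ?y * ?S"
      by (simp add: eqs QD flip: ennreal_plus)
    then have "2 powr of_int m * ?S \<le> 2 * measure (weighted (h m)) Q"
      using large[OF m Q] unfolding y by simp
    then have "ennreal (2 powr of_int m * ?S) \<le> ennreal (2 * measure (weighted (h m)) Q)" by (rule ennreal_leI)
    then show ?thesis by (simp add: eqh ennreal_mult)
  qed
  \<comment> \<open>One factor \<open>2 powr m\<close> is spent on \<open>half\<close>; the
    remaining \<open>2 powr ((p - 1) * m)\<close> makes the sum over the levels geometric at each
    point.\<close>
  have "ennreal (\<Sum>m\<in>M. \<Sum>Q\<in>\<P> m. 2 powr (p * of_int m) * measure (weighted s) Q)
      = (\<Sum>m\<in>M. \<Sum>Q\<in>\<P> m. ennreal (2 powr ((p - 1) * of_int m)) * ennreal (2 powr of_int m * measure (weighted s) Q))"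
    by (simp add: sum_nonneg ennreal_mult'[symmetric] mult.assoc[symmetric] left_diff_distrib flip: sum_ennreal powr_add)
  also have "\<dots> \<le> (\<Sum>m\<in>M. \<Sum>Q\<in>\<P> m. ennreal (2 powr ((p - 1) * of_int m)) * (2 * emeasure (weighted (h m)) Q))"
    by (intro sum_mono mult_left_mono half) auto
  also have "\<dots> = (\<Sum>m\<in>M. ennreal (2 powr ((p - 1) * of_int m)) * 2 * (\<Sum>Q\<in>\<P> m. emeasure (weighted (h m)) Q))"
    by (simp add: sum_distrib_left mult.assoc)
  also have "\<dots> \<le> (\<Sum>m\<in>M. ennreal (2 powr ((p - 1) * of_int m)) * 2 * emeasure (weighted (h m)) UNIV)"
    using M(2) by (intro sum_mono mult_left_mono sum_emeasure_le) auto
  also have "\<dots> = (\<integral>\<^sup>+x. (\<Sum>m\<in>M. ennreal (2 powr ((p - 1) * of_int m)) * 2 * ennreal (h m x)) \<partial>lebesgue)"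
    by (subst nn_integral_sum) (auto simp: emeasure_weighted nn_integral_cmult)
  also have "\<dots> \<le> (\<integral>\<^sup>+x. ennreal (2 powr p * geo (p - 1)) * ennreal (f x powr p * s x powr (1 - p)) \<partial>lebesgue)"
  proof (rule nn_integral_mono)
    fix x
    define M' where "M' = {m\<in>M. f x > 2 powr (of_int m - 1) * s x}"
    have "(\<Sum>m\<in>M. 2 powr ((p - 1) * of_int m) * 2 * h m x) = (\<Sum>m\<in>M'. 2 powr ((p - 1) * of_int m) * 2 * f x)"
      using M(1) by (intro sum.mono_neutral_cong_right) (auto simp: M'_def h_def)
    also have "\<dots> \<le> 2 powr p * geo (p - 1) * (f x powr p * s x powr (1 - p))"
    proof (cases "f x = 0")
      case False
      then have fx: "0 < f x" using pos(1)[of x] by simp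
      \<comment> \<open>The levels occurring at \<open>x\<close> are exactly those in
        \<open>M\<close> with \<open>2 powr m < ?r\<close>.\<close>
      let ?r = "2 * f x / s x"
      have r: "0 < ?r" using fx pos(2)[of x] by simp
      have "m \<le> level ?r" if "m \<in> M'" for m
      proof -
        have "2 powr of_int m < ?r" using that pos(2)[of x] by (simp add: M'_def powr_diff field_simps)
        then have "level (2 powr of_int m) \<le> level ?r" by (intro level_mono) auto
        then show ?thesis by (simp add: level_def)
      qed
      then have "(\<Sum>m\<in>M'. 2 powr ((p - 1) * of_int m)) \<le> geo (p - 1) * 2 powr ((p - 1) * of_int (level ?r))"
        using M(1) p by (intro sum_powr_le_geo) (auto simp: M'_def)
      also have "2 powr ((p - 1) * of_int (level ?r)) = (2 powr of_int (level ?r)) powr (p - 1)"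
        by (simp add: powr_powr mult.commute)
      also have "geo (p - 1) * \<dots> \<le> geo (p - 1) * ?r powr (p - 1)"
        using level_bounds(1)[OF r] p by (intro mult_left_mono powr_mono2 less_imp_le[OF geo_pos]) auto
      finally have "(\<Sum>m\<in>M'. 2 powr ((p - 1) * of_int m)) * (2 * f x) \<le> geo (p - 1) * ?r powr (p - 1) * (2 * f x)"
        using fx by (intro mult_right_mono) auto
      moreover have key: "?r powr (p - 1) * (2 * f x) = 2 powr p * (f x powr p * s x powr (1 - p))"
        by (rule ln_inj_iff[THEN iffD1])
          (use fx pos(2)[of x] in \<open>simp_all add: ln_mult ln_powr ln_div algebra_simps\<close>)
      moreover have "(\<Sum>m\<in>M'. 2 powr ((p - 1) * of_int m) * 2 * f x)
          = (\<Sum>m\<in>M'. 2 powr ((p - 1) * of_int m)) * (2 * f x)"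
        by (simp only: sum_distrib_right mult.assoc)
      moreover have "geo (p - 1) * ?r powr (p - 1) * (2 * f x)
          = 2 powr p * geo (p - 1) * (f x powr p * s x powr (1 - p))"
        unfolding mult.assoc[of "geo (p - 1)" "?r powr (p - 1)"] key by (simp only: mult_ac)
      ultimately show ?thesis by simp
    qed simp
    finally have "ennreal (\<Sum>m\<in>M. 2 powr ((p - 1) * of_int m) * 2 * h m x)
        \<le> ennreal (2 powr p * geo (p - 1) * (f x powr p * s x powr (1 - p)))" by (rule ennreal_leI)
    then show "(\<Sum>m\<in>M. ennreal (2 powr ((p - 1) * of_int m)) * 2 * ennreal (h m x))
        \<le> ennreal (2 powr p * geo (p - 1)) * ennreal (f x powr p * s x powr (1 - p))"
      using h_le p by (simp add: ennreal_mult sum_nonneg less_imp_le[OF geo_pos] flip: sum_ennreal)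
  qed
  also have "\<dots> = ennreal (2 powr p * geo (p - 1)) * (\<integral>\<^sup>+x. ennreal (f x powr p * s x powr (1 - p)) \<partial>lebesgue)"
    by (intro nn_integral_cmult measurable_compose[OF _ measurable_ennreal] borel_measurable_times
        powr_real_measurable meas borel_measurable_const)
  finally show ?thesis .
qed

section \<open>The A_infinity constant and Carleson sums\<close>

lemma Ainfty_integral_le:
  assumes u: "u \<in> borel_measurable lebesgue" and fin: "emeasure (weighted u) R < \<infinity>" "0 < emeasure (weighted u) R"
    and R: "R \<in> D"
  shows "(\<integral>\<^sup>+x\<in>R. dyadic_maximal D (\<lambda>y. indicator R y * u y) x \<partial>lebesgue) \<le> Ainfty_const D u * emeasure (weighted u) R"
proof -
  let ?I = "\<integral>\<^sup>+x\<in>R. ennreal (u x) \<partial>lebesgue"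
  let ?M = "\<integral>\<^sup>+x\<in>R. dyadic_maximal D (\<lambda>y. indicator R y * u y) x \<partial>lebesgue"
  have I: "emeasure (weighted u) R = ?I" by (rule emeasure_weighted[OF u sets_D[OF R]])
  have "?M / ?I = (if ?I = \<infinity> then \<infinity> else ?M / ?I)" using fin unfolding I by auto
  also have "\<dots> \<le> Ainfty_const D u" unfolding Ainfty_const_def by (rule SUP_upper[OF R])
  finally have "?M / ?I * ?I \<le> Ainfty_const D u * ?I" by (rule mult_right_mono) simp
  moreover have "?M / ?I * ?I = ?M" using fin unfolding I by (intro ennreal_divide_mult_cancel) auto
  ultimately show ?thesis by (simp add: I)
qed

lemma avg_le_dyadic_maximal:
  assumes "Q \<in> D" "Q \<subseteq> R" "x \<in> Q" "\<And>x. 0 \<le> u x"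
  shows "avg Q u \<le> dyadic_maximal D (\<lambda>y. indicator R y * u y) x"
proof -
  have "avg Q u = avg Q (\<lambda>y. \<bar>indicator R y * u y\<bar>)"
    unfolding avg_def using assms(2,4)
    by (intro arg_cong2[where f = "(/)"] nn_integral_cong refl) (auto simp: indicator_def)
  also have "\<dots> \<le> dyadic_maximal D (\<lambda>y. indicator R y * u y) x"
    unfolding dyadic_maximal_def using assms by (intro SUP_upper) auto
  finally show ?thesis .
qed

lemma avg_mult_emeasure:
  assumes "u \<in> borel_measurable lebesgue" "Q \<in> D"
  shows "avg Q u * emeasure lebesgue Q = emeasure (weighted u) Q"
proof -
  have "0 < emeasure lebesgue Q" "emeasure lebesgue Q < top"
    using assms(2) measure_D_pos by (auto simp: emeasure_D_eq)
  then show ?thesis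
    unfolding avg_def emeasure_weighted[OF assms(1) sets_D[OF assms(2)]]
    by (rule ennreal_divide_mult_cancel)
qed

text \<open>The average over \<open>R\<close> itself competes in the maximal function. This allows
  the constant to be inserted into an estimate that holds without it, and keeps it away from
  0.\<close>

lemma Ainfty_ge_one:
  assumes u: "u \<in> borel_measurable lebesgue" "\<And>x. 0 \<le> u x"
    and pos: "\<And>Q. Q \<in> D \<Longrightarrow> 0 < emeasure (weighted u) Q"
  shows "1 \<le> Ainfty_const D u"
proof -
  obtain R where R: "R \<in> D" using D_nonempty by auto
  show ?thesis
  proof (cases "emeasure (weighted u) R < \<infinity>")
    case True
    have "emeasure (weighted u) R = (\<integral>\<^sup>+x\<in>R. avg R u \<partial>lebesgue)"
      using avg_mult_emeasure[OF u(1) R] sets_D[OF R] by (simp add: nn_integral_cmult_indicator)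
    also have "\<dots> \<le> (\<integral>\<^sup>+x\<in>R. dyadic_maximal D (\<lambda>y. indicator R y * u y) x \<partial>lebesgue)"
      using avg_le_dyadic_maximal[OF R, of R _ u] u(2)
      by (intro nn_integral_mono) (auto simp: indicator_def)
    also have "\<dots> \<le> Ainfty_const D u * emeasure (weighted u) R"
      using Ainfty_integral_le[OF u(1)] pos[OF R] R True by auto
    finally have "emeasure (weighted u) R * 1 \<le> emeasure (weighted u) R * Ainfty_const D u"
      by (simp add: mult.commute)
    then show ?thesis using pos[OF R] True by (subst (asm) ennreal_mult_le_mult_iff) auto
  next
    case False
    \<comment> \<open>A cube of infinite mass makes the constant infinite by convention.\<close>
    then have "(\<integral>\<^sup>+x\<in>R. ennreal (u x) \<partial>lebesgue) = \<infinity>"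
      using emeasure_weighted[OF u(1) sets_D[OF R]] by (simp add: not_less top_unique)
    then have "\<infinity> \<le> Ainfty_const D u"
      unfolding Ainfty_const_def using R by (intro SUP_upper2[of R]) auto
    then show ?thesis by (simp add: top.extremum_unique)
  qed
qed

text \<open>\<open>avg Q u\<close> is at most the localized maximal function on \<open>E Q\<close>,
  which carries at least the fraction \<open>\<gamma>\<close> of the volume of \<open>Q\<close>. As
  the sets \<open>E Q\<close> are disjoint and lie in \<open>R\<close>, the masses sum to at most
  \<open>1 / \<gamma>\<close> times the integral of the maximal function over
  \<open>R\<close>.\<close>

lemma carleson_sparse:
  assumes u: "u \<in> borel_measurable lebesgue" "\<And>x. 0 \<le> u x"
    and fin: "\<And>Q. Q \<in> D \<Longrightarrow> emeasure (weighted u) Q < \<infinity> \<and> 0 < emeasure (weighted u) Q"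
    and L: "Ainfty_const D u = ennreal L" "0 \<le> L"
    and \<S>: "\<S> \<subseteq> D" "sparse_collection \<gamma> \<S>" "0 < \<gamma>"
    and \<B>: "R \<in> D" "finite \<B>" "\<B> \<subseteq> \<S>" "\<And>Q. Q \<in> \<B> \<Longrightarrow> Q \<subseteq> R"
  shows "sum (measure (weighted u)) \<B> \<le> L / \<gamma> * measure (weighted u) R"
proof -
  let ?v = "measure (weighted u)"
  obtain E where E: "\<And>Q. Q \<in> \<S> \<Longrightarrow> E Q \<subseteq> Q" "\<And>Q. Q \<in> \<S> \<Longrightarrow> E Q \<in> sets lebesgue"
    "\<And>Q. Q \<in> \<S> \<Longrightarrow> \<gamma> * measure lebesgue Q \<le> measure lebesgue (E Q)" "disjoint_family_on E \<S>"
    using \<S>(2) unfolding sparse_collection_def by auto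
  have eq: "emeasure (weighted u) Q = ennreal (?v Q)" if "Q \<in> D" for Q
    using fin[OF that] by (intro emeasure_eq_ennreal_measure) auto
  have BD: "Q \<in> D" "Q \<in> \<S>" if "Q \<in> \<B>" for Q using that \<B> \<S>(1) by auto
  have single: "ennreal (\<gamma> * ?v Q) \<le> (\<integral>\<^sup>+x. avg Q u * indicator (E Q) x \<partial>lebesgue)" if "Q \<in> \<B>" for Q
  proof -
    note Q = BD[OF that]
    have "emeasure lebesgue (E Q) \<le> emeasure lebesgue Q" by (intro emeasure_mono E sets_D Q)
    then have "emeasure lebesgue (E Q) < top" using emeasure_D[OF Q(1)] by (metis ennreal_less_top le_less_trans)
    then have EQ: "emeasure lebesgue (E Q) = ennreal (measure lebesgue (E Q))"
      by (intro emeasure_eq_ennreal_measure) auto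
    have "ennreal (\<gamma> * ?v Q) = ennreal \<gamma> * (avg Q u * emeasure lebesgue Q)"
      using avg_mult_emeasure[OF u(1) Q(1)] eq[OF Q(1)] \<S>(3) by (simp add: ennreal_mult)
    also have "\<dots> = avg Q u * ennreal (\<gamma> * measure lebesgue Q)"
      using \<S>(3) by (simp add: emeasure_D_eq[OF Q(1)] ennreal_mult mult_ac)
    also have "\<dots> \<le> avg Q u * emeasure lebesgue (E Q)"
      unfolding EQ by (intro mult_left_mono ennreal_leI E(3) Q) auto
    finally show ?thesis using E(2)[OF Q(2)] by (simp add: nn_integral_cmult_indicator)
  qed
  have "ennreal (\<gamma> * sum ?v \<B>) = (\<Sum>Q\<in>\<B>. ennreal (\<gamma> * ?v Q))"
    using \<S>(3) by (simp add: sum_distrib_left sum_ennreal)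
  also have "\<dots> \<le> (\<Sum>Q\<in>\<B>. \<integral>\<^sup>+x. avg Q u * indicator (E Q) x \<partial>lebesgue)" by (intro sum_mono single)
  also have "\<dots> = (\<integral>\<^sup>+x. (\<Sum>Q\<in>\<B>. avg Q u * indicator (E Q) x) \<partial>lebesgue)"
    using E(2) BD by (intro nn_integral_sum[symmetric]) auto
  also have "\<dots> \<le> (\<integral>\<^sup>+x\<in>R. dyadic_maximal D (\<lambda>y. indicator R y * u y) x \<partial>lebesgue)"
  proof (rule nn_integral_mono)
    fix x
    show "(\<Sum>Q\<in>\<B>. avg Q u * indicator (E Q) x) \<le> dyadic_maximal D (\<lambda>y. indicator R y * u y) x * indicator R x"
    proof (cases "\<exists>Q\<in>\<B>. x \<in> E Q")
      case True
      then obtain Q where Q: "Q \<in> \<B>" "x \<in> E Q" by auto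
      have "x \<notin> E Q'" if "Q' \<in> \<B>" "Q' \<noteq> Q" for Q'
        using E(4) Q that BD by (auto simp: disjoint_family_on_def)
      then have "(\<Sum>Q'\<in>\<B>. avg Q' u * indicator (E Q') x) = (\<Sum>Q'\<in>{Q}. avg Q' u * indicator (E Q') x)"
        using Q \<B>(2) by (intro sum.mono_neutral_right) auto
      then show ?thesis
        using Q E(1)[OF BD(2)[OF Q(1)]] \<B>(4)[OF Q(1)] avg_le_dyadic_maximal[OF BD(1)[OF Q(1)] \<B>(4)[OF Q(1)] _ u(2), of x]
        by (auto simp: indicator_def)
    qed auto
  qed
  also have "\<dots> \<le> Ainfty_const D u * emeasure (weighted u) R"
    using Ainfty_integral_le[OF u(1)] fin[OF \<B>(1)] \<B>(1) by auto
  also have "\<dots> = ennreal (L * ?v R)" using L by (simp add: eq[OF \<B>(1)] ennreal_mult)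
  finally have "\<gamma> * sum ?v \<B> \<le> L * ?v R" using L(2) by (simp add: ennreal_le_iff)
  then show ?thesis using \<S>(3) by (simp add: field_simps)
qed

end

subsection \<open>Level sets of the sparse operator\<close>

lemma epowr_ennreal: "0 < a \<Longrightarrow> ennreal a epowr c = ennreal (a powr c)"
  by (simp add: epowr_def)

lemma epowr_ennreal': "0 \<le> a \<Longrightarrow> c \<noteq> 0 \<Longrightarrow> ennreal a epowr c = ennreal (a powr c)"
  by (simp add: epowr_def)

lemma top_epowr: "c \<noteq> 0 \<Longrightarrow> \<infinity> epowr c = \<infinity>"
  by (simp add: epowr_def)

lemma epowr_pos: "0 < x \<Longrightarrow> 0 < x epowr c"
  by (cases x) (auto simp: epowr_def)

lemma epowr_mono:
  assumes "x \<le> ennreal a" "0 \<le> a" "0 < c"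
  shows "x epowr c \<le> ennreal (a powr c)"
proof -
  obtain b where b: "x = ennreal b" "0 \<le> b"
    using assms(1) by (cases x) (auto simp: top_unique)
  then have "b \<le> a" using assms by (simp add: ennreal_le_iff)
  then show ?thesis using b assms by (simp add: epowr_ennreal' powr_mono2 ennreal_leI)
qed

lemma less_epowr_half_iff:
  assumes "0 < t"
  shows "ennreal t < y epowr (1 / 2) \<longleftrightarrow> ennreal (t\<^sup>2) < y"
proof (cases y)
  case (real r)
  have "t < r powr (1 / 2) \<longleftrightarrow> t\<^sup>2 < r"
    using assms real by (simp add: powr_half_sqrt) (metis abs_of_pos real_sqrt_abs real_sqrt_less_iff)
  then show ?thesis using real assms by (simp add: epowr_ennreal' ennreal_less_iff)
qed (simp add: epowr_def)

lemma sparse_op_finite: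
  assumes "finite \<S>"
  shows "sparse_op \<alpha> \<S> f x = (\<Sum>Q\<in>\<S>. (frac_avg \<alpha> Q f)\<^sup>2 * indicator Q x) epowr (1 / 2)"
  using assms by (simp add: sparse_op_def)

section \<open>Exhaustion by finite collections\<close>

lemma countable_finite_exhaustion:
  assumes "countable \<S>"
  obtains A :: "nat \<Rightarrow> 'a set" where "incseq A" "\<And>n. finite (A n)" "\<Union>(range A) = \<S>"
proof (cases "\<S> = {}")
  case True
  show ?thesis by (rule that[of "\<lambda>_. {}"]) (auto simp: True incseq_def)
next
  case False
  show ?thesis
  proof (rule that[of "\<lambda>n. from_nat_into \<S> ` {..n}"])
    show "incseq (\<lambda>n. from_nat_into \<S> ` {..n})" by (auto simp: incseq_def)
    have "\<Union>(range (\<lambda>n. from_nat_into \<S> ` {..n})) = range (from_nat_into \<S>)" by auto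
    then show "\<Union>(range (\<lambda>n. from_nat_into \<S> ` {..n})) = \<S>"
      using range_from_nat_into[OF False assms] by simp
  qed auto
qed

text \<open>The infinite sum is the supremum of its finite partial sums, and every finite subset of
  \<open>\<S>\<close> lies in some \<open>A n\<close>.\<close>

lemma sparse_op_level_set_exhaustion:
  fixes A :: "nat \<Rightarrow> (real ^ 'n) set set"
  assumes A: "incseq A" "\<And>n. finite (A n)" "\<Union>(range A) = \<S>" and t: "0 < t"
  shows "{x. ennreal t < sparse_op \<alpha> \<S> f x} = (\<Union>n. {x. ennreal t < sparse_op \<alpha> (A n) f x})"
    and "incseq (\<lambda>n. {x. ennreal t < sparse_op \<alpha> (A n) f x})"
proof -
  let ?g = "\<lambda>x Q. (frac_avg \<alpha> Q f)\<^sup>2 * indicator Q x"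
  have fin: "ennreal t < sparse_op \<alpha> F f x \<longleftrightarrow> ennreal (t\<^sup>2) < sum (?g x) F" if "finite F" for F x
    using that t by (simp add: sparse_op_finite less_epowr_half_iff)
  have inf: "ennreal t < sparse_op \<alpha> \<S> f x \<longleftrightarrow> (\<exists>F. finite F \<and> F \<subseteq> \<S> \<and> ennreal (t\<^sup>2) < sum (?g x) F)" for x
    unfolding sparse_op_def less_epowr_half_iff[OF t]
    by (subst nonneg_infsum_complete) (auto simp: less_SUP_iff)
  have sub: "\<exists>n. F \<subseteq> A n" if "finite F" "F \<subseteq> \<S>" for F
    using that
  proof induction
    case (insert Q F)
    then obtain n where "F \<subseteq> A n" by auto
    moreover obtain m where "Q \<in> A m" using insert.prems A(3) by auto
    ultimately have "insert Q F \<subseteq> A (max m n)"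
      using incseqD[OF A(1), of m "max m n"] incseqD[OF A(1), of n "max m n"] by auto
    then show ?case by auto
  qed auto
  show "{x. ennreal t < sparse_op \<alpha> \<S> f x} = (\<Union>n. {x. ennreal t < sparse_op \<alpha> (A n) f x})"
  proof (intro set_eqI iffI)
    fix x assume "x \<in> {x. ennreal t < sparse_op \<alpha> \<S> f x}"
    then have "\<exists>F. finite F \<and> F \<subseteq> \<S> \<and> ennreal (t\<^sup>2) < sum (?g x) F" unfolding inf[symmetric] by simp
    then obtain F where F: "finite F" "F \<subseteq> \<S>" "ennreal (t\<^sup>2) < sum (?g x) F" by (elim exE conjE)
    obtain n where "F \<subseteq> A n" using sub[OF F(1,2)] by auto
    then have "sum (?g x) F \<le> sum (?g x) (A n)" by (intro sum_mono2 A) auto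
    then have "ennreal t < sparse_op \<alpha> (A n) f x" using F(3) unfolding fin[OF A(2)] by simp
    then show "x \<in> (\<Union>n. {x. ennreal t < sparse_op \<alpha> (A n) f x})" by blast
  next
    fix x assume "x \<in> (\<Union>n. {x. ennreal t < sparse_op \<alpha> (A n) f x})"
    then obtain n where "ennreal t < sparse_op \<alpha> (A n) f x" by auto
    then have "ennreal (t\<^sup>2) < sum (?g x) (A n)" using fin[OF A(2)] by auto
    moreover have "A n \<subseteq> \<S>" unfolding A(3)[symmetric] by (rule UN_upper) simp
    ultimately have "ennreal t < sparse_op \<alpha> \<S> f x" unfolding inf using A(2)[of n] by (intro exI[of _ "A n"] conjI)
    then show "x \<in> {x. ennreal t < sparse_op \<alpha> \<S> f x}" by simp
  qed
  show "incseq (\<lambda>n. {x. ennreal t < sparse_op \<alpha> (A n) f x})"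
  proof (intro incseq_SucI subsetI CollectI)
    fix n x assume "x \<in> {x. ennreal t < sparse_op \<alpha> (A n) f x}"
    then have "ennreal (t\<^sup>2) < sum (?g x) (A n)" using fin[OF A(2)] by auto
    also have "\<dots> \<le> sum (?g x) (A (Suc n))"
      using A(1) by (intro sum_mono2 A) (auto dest: incseq_SucD)
    finally show "ennreal t < sparse_op \<alpha> (A (Suc n)) f x" using fin[OF A(2)] by simp
  qed
qed

context dyadic_lattice
begin

text \<open>Chebyshev's inequality: the pointwise lower bound is integrated over \<open>E\<close>.
  Keeping the intersections with \<open>E\<close> is what makes the dual estimate for
  \<open>q > 2\<close> applicable.\<close>

lemma measure_le_sum:
  assumes M: "sets M = sets lebesgue" "\<And>Q. Q \<in> D \<Longrightarrow> emeasure M Q < \<infinity>"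
    and \<S>: "finite \<S>" "\<S> \<subseteq> D" and E: "E \<in> sets lebesgue" "E \<subseteq> \<Union>\<S>"
    and c: "\<And>Q. Q \<in> \<S> \<Longrightarrow> 0 \<le> c Q" "\<And>x. x \<in> E \<Longrightarrow> 1 \<le> (\<Sum>Q\<in>\<S>. c Q * indicator Q x)"
  shows "emeasure M E < \<infinity>" "measure M E \<le> (\<Sum>Q\<in>\<S>. c Q * measure M (Q \<inter> E))"
proof -
  have SD: "Q \<in> D" "Q \<in> sets M" if "Q \<in> \<S>" for Q using that \<S>(2) sets_D M(1) by auto
  have EM: "E \<in> sets M" using E M by simp
  have "emeasure M E \<le> emeasure M (\<Union>Q\<in>\<S>. Q)" using E(2) SD(2) \<S>(1) by (intro emeasure_mono) auto
  also have "\<dots> \<le> (\<Sum>Q\<in>\<S>. emeasure M Q)" using SD(2) by (intro emeasure_subadditive_finite \<S>(1)) auto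
  also have "\<dots> < \<infinity>" using \<S>(1) M(2) SD by simp
  finally show fin: "emeasure M E < \<infinity>" .
  have eq: "emeasure M (Q \<inter> E) = ennreal (measure M (Q \<inter> E))" if "Q \<in> \<S>" for Q
  proof (rule emeasure_eq_ennreal_measure)
    have "emeasure M (Q \<inter> E) \<le> emeasure M E" by (intro emeasure_mono EM) auto
    then show "emeasure M (Q \<inter> E) \<noteq> top" using fin by (auto simp: top_unique)
  qed
  have "ennreal (measure M E) = emeasure M E"
    using fin by (intro emeasure_eq_ennreal_measure[symmetric]) auto
  also have "\<dots> = (\<integral>\<^sup>+x. indicator E x \<partial>M)" using EM by simp
  also have "\<dots> \<le> (\<integral>\<^sup>+x. (\<Sum>Q\<in>\<S>. ennreal (c Q) * indicator (Q \<inter> E) x) \<partial>M)"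
  proof (rule nn_integral_mono)
    fix x
    show "indicator E x \<le> (\<Sum>Q\<in>\<S>. ennreal (c Q) * indicator (Q \<inter> E) x :: ennreal)"
    proof (cases "x \<in> E")
      case True
      have "(1 :: ennreal) \<le> ennreal (\<Sum>Q\<in>\<S>. c Q * indicator Q x)"
        using c(2)[OF True] by (metis ennreal_1 ennreal_leI)
      also have "\<dots> = (\<Sum>Q\<in>\<S>. ennreal (c Q * indicator Q x))"
        using c(1) by (intro sum_ennreal[symmetric]) auto
      also have "\<dots> = (\<Sum>Q\<in>\<S>. ennreal (c Q) * indicator (Q \<inter> E) x)"
        using True by (intro sum.cong) (auto simp: indicator_def)
      finally show ?thesis using True by simp
    qed simp
  qed
  also have "\<dots> = (\<Sum>Q\<in>\<S>. ennreal (c Q) * emeasure M (Q \<inter> E))"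
    using SD(2) EM by (subst nn_integral_sum) (auto simp: nn_integral_cmult_indicator intro!: sum.cong)
  also have "\<dots> = (\<Sum>Q\<in>\<S>. ennreal (c Q * measure M (Q \<inter> E)))"
    using c(1) eq by (intro sum.cong) (auto simp: ennreal_mult)
  also have "\<dots> = ennreal (\<Sum>Q\<in>\<S>. c Q * measure M (Q \<inter> E))"
    using c(1) by (intro sum_ennreal) auto
  finally show "measure M E \<le> (\<Sum>Q\<in>\<S>. c Q * measure M (Q \<inter> E))"
    using c(1) by (subst (asm) ennreal_le_iff) (auto intro!: sum_nonneg)
qed

end

section \<open>Weighted measure of level sets\<close>

lemma level_set_sets:
  fixes c :: "(real ^ 'n) set \<Rightarrow> real"
  assumes "\<And>Q. Q \<in> \<S> \<Longrightarrow> Q \<in> sets lebesgue"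
  shows "{x. 1 < (\<Sum>Q\<in>\<S>. c Q * indicator Q x)} \<in> sets lebesgue"
proof -
  have "(\<lambda>x. \<Sum>Q\<in>\<S>. c Q * indicator Q x) \<in> borel_measurable lebesgue"
    using assms by (intro borel_measurable_sum borel_measurable_times borel_measurable_const borel_measurable_indicator)
  then have "{x \<in> space lebesgue. 1 < (\<Sum>Q\<in>\<S>. c Q * indicator Q x)} \<in> sets lebesgue"
    by (intro borel_measurable_less) auto
  then show ?thesis by simp
qed

lemma indicator_sum_pos_imp_mem:
  assumes "1 < (\<Sum>Q\<in>\<S>. c Q * indicator Q x :: real)"
  shows "x \<in> \<Union>\<S>"
proof (rule ccontr)
  assume "x \<notin> \<Union>\<S>"
  then have "(\<Sum>Q\<in>\<S>. c Q * indicator Q x) = 0" by (intro sum.neutral) auto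
  then show False using assms by simp
qed

context fractional_setting
begin

text \<open>\<open>F\<close> is already divided by the height and the square root is squared away,
  hence the threshold 1.\<close>

definition level_set_of :: "(real ^ 'n) set set \<Rightarrow> (real ^ 'n) set" where
  "level_set_of \<S> = {x. 1 < (\<Sum>Q\<in>\<S>. (favg Q)\<^sup>2 * indicator Q x)}"

context
  fixes M :: "(real ^ 'n) measure" and \<S> :: "(real ^ 'n) set set"
  assumes M: "sets M = sets lebesgue" "\<And>Q. Q \<in> D \<Longrightarrow> emeasure M Q < \<infinity>"
    and \<omega>_eq: "\<And>Q. Q \<in> D \<Longrightarrow> \<omega> Q = measure M Q"
    and \<S>: "finite \<S>" "\<S> \<subseteq> D"
begin

abbreviation level_set :: "(real ^ 'n) set" where
  "level_set \<equiv> level_set_of \<S>"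

lemma level_set: "level_set \<in> sets lebesgue" "level_set \<subseteq> \<Union>\<S>"
proof -
  show "level_set \<in> sets lebesgue"
    unfolding level_set_of_def using \<S>(2) by (intro level_set_sets sets_D) auto
  show "level_set \<subseteq> \<Union>\<S>"
    unfolding level_set_of_def by (intro subsetI indicator_sum_pos_imp_mem) simp
qed

lemma measure_inter_le: "Q \<in> D \<Longrightarrow> measure M (Q \<inter> level_set) \<le> \<omega> Q"
  unfolding \<omega>_eq using M(1) M(2)[of Q] sets_D[of Q] level_set(1)
  by (intro measure_mono_fmeasurable fmeasurableI) auto

lemma measure_level_set_low:
  assumes "q < 2"
  shows "measure M level_set
    \<le> low_const (real CARD('n)) p q \<beta> * (2 powr (2 - q) * geo (2 - q) + geo q) * K powr q * N powr (q / p)"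
proof -
  \<comment> \<open>Either one term alone reaches 1, or truncation changes no term at
    \<open>x\<close>.\<close>
  have one: "1 \<le> (\<Sum>Q\<in>\<S>. min 1 ((favg Q)\<^sup>2) * indicator Q x)" if "x \<in> level_set" for x
  proof (cases "\<exists>Q\<in>\<S>. x \<in> Q \<and> 1 \<le> (favg Q)\<^sup>2")
    case True
    then obtain R where R: "R \<in> \<S>" "x \<in> R" "1 \<le> (favg R)\<^sup>2" by auto
    have "min 1 ((favg R)\<^sup>2) * indicator R x \<le> (\<Sum>Q\<in>\<S>. min 1 ((favg Q)\<^sup>2) * indicator Q x)"
      using R by (intro member_le_sum \<S>(1)) auto
    then show ?thesis using R by simp
  next
    case False
    then have "(\<Sum>Q\<in>\<S>. min 1 ((favg Q)\<^sup>2) * indicator Q x) = (\<Sum>Q\<in>\<S>. (favg Q)\<^sup>2 * indicator Q x)"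
      by (intro sum.cong) (auto simp: indicator_def min_def)
    then show ?thesis using that by (simp add: level_set_of_def)
  qed
  have "measure M level_set \<le> (\<Sum>Q\<in>\<S>. min 1 ((favg Q)\<^sup>2) * measure M (Q \<inter> level_set))"
    by (rule measure_le_sum(2)[OF M \<S> level_set _ one]) auto
  also have "\<dots> \<le> (\<Sum>Q\<in>\<S>. min 1 ((favg Q)\<^sup>2) * \<omega> Q)"
    using \<S>(2) by (intro sum_mono mult_left_mono measure_inter_le) auto
  also have "\<dots> \<le> low_const (real CARD('n)) p q \<beta> * (2 powr (2 - q) * geo (2 - q) + geo q) * K powr q * N powr (q / p)"
    by (rule weak_type_low[OF assms \<S>])
  finally show ?thesis .
qed

lemma emeasure_level_set_finite: "emeasure M level_set < \<infinity>"
  by (rule measure_le_sum(1)[OF M \<S> level_set, of "\<lambda>Q. (favg Q)\<^sup>2"]) (simp_all add: level_set_of_def)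

lemma measure_level_set_le: "measure M level_set \<le> (\<Sum>Q\<in>\<S>. (favg Q)\<^sup>2 * measure M (Q \<inter> level_set))"
  by (rule measure_le_sum(2)[OF M \<S> level_set]) (simp_all add: level_set_of_def)

lemma measure_level_set_two:
  assumes "q = 2" "0 \<le> \<Lambda>"
    and carleson: "\<And>R \<B>. R \<in> D \<Longrightarrow> finite \<B> \<Longrightarrow> \<B> \<subseteq> \<S> \<Longrightarrow> (\<And>Q. Q \<in> \<B> \<Longrightarrow> Q \<subseteq> R) \<Longrightarrow> sum \<sigma> \<B> \<le> \<Lambda> * \<sigma> R"
  shows "measure M level_set \<le> 4 * \<Lambda> * K powr q * N powr (q / p)"
proof -
  note measure_level_set_le
  also have "(\<Sum>Q\<in>\<S>. (favg Q)\<^sup>2 * measure M (Q \<inter> level_set)) \<le> (\<Sum>Q\<in>\<S>. (favg Q)\<^sup>2 * \<omega> Q)"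
    using \<S>(2) by (intro sum_mono mult_left_mono measure_inter_le) auto
  also have "\<dots> \<le> 4 * \<Lambda> * K\<^sup>2 * N powr (2 / p)"
    by (rule weak_type_two[OF assms(1) \<S> assms(2) carleson])
  finally show ?thesis using assms(1) K_pos by simp
qed

text \<open>The dual estimate is tested on the level set itself. It bounds the measure
  \<open>W\<close> by a multiple of \<open>W powr (1 - 2 / q)\<close>, and for \<open>W > 0\<close>
  this can be solved for \<open>W\<close>.\<close>

lemma measure_level_set_high:
  assumes "2 < q" "maximal_bound \<S> \<Gamma>" "0 \<le> \<Gamma>"
  shows "measure M level_set
    \<le> (high_const (real CARD('n)) q \<beta> * \<Gamma>) powr (q / 2) * K powr q * N powr (q / p)"
proof (cases "measure M level_set = 0")
  case False
  define W where "W = measure M level_set"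
  define B where "B = high_const (real CARD('n)) q \<beta> * \<Gamma>"
  have W: "0 < W" using False by (simp add: W_def zero_less_measure_iff)
  have B: "0 \<le> B"
    unfolding B_def high_const_def using assms packing_const_nonneg[OF assms(1)]
    by (intro mult_nonneg_nonneg less_imp_le[OF geo_pos]) auto
  note fin = emeasure_level_set_finite
  have e_sum: "(\<Sum>Q\<in>\<B>. measure M (Q \<inter> level_set)) \<le> W" if "finite \<B>" "\<B> \<subseteq> D" "disjoint \<B>" for \<B>
  proof -
    have Qs: "Q \<in> sets M" if "Q \<in> \<B>" for Q using that \<open>\<B> \<subseteq> D\<close> sets_D M(1) by auto
    have "(\<Sum>Q\<in>\<B>. measure M (Q \<inter> level_set)) = measure M (\<Union>Q\<in>\<B>. Q \<inter> level_set)"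
    proof (rule measure_finite_Union[symmetric])
      show "disjoint_family_on (\<lambda>Q. Q \<inter> level_set) \<B>"
        using \<open>disjoint \<B>\<close> by (auto simp: disjoint_family_on_def disjoint_def)
      show "emeasure M (Q \<inter> level_set) \<noteq> \<infinity>" if "Q \<in> \<B>" for Q
      proof -
        have "emeasure M (Q \<inter> level_set) \<le> emeasure M level_set"
          using level_set(1) M(1) by (intro emeasure_mono) auto
        then show ?thesis using fin by (auto simp: top_unique)
      qed
    qed (use that Qs level_set(1) M(1) in auto)
    also have "\<dots> \<le> W"
      unfolding W_def using fin level_set(1) M(1) Qs that(1)
      by (intro measure_mono_fmeasurable fmeasurableI) auto
    finally show ?thesis .
  qed
  note measure_level_set_le
  also have "(\<Sum>Q\<in>\<S>. (favg Q)\<^sup>2 * measure M (Q \<inter> level_set))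
      \<le> high_const (real CARD('n)) q \<beta> * \<Gamma> * K\<^sup>2 * N powr (2 / p) * W powr (1 - 2 / q)"
    by (rule weak_type_high[OF assms(1) \<S> assms(2,3) less_imp_le[OF W] e_sum])
      (auto intro: measure_inter_le)
  finally have "W \<le> B * K\<^sup>2 * N powr (2 / p) * W powr (1 - 2 / q)" by (simp add: W_def B_def)
  moreover have "W = W powr (2 / q) * W powr (1 - 2 / q)" unfolding powr_add[symmetric] using W by simp
  ultimately have "W powr (2 / q) \<le> B * K\<^sup>2 * N powr (2 / p)"
    using W by (metis mult_le_cancel_right_pos powr_gt_zero less_irrefl)
  then have "(W powr (2 / q)) powr (q / 2) \<le> (B * K\<^sup>2 * N powr (2 / p)) powr (q / 2)"
    using assms(1) by (intro powr_mono2) auto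
  also have "(W powr (2 / q)) powr (q / 2) = W" using W assms(1) by (simp add: powr_powr)
  also have "(B * K\<^sup>2 * N powr (2 / p)) powr (q / 2) = B powr (q / 2) * (K powr 2) powr (q / 2) * (N powr (2 / p)) powr (q / 2)"
    using B K_pos by (simp add: powr_mult)
  also have "\<dots> = B powr (q / 2) * K powr q * N powr (q / p)" by (simp add: powr_powr)
  finally show ?thesis by (simp add: W_def B_def)
qed auto

end

end

section \<open>Rescaling by the height of the level set\<close>

lemma superadditive_divide:
  assumes "superadditive D v" "0 < t"
  shows "superadditive D (\<lambda>Q. v Q / t)"
  using assms by (auto simp: superadditive_def divide_right_mono simp flip: sum_divide_distrib)

lemma emeasure_weighted_divide:
  assumes "f \<in> borel_measurable lebesgue" "\<And>x. 0 \<le> f x" "0 < t" "A \<in> sets lebesgue"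
  shows "emeasure (weighted (\<lambda>x. f x / t)) A = ennreal (1 / t) * emeasure (weighted f) A"
proof -
  have "emeasure (weighted (\<lambda>x. f x / t)) A = (\<integral>\<^sup>+x\<in>A. ennreal (f x / t) \<partial>lebesgue)"
    using assms by (intro emeasure_weighted) auto
  also have "\<dots> = (\<integral>\<^sup>+x. ennreal (1 / t) * (ennreal (f x) * indicator A x) \<partial>lebesgue)"
    using assms(3) by (intro nn_integral_cong) (auto simp: ennreal_mult'[symmetric] mult.assoc[symmetric])
  also have "\<dots> = ennreal (1 / t) * emeasure (weighted f) A"
    using assms by (subst nn_integral_cmult) (auto simp: emeasure_weighted)
  finally show ?thesis .
qed

lemma measure_weighted_divide:
  assumes "f \<in> borel_measurable lebesgue" "\<And>x. 0 \<le> f x" "0 < t" "A \<in> sets lebesgue"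
  shows "measure (weighted (\<lambda>x. f x / t)) A = measure (weighted f) A / t"
  using assms(3) by (simp add: measure_def emeasure_weighted_divide[OF assms] enn2real_mult)

context dyadic_lattice
begin

lemma emeasure_weighted_pos:
  assumes "u \<in> borel_measurable lebesgue" "\<And>x. 0 < u x" "Q \<in> D"
  shows "0 < emeasure (weighted u) Q"
proof (rule ccontr)
  assume "\<not> 0 < emeasure (weighted u) Q"
  then have "(\<integral>\<^sup>+x. ennreal (u x) * indicator Q x \<partial>lebesgue) = 0"
    using emeasure_weighted[OF assms(1) sets_D[OF assms(3)]] by simp
  then have "emeasure lebesgue {x \<in> space lebesgue. ennreal (u x) * indicator Q x \<noteq> 0} = 0"
    using assms(1) sets_D[OF assms(3)] by (subst (asm) nn_integral_0_iff) auto
  moreover have "{x \<in> space lebesgue. ennreal (u x) * indicator Q x \<noteq> 0} = Q"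
  proof -
    have "ennreal (u x) \<noteq> 0" for x using assms(2)[of x] by simp
    then show ?thesis by (auto simp: indicator_def)
  qed
  ultimately show False using measure_D_pos[OF assms(3)] by (simp add: emeasure_D_eq[OF assms(3)])
qed

lemma avg_pos:
  assumes "u \<in> borel_measurable lebesgue" "\<And>x. 0 < u x" "Q \<in> D"
  shows "0 < avg Q u"
proof (rule ccontr)
  assume "\<not> 0 < avg Q u"
  then have "avg Q u * emeasure lebesgue Q = 0" by simp
  then show False using emeasure_weighted_pos[OF assms] avg_mult_emeasure[OF assms(1,3)] by simp
qed

lemma avg_less_top_imp:
  assumes "u \<in> borel_measurable lebesgue" "Q \<in> D" "avg Q u < \<infinity>"
  shows "emeasure (weighted u) Q < \<infinity>" "avg Q u = ennreal (measure (weighted u) Q / measure lebesgue Q)"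
proof -
  have V: "0 < measure lebesgue Q" by (rule measure_D_pos[OF assms(2)])
  obtain a where a: "avg Q u = ennreal a" "0 \<le> a" using assms(3) by (cases "avg Q u") auto
  have "emeasure (weighted u) Q = ennreal (a * measure lebesgue Q)"
    using avg_mult_emeasure[OF assms(1,2)] V unfolding a emeasure_D_eq[OF assms(2)]
    by (simp add: ennreal_mult a(2))
  then show "emeasure (weighted u) Q < \<infinity>" "avg Q u = ennreal (measure (weighted u) Q / measure lebesgue Q)"
    using a V by (auto simp: measure_def)
qed

end

section \<open>Consequences of the A_(p,q) condition\<close>

lemma weight_powr:
  assumes "weight w"
  shows "(\<lambda>x. w x powr a) \<in> borel_measurable lebesgue" "0 < w x powr a"
proof -
  have "w \<in> borel_measurable lebesgue" "0 < w x" using assms by (auto simp: weight_def)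
  then show "(\<lambda>x. w x powr a) \<in> borel_measurable lebesgue" "0 < w x powr a"
    by (auto intro!: powr_real_measurable borel_measurable_const)
qed

locale apq_weight = dyadic_lattice D
  for D :: "(real ^ 'n) set set" +
  fixes w :: "real ^ 'n \<Rightarrow> real" and p q :: real
  assumes w: "weight w" and pq: "1 < p" "0 < q"
begin

abbreviation s :: "real ^ 'n \<Rightarrow> real" where "s \<equiv> \<lambda>x. w x powr (- conj_exp p)"
abbreviation u :: "real ^ 'n \<Rightarrow> real" where "u \<equiv> \<lambda>x. w x powr q"

lemma w_pos: "0 < w x" using w by (simp add: weight_def)

lemma weights:
  "s \<in> borel_measurable lebesgue" "\<And>x. 0 < s x" "u \<in> borel_measurable lebesgue" "\<And>x. 0 < u x"
  using weight_powr[OF w] by auto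

lemma conj_exp_pos: "0 < conj_exp p"
  using pq by (simp add: conj_exp_def)

text \<open>Excludes the product of 0 and \<open>\<infinity>\<close>, which \<open>ennreal\<close>
  evaluates to 0, from the final bound.\<close>

lemma Apq_pos: "0 < Apq_const D p q w"
proof -
  obtain Q where Q: "Q \<in> D" using D_nonempty by auto
  have "0 < avg Q u * avg Q s epowr (q / conj_exp p)"
    using avg_pos[OF weights(3,4) Q] epowr_pos[OF avg_pos[OF weights(1,2) Q]]
    by (simp add: ennreal_zero_less_mult_iff)
  also have "\<dots> \<le> Apq_const D p q w" unfolding Apq_const_def by (rule SUP_upper[OF Q])
  finally show ?thesis .
qed

context
  fixes \<kappa> :: real
  assumes Apq: "Apq_const D p q w = ennreal \<kappa>" "0 \<le> \<kappa>"
begin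

text \<open>\<open>weight\<close> gives local integrability of \<open>w\<close> to the first power
  only. For the two powers here it comes from the A_(p,q) condition: a product of positive factors
  is finite only if each factor is.\<close>

lemma avg_finite:
  assumes Q: "Q \<in> D"
  shows "avg Q u < \<infinity>" "avg Q s < \<infinity>"
proof -
  have "avg Q u * avg Q s epowr (q / conj_exp p) \<le> Apq_const D p q w"
    unfolding Apq_const_def by (rule SUP_upper[OF Q])
  then have "avg Q u * avg Q s epowr (q / conj_exp p) < top" unfolding Apq by (rule le_less_trans) simp
  then have fin: "avg Q u < top" "avg Q s epowr (q / conj_exp p) < top"
    using avg_pos[OF weights(3,4) Q] epowr_pos[OF avg_pos[OF weights(1,2) Q], of "q / conj_exp p"]
    by (auto simp: ennreal_mult_less_top)
  then show "avg Q u < \<infinity>" by simp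
  show "avg Q s < \<infinity>"
  proof (rule ccontr)
    assume "\<not> avg Q s < \<infinity>"
    then have "avg Q s = \<infinity>" by (simp add: not_less top_unique)
    then show False using fin(2) pq conj_exp_pos by (simp add: top_epowr[unfolded infinity_ennreal_def])
  qed
qed

lemma mass_finite:
  assumes "Q \<in> D"
  shows "emeasure (weighted u) Q < \<infinity>" "emeasure (weighted s) Q < \<infinity>"
  using avg_less_top_imp(1)[OF weights(3) assms avg_finite(1)[OF assms]]
    avg_less_top_imp(1)[OF weights(1) assms avg_finite(2)[OF assms]] by auto

lemma mass_pos:
  assumes "Q \<in> D"
  shows "0 < measure (weighted u) Q" "0 < measure (weighted s) Q"
  using emeasure_weighted_pos[OF weights(3,4) assms] emeasure_weighted_pos[OF weights(1,2) assms] mass_finite[OF assms]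
  by (auto simp: measure_def enn2real_positive_iff)

lemma two_weight_bound:
  assumes Q: "Q \<in> D" and \<beta>: "\<beta> = 1 - 1 / p + 1 / q"
  shows "measure lebesgue Q powr (- \<beta>) * measure (weighted s) Q powr (1 - 1 / p) * measure (weighted u) Q powr (1 / q)
    \<le> \<kappa> powr (1 / q)"
proof -
  define V A B where "V = measure lebesgue Q" and "A = measure (weighted u) Q" and "B = measure (weighted s) Q"
  have pos: "0 < V" "0 < A" "0 < B"
    using measure_D_pos[OF Q] mass_pos[OF Q] by (auto simp: V_def A_def B_def)
  have "avg Q u * avg Q s epowr (q / conj_exp p) \<le> Apq_const D p q w"
    unfolding Apq_const_def by (rule SUP_upper[OF Q])
  then have "ennreal (A / V) * ennreal (B / V) epowr (q / conj_exp p) \<le> ennreal \<kappa>"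
    unfolding Apq avg_less_top_imp(2)[OF weights(3) Q avg_finite(1)[OF Q]]
      avg_less_top_imp(2)[OF weights(1) Q avg_finite(2)[OF Q]] A_def B_def V_def .
  then have "A / V * (B / V) powr (q / conj_exp p) \<le> \<kappa>"
    using pos Apq(2) by (simp add: epowr_ennreal ennreal_mult[symmetric] ennreal_le_iff)
  then have "(A / V * (B / V) powr (q / conj_exp p)) powr (1 / q) \<le> \<kappa> powr (1 / q)"
    using pos pq by (intro powr_mono2) auto
  also have "(A / V * (B / V) powr (q / conj_exp p)) powr (1 / q) = V powr (- \<beta>) * B powr (1 - 1 / p) * A powr (1 / q)"
    by (rule ln_inj_iff[THEN iffD1])
      (use pos pq in \<open>simp_all add: \<beta> conj_exp_def ln_mult ln_powr ln_div field_simps\<close>)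
  finally show ?thesis by (simp add: V_def A_def B_def)
qed

text \<open>Young's inequality for the factorization of \<open>f x\<close> into
  \<open>f x * w x\<close> and \<open>1 / w x\<close>.\<close>

lemma integrable_on_cubes:
  assumes f: "f \<in> borel_measurable lebesgue" "\<And>x. 0 \<le> f x"
    and fin: "(\<integral>\<^sup>+x. ennreal (f x powr p * w x powr p) \<partial>lebesgue) < \<infinity>" and Q: "Q \<in> D"
  shows "emeasure (weighted f) Q < \<infinity>"
proof -
  have young: "f x \<le> f x powr p * w x powr p + s x" for x
  proof -
    have e: "1 < conj_exp p" "1 / p + 1 / conj_exp p = 1" using pq by (auto simp: conj_exp_def field_simps)
    have "(f x * w x) * (1 / w x) \<le> (f x * w x) powr p / p + (1 / w x) powr conj_exp p / conj_exp p"
      using pq e f(2)[of x] w_pos[of x] by (intro Youngs_inequality) auto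
    also have "\<dots> \<le> (f x * w x) powr p + (1 / w x) powr conj_exp p"
      using pq e by (intro add_mono) (auto simp: divide_le_eq mult_le_cancel_left1)
    also have "(1 / w x) powr conj_exp p = s x" using w_pos[of x] by (simp add: powr_divide powr_minus_divide)
    finally show ?thesis using w_pos[of x] f(2)[of x] by (simp add: powr_mult)
  qed
  have "emeasure (weighted f) Q \<le> (\<integral>\<^sup>+x. ennreal (f x powr p * w x powr p) + ennreal (s x) * indicator Q x \<partial>lebesgue)"
    unfolding emeasure_weighted[OF f(1) sets_D[OF Q]]
    using young by (intro nn_integral_mono) (auto simp: indicator_def simp flip: ennreal_plus intro!: ennreal_leI)
  also have "\<dots> = (\<integral>\<^sup>+x. ennreal (f x powr p * w x powr p) \<partial>lebesgue) + emeasure (weighted s) Q"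
    unfolding emeasure_weighted[OF weights(1) sets_D[OF Q]]
    using f(1) weights(1) weight_powr(1)[OF w, of p] sets_D[OF Q]
    by (intro nn_integral_add measurable_compose[OF _ measurable_ennreal] borel_measurable_times) auto
  also have "\<dots> < \<infinity>" using fin mass_finite(2)[OF Q] by simp
  finally show ?thesis .
qed

end

end

text \<open>Bounds the measure of a level set, so its q-th root enters the norm. The common factor
  is the loss in \<open>level_sum_measure\<close> to the power \<open>q / p\<close>; the powers of
  \<open>1 / \<gamma>\<close> come from Carleson sums.\<close>

definition weak_const :: "real \<Rightarrow> real \<Rightarrow> real \<Rightarrow> real \<Rightarrow> real \<Rightarrow> real" where
  "weak_const d p q \<beta> \<gamma> = (2 powr p * geo (p - 1)) powr (q / p) *
     (if q < 2 then low_const d p q \<beta> * (2 powr (2 - q) * geo (2 - q) + geo q)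
      else if q = 2 then 4 / \<gamma>
      else if p \<le> 2 then high_const d q \<beta> powr (q / 2)
      else (high_const d q \<beta> * (1 / \<gamma>) powr (1 - 2 / p)) powr (q / 2))"

lemma epowr_eq_ennrealD:
  assumes "x epowr c = ennreal a" "c \<noteq> 0" "0 \<le> a"
  shows "x = ennreal (a powr (1 / c))"
proof (cases x)
  case (real r)
  then have "ennreal (r powr c) = ennreal a" using assms by (simp add: epowr_ennreal')
  then have "r powr c = a" using assms by simp
  then have "a powr (1 / c) = r" using real assms(2) by (auto simp: powr_powr)
  then show ?thesis using real by simp
next
  case top
  then show ?thesis using assms by (simp add: epowr_def)
qed

lemma frac_avg_eq:
  assumes f: "f \<in> borel_measurable lebesgue" and Q: "Q \<in> sets lebesgue" "0 < measure lebesgue Q"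
    and fin: "emeasure (weighted f) Q < \<infinity>"
  shows "frac_avg \<alpha> Q f = ennreal (measure lebesgue Q powr (- (1 - \<alpha> / real CARD('n))) * measure (weighted f) (Q :: (real ^ 'n) set))"
proof -
  have "(\<integral>\<^sup>+x\<in>Q. ennreal (f x) \<partial>lebesgue) = ennreal (measure (weighted f) Q)"
    unfolding emeasure_weighted[OF f Q(1), symmetric] using fin by (intro emeasure_eq_ennreal_measure) auto
  then show ?thesis
    unfolding frac_avg_def powr_minus using Q(2) by (simp add: divide_ennreal divide_inverse mult.commute)
qed

lemma less_sparse_op_iff:
  fixes c :: "(real ^ 'n) set \<Rightarrow> real"
  assumes "finite \<S>" "0 < t" and c: "\<And>Q. Q \<in> \<S> \<Longrightarrow> frac_avg \<alpha> Q f = ennreal (t * c Q)" "\<And>Q. Q \<in> \<S> \<Longrightarrow> 0 \<le> c Q"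
  shows "ennreal t < sparse_op \<alpha> \<S> f x \<longleftrightarrow> 1 < (\<Sum>Q\<in>\<S>. (c Q)\<^sup>2 * indicator Q x)"
proof -
  have "(\<Sum>Q\<in>\<S>. (frac_avg \<alpha> Q f)\<^sup>2 * indicator Q x) = (\<Sum>Q\<in>\<S>. ennreal ((t * c Q)\<^sup>2 * indicator Q x))"
    using c assms(2) by (intro sum.cong) (auto simp: ennreal_power indicator_def)
  also have "\<dots> = ennreal (\<Sum>Q\<in>\<S>. (t * c Q)\<^sup>2 * indicator Q x)" by (intro sum_ennreal) auto
  also have "(\<Sum>Q\<in>\<S>. (t * c Q)\<^sup>2 * indicator Q x) = t\<^sup>2 * (\<Sum>Q\<in>\<S>. (c Q)\<^sup>2 * indicator Q x)"
    by (simp add: sum_distrib_left power_mult_distrib mult.assoc)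
  finally show ?thesis
    using assms(1,2) by (simp add: sparse_op_finite less_epowr_half_iff ennreal_less_iff)
qed

context apq_weight
begin

text \<open>The Carleson constants come from the full collection \<open>\<T>\<close>, so the bound
  is uniform in the finite part \<open>\<S>\<close>. Measurability is recorded for the passage to
  the limit.\<close>

lemma weak_bound_finite:
  fixes f :: "real ^ 'n \<Rightarrow> real"
  assumes exps: "p < q" "1 - \<alpha> / real CARD('n) = 1 - 1 / p + 1 / q" "1 - \<alpha> / real CARD('n) < 1"
    and Apq: "Apq_const D p q w = ennreal \<kappa>" "0 < \<kappa>"
    and A: "(if 2 \<le> q \<and> p \<le> 2 then Ainfty_const D s epowr (1 / q)
             else Ainfty_const D u epowr (max (1 / 2 - 1 / p) 0)) = ennreal A" "0 \<le> A"
    and sparse: "\<T> \<subseteq> D" "sparse_collection \<gamma> \<T>" "0 < \<gamma>"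
    and \<S>: "finite \<S>" "\<S> \<subseteq> \<T>"
    and f: "f \<in> borel_measurable lebesgue" "\<And>x. 0 \<le> f x"
    and Np: "(\<integral>\<^sup>+x. ennreal (f x powr p * w x powr p) \<partial>lebesgue) = ennreal Np" "0 \<le> Np" and t: "0 < t"
  shows "{x. ennreal t < sparse_op \<alpha> \<S> f x} \<in> sets lebesgue"
    and "emeasure (weighted u) {x. ennreal t < sparse_op \<alpha> \<S> f x}
      \<le> ennreal (weak_const (real CARD('n)) p q (1 - \<alpha> / real CARD('n)) \<gamma> * \<kappa> * A powr q * (Np / t powr p) powr (q / p))"
proof -
  define \<beta> where "\<beta> = 1 - \<alpha> / real CARD('n)"
  define N where "N = 2 powr p * geo (p - 1) * (Np / t powr p)"
  define F where "F = (\<lambda>Q. measure (weighted f) Q / t)"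
  have \<kappa>0: "0 \<le> \<kappa>" using Apq(2) by simp
  note mf = mass_finite[OF Apq(1) \<kappa>0] and mp = mass_pos[OF Apq(1) \<kappa>0]
  have ff: "emeasure (weighted f) Q < \<infinity>" if "Q \<in> D" for Q
    by (rule integrable_on_cubes[OF Apq(1) \<kappa>0 f _ that]) (simp add: Np)
  have F_eq: "F Q = measure (weighted (\<lambda>x. f x / t)) Q" if "Q \<in> D" for Q
    unfolding F_def using measure_weighted_divide[OF f t sets_D[OF that]] by simp
  have g0: "0 < geo (p - 1)" using pq by (intro geo_pos) auto
  have N: "0 \<le> N" unfolding N_def using Np(2) g0 t by simp
  have level: "(\<Sum>m\<in>I. \<Sum>Q\<in>\<P> m. 2 powr (p * of_int m) * measure (weighted s) Q) \<le> N"
    if I: "finite I" "\<And>m. m \<in> I \<Longrightarrow> finite (\<P> m) \<and> \<P> m \<subseteq> D \<and> disjoint (\<P> m)"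
      and large: "\<And>m Q. m \<in> I \<Longrightarrow> Q \<in> \<P> m \<Longrightarrow> 2 powr of_int m * measure (weighted s) Q \<le> F Q" for I \<P>
  proof -
    have "ennreal (\<Sum>m\<in>I. \<Sum>Q\<in>\<P> m. 2 powr (p * of_int m) * measure (weighted s) Q)
      \<le> ennreal (2 powr p * geo (p - 1)) * (\<integral>\<^sup>+x. ennreal ((f x / t) powr p * s x powr (1 - p)) \<partial>lebesgue)"
    proof (rule level_sum_measure[OF _ weights(1) _ weights(2) pq(1) _ mf(2) I])
      show "(\<lambda>x. f x / t) \<in> borel_measurable lebesgue" using f(1) by auto
      show "0 \<le> f x / t" for x using f(2) t by simp
      show "emeasure (weighted (\<lambda>x. f x / t)) Q < \<infinity>" if "Q \<in> D" for Q
        using ff[OF that] by (simp add: emeasure_weighted_divide[OF f t sets_D[OF that]] ennreal_mult_less_top)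
      show "2 powr of_int m * measure (weighted s) Q \<le> measure (weighted (\<lambda>x. f x / t)) Q" if "m \<in> I" "Q \<in> \<P> m" for m Q
        using large[OF that] F_eq[of Q] I(2)[OF that(1)] that(2) by auto
    qed
    also have "(\<integral>\<^sup>+x. ennreal ((f x / t) powr p * s x powr (1 - p)) \<partial>lebesgue)
        = (\<integral>\<^sup>+x. ennreal (1 / t powr p) * ennreal (f x powr p * w x powr p) \<partial>lebesgue)"
    proof (rule nn_integral_cong)
      fix x
      \<comment> \<open>Hence \<open>s x powr (1 - p)\<close> is \<open>w x powr p\<close>, and the
        integral of \<open>level_sum_measure\<close> is the p-th power of the weighted norm.\<close>
      have "conj_exp p * (p - 1) = p" using pq by (simp add: conj_exp_def)
      then have "- conj_exp p * (1 - p) = p" by (simp add: algebra_simps)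
      then have "s x powr (1 - p) = w x powr p" by (simp only: powr_powr)
      then show "ennreal ((f x / t) powr p * s x powr (1 - p)) = ennreal (1 / t powr p) * ennreal (f x powr p * w x powr p)"
        using f(2)[of x] t by (simp add: powr_divide ennreal_mult[symmetric])
    qed
    also have "\<dots> = ennreal (1 / t powr p) * ennreal Np"
      unfolding Np(1)[symmetric] using f(1) weight_powr(1)[OF w, of p] by (intro nn_integral_cmult) auto
    also have "ennreal (2 powr p * geo (p - 1)) * \<dots> = ennreal N"
      using Np(2) g0 t by (simp add: N_def ennreal_mult[symmetric])
    finally show ?thesis using N by (simp add: ennreal_le_iff)
  qed
  interpret fs: fractional_setting D "measure (weighted s)" "measure (weighted u)" F p q \<beta> "\<kappa> powr (1 / q)" N
  proof
    show "superadditive D (measure (weighted s))" "superadditive D (measure (weighted u))"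
      using mf by (auto intro!: superadditive_measure)
    show "superadditive D F"
      unfolding F_def using ff t by (intro superadditive_divide superadditive_measure) auto
    show "0 < measure (weighted s) Q" "0 < measure (weighted u) Q" if "Q \<in> D" for Q using mp[OF that] by auto
    show "1 < p" "p < q" "\<beta> = 1 - 1 / p + 1 / q" "\<beta> < 1" using pq exps by (auto simp: \<beta>_def)
    show "0 < \<kappa> powr (1 / q)" using Apq(2) by simp
    show "0 \<le> N" by (rule N)
    show "measure lebesgue Q powr (- \<beta>) * measure (weighted s) Q powr (1 - 1 / p) * measure (weighted u) Q powr (1 / q)
        \<le> \<kappa> powr (1 / q)" if "Q \<in> D" for Q
      by (rule two_weight_bound[OF Apq(1) \<kappa>0 that]) (simp add: \<beta>_def exps)
  qed (rule level)
  have \<S>D: "\<S> \<subseteq> D" using \<S>(2) sparse(1) by auto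
  have M: "sets (weighted u) = sets lebesgue" by simp
  note finite_case = M mf(1) refl \<S>(1) \<S>D
  have favg: "frac_avg \<alpha> Q f = ennreal (t * fs.favg Q)" "0 \<le> fs.favg Q" if "Q \<in> \<S>" for Q
  proof -
    have Q: "Q \<in> D" using that \<S>D by auto
    have "frac_avg \<alpha> Q f = ennreal (measure lebesgue Q powr (- \<beta>) * measure (weighted f) Q)"
      unfolding \<beta>_def by (rule frac_avg_eq[OF f(1) sets_D[OF Q] measure_D_pos[OF Q] ff[OF Q]])
    then show "frac_avg \<alpha> Q f = ennreal (t * fs.favg Q)" unfolding fs.favg_def using t by (simp add: F_def)
    show "0 \<le> fs.favg Q" using fs.F_nonneg[OF Q] by (simp add: fs.favg_def)
  qed
  have set_eq: "{x. ennreal t < sparse_op \<alpha> \<S> f x} = fs.level_set_of \<S>"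
    unfolding fs.level_set_of_def using less_sparse_op_iff[OF \<S>(1) t favg] by simp
  show "{x. ennreal t < sparse_op \<alpha> \<S> f x} \<in> sets lebesgue"
    unfolding set_eq by (rule fs.level_set(1)[OF finite_case])
  define R where "R = (2 powr p * geo (p - 1)) powr (q / p) * \<kappa> * (Np / t powr p) powr (q / p)"
  have K: "(\<kappa> powr (1 / q)) powr q = \<kappa>" using Apq(2) pq by (simp add: powr_powr)
  have R: "R = \<kappa> * N powr (q / p)" unfolding R_def N_def powr_mult by (simp only: mult_ac)
  have R0: "0 \<le> R" unfolding R using Apq(2) by simp
  have pos_s: "0 \<le> s x" and pos_u: "0 \<le> u x" for x by simp_all
  have goal: "measure (weighted u) (fs.level_set_of \<S>)
      \<le> weak_const (real CARD('n)) p q \<beta> \<gamma> * \<kappa> * A powr q * (Np / t powr p) powr (q / p)"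
  proof -
    consider "q < 2" | "q = 2" "p \<le> 2" | "2 < q" "p \<le> 2" | "2 < q" "2 < p" using exps(1) by linarith
    then show ?thesis
    proof cases
      case 1
      \<comment> \<open>For \<open>p < q < 2\<close> the exponent of the A_infinity constant is 0,
        and a zeroth power is 1 even if the constant is infinite.\<close>
      have "1 / p > 1 / 2" using 1 exps(1) pq by (simp add: field_simps)
      then have "max (1 / 2 - 1 / p) 0 = 0" by simp
      then have A1: "A = 1" using A 1 by (simp add: epowr_def)
      have "measure (weighted u) (fs.level_set_of \<S>)
          \<le> low_const (real CARD('n)) p q \<beta> * (2 powr (2 - q) * geo (2 - q) + geo q) * R"
        using fs.measure_level_set_low[OF finite_case 1] unfolding K R by (simp only: mult.assoc)
      then show ?thesis using 1 unfolding A1 by (simp add: weak_const_def R_def mult_ac)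
    next
      case 2
      then have "Ainfty_const D s epowr (1 / q) = ennreal A" using A by simp
      from epowr_eq_ennrealD[OF this _ A(2)] pq have L: "Ainfty_const D s = ennreal (A powr q)" by simp
      have "measure (weighted u) (fs.level_set_of \<S>) \<le> 4 * (A powr q / \<gamma>) * (\<kappa> powr (1 / q)) powr q * N powr (q / p)"
      proof (rule fs.measure_level_set_two[OF finite_case 2(1)])
        show "0 \<le> A powr q / \<gamma>" using sparse(3) by simp
        fix R \<B> assume "R \<in> D" "finite \<B>" "\<B> \<subseteq> \<S>" "\<And>Q. Q \<in> \<B> \<Longrightarrow> Q \<subseteq> R"
        then show "sum (measure (weighted s)) \<B> \<le> A powr q / \<gamma> * measure (weighted s) R"
          using \<S>(2) mf(2) emeasure_weighted_pos[OF weights(1,2)]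
          by (intro carleson_sparse[OF weights(1) pos_s _ L _ sparse]) auto
      qed
      also have "\<dots> = (4 / \<gamma>) * A powr q * R" unfolding K R by simp
      finally show ?thesis using 2 by (simp add: weak_const_def R_def mult_ac)
    next
      case 3
      then have "Ainfty_const D s epowr (1 / q) = ennreal A" using A by simp
      from epowr_eq_ennrealD[OF this _ A(2)] pq have L: "Ainfty_const D s = ennreal (A powr q)" by simp
      \<comment> \<open>For \<open>p \<le> 2 < q\<close> the estimate carries no A_infinity
        constant; being at least 1, it may be inserted.\<close>
      have "1 \<le> Ainfty_const D s"
        by (rule Ainfty_ge_one[OF weights(1) pos_s emeasure_weighted_pos[OF weights(1,2)]])
      then have A1: "1 \<le> A powr q" unfolding L by simp
      have "measure (weighted u) (fs.level_set_of \<S>)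
          \<le> (high_const (real CARD('n)) q \<beta> * 1) powr (q / 2) * (\<kappa> powr (1 / q)) powr q * N powr (q / p)"
        by (rule fs.measure_level_set_high[OF finite_case 3(1) fs.maximal_bound_small_p[OF 3 \<S>(1) \<S>D] zero_le_one])
      also have "\<dots> = high_const (real CARD('n)) q \<beta> powr (q / 2) * R * 1" unfolding K R by simp
      also have "\<dots> \<le> high_const (real CARD('n)) q \<beta> powr (q / 2) * R * A powr q"
        using A1 R0 by (intro mult_left_mono) auto
      finally show ?thesis using 3 by (simp add: weak_const_def R_def mult_ac)
    next
      case 4
      define e where "e = 1 / 2 - 1 / p"
      have e: "0 < e" unfolding e_def using 4 by (simp add: field_simps)
      then have "Ainfty_const D u epowr e = ennreal A" using A 4 by (simp add: e_def[symmetric])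
      from epowr_eq_ennrealD[OF this _ A(2)] e have L: "Ainfty_const D u = ennreal (A powr (1 / e))" by simp
      let ?L = "A powr (1 / e) / \<gamma>"
      \<comment> \<open>At this exponent the Carleson constant contributes \<open>A powr 2\<close>,
        and the outer power \<open>q / 2\<close> turns it into \<open>A powr q\<close>.\<close>
      have e2: "1 - 2 / p = 2 * e" by (simp add: e_def)
      have carleson: "sum (measure (weighted u)) \<B> \<le> ?L * measure (weighted u) R"
        if "R \<in> D" "finite \<B>" "\<B> \<subseteq> \<S>" "\<And>Q. Q \<in> \<B> \<Longrightarrow> Q \<subseteq> R" for R \<B>
        using that \<S>(2) mf(1) emeasure_weighted_pos[OF weights(3,4)]
        by (intro carleson_sparse[OF weights(3) pos_u _ L _ sparse]) auto
      have L0: "0 \<le> ?L" using sparse(3) by simp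
      have "measure (weighted u) (fs.level_set_of \<S>)
          \<le> (high_const (real CARD('n)) q \<beta> * ?L powr (1 - 2 / p)) powr (q / 2) * (\<kappa> powr (1 / q)) powr q * N powr (q / p)"
        by (rule fs.measure_level_set_high[OF finite_case 4(1) fs.maximal_bound_large_p[OF 4(2) \<S>(1) \<S>D L0 carleson]]) auto
      also have "?L powr (1 - 2 / p) = (1 / \<gamma>) powr (1 - 2 / p) * A powr 2"
      proof -
        have "?L powr (1 - 2 / p) = (A powr (1 / e)) powr (2 * e) * (1 / \<gamma>) powr (1 - 2 / p)"
          unfolding e2 using sparse(3) by (simp add: powr_mult[symmetric])
        then show ?thesis using e A(2) by (simp add: powr_powr mult.commute)
      qed
      also have "(high_const (real CARD('n)) q \<beta> * ((1 / \<gamma>) powr (1 - 2 / p) * A powr 2)) powr (q / 2)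
          = (high_const (real CARD('n)) q \<beta> * (1 / \<gamma>) powr (1 - 2 / p)) powr (q / 2) * A powr q"
      proof -
        have "(A powr 2) powr (q / 2) = A powr q" by (simp add: powr_powr)
        moreover have "0 \<le> high_const (real CARD('n)) q \<beta>"
          unfolding high_const_def using 4(1) fs.packing_const_nonneg[OF 4(1)]
          by (intro mult_nonneg_nonneg less_imp_le[OF geo_pos]) auto
        ultimately show ?thesis by (simp only: powr_mult mult.assoc[symmetric])
      qed
      finally have "measure (weighted u) (fs.level_set_of \<S>)
          \<le> (high_const (real CARD('n)) q \<beta> * (1 / \<gamma>) powr (1 - 2 / p)) powr (q / 2) * A powr q * R"
        unfolding K R by (simp only: mult.assoc)
      then show ?thesis using 4 by (simp add: weak_const_def R_def mult_ac)
    qed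
  qed
  have "emeasure (weighted u) (fs.level_set_of \<S>) = ennreal (measure (weighted u) (fs.level_set_of \<S>))"
    using fs.emeasure_level_set_finite[OF finite_case] by (intro emeasure_eq_ennreal_measure) auto
  also have "\<dots> \<le> ennreal (weak_const (real CARD('n)) p q \<beta> \<gamma> * \<kappa> * A powr q * (Np / t powr p) powr (q / p))"
    by (rule ennreal_leI[OF goal])
  finally show "emeasure (weighted u) {x. ennreal t < sparse_op \<alpha> \<S> f x}
      \<le> ennreal (weak_const (real CARD('n)) p q (1 - \<alpha> / real CARD('n)) \<gamma> * \<kappa> * A powr q * (Np / t powr p) powr (q / p))"
    unfolding set_eq \<beta>_def .
qed

end

subsection \<open>The weak-type bound\<close>

context apq_weight
begin

text \<open>Continuity of the weighted measure from below along an exhaustion, with a bound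
  independent of the finite part.\<close>

lemma weak_bound:
  fixes f :: "real ^ 'n \<Rightarrow> real"
  assumes exps: "p < q" "1 - \<alpha> / real CARD('n) = 1 - 1 / p + 1 / q" "1 - \<alpha> / real CARD('n) < 1"
    and Apq: "Apq_const D p q w = ennreal \<kappa>" "0 < \<kappa>"
    and A: "(if 2 \<le> q \<and> p \<le> 2 then Ainfty_const D s epowr (1 / q)
             else Ainfty_const D u epowr (max (1 / 2 - 1 / p) 0)) = ennreal A" "0 \<le> A"
    and sparse: "\<T> \<subseteq> D" "sparse_collection \<gamma> \<T>" "0 < \<gamma>"
    and f: "f \<in> borel_measurable lebesgue" "\<And>x. 0 \<le> f x"
    and Np: "(\<integral>\<^sup>+x. ennreal (f x powr p * w x powr p) \<partial>lebesgue) = ennreal Np" "0 \<le> Np" and t: "0 < t"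
  shows "emeasure (weighted u) {x. ennreal t < sparse_op \<alpha> \<T> f x}
      \<le> ennreal (weak_const (real CARD('n)) p q (1 - \<alpha> / real CARD('n)) \<gamma> * \<kappa> * A powr q * (Np / t powr p) powr (q / p))"
proof -
  have "countable \<T>" by (rule countable_subset[OF sparse(1) countable_D])
  then obtain \<S> :: "nat \<Rightarrow> (real ^ 'n) set set" where \<S>: "incseq \<S>" "\<And>n. finite (\<S> n)" "\<Union>(range \<S>) = \<T>"
    by (rule countable_finite_exhaustion) blast
  let ?E = "\<lambda>n. {x. ennreal t < sparse_op \<alpha> (\<S> n) f x}"
  have sub: "\<S> n \<subseteq> \<T>" for n unfolding \<S>(3)[symmetric] by (rule UN_upper) simp
  note fin = weak_bound_finite[OF exps Apq A sparse \<S>(2) sub f Np t]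
  have "emeasure (weighted u) {x. ennreal t < sparse_op \<alpha> \<T> f x} = emeasure (weighted u) (\<Union>n. ?E n)"
    using sparse_op_level_set_exhaustion(1)[OF \<S> t] by simp
  also have "\<dots> = (SUP n. emeasure (weighted u) (?E n))"
    using fin(1) by (intro SUP_emeasure_incseq[symmetric] sparse_op_level_set_exhaustion(2)[OF \<S> t]) auto
  also have "\<dots> \<le> ennreal (weak_const (real CARD('n)) p q (1 - \<alpha> / real CARD('n)) \<gamma> * \<kappa> * A powr q * (Np / t powr p) powr (q / p))"
    by (intro SUP_least fin(2))
  finally show ?thesis .
qed

lemma Lp_norm_weighted:
  assumes "f \<in> borel_measurable lebesgue" "\<And>x. 0 \<le> f x"
  shows "Lp_norm p (weighted (\<lambda>x. w x powr p)) f = (\<integral>\<^sup>+x. ennreal (f x powr p * w x powr p) \<partial>lebesgue) epowr (1 / p)"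
proof -
  have "(\<integral>\<^sup>+x. ennreal (\<bar>f x\<bar> powr p) \<partial>weighted (\<lambda>x. w x powr p))
      = (\<integral>\<^sup>+x. ennreal (w x powr p) * ennreal (\<bar>f x\<bar> powr p) \<partial>lebesgue)"
    unfolding weighted_def using weight_powr(1)[OF w, of p] assms(1) by (intro nn_integral_density) auto
  also have "\<dots> = (\<integral>\<^sup>+x. ennreal (f x powr p * w x powr p) \<partial>lebesgue)"
    using assms(2) by (intro nn_integral_cong) (simp add: ennreal_mult[symmetric] mult.commute)
  finally show ?thesis by (simp add: Lp_norm_def)
qed

lemma weak_type_norm_le:
  assumes exps: "p < q" "1 - \<alpha> / real CARD('n) = 1 - 1 / p + 1 / q" "1 - \<alpha> / real CARD('n) < 1"
    and sparse: "\<T> \<subseteq> D" "sparse_collection \<gamma> \<T>" "0 < \<gamma>"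
    and C: "weak_const (real CARD('n)) p q (1 - \<alpha> / real CARD('n)) \<gamma> powr (1 / q) \<le> C" "0 < C"
  shows "weak_type_norm p q w (sparse_op \<alpha> \<T>) \<le> ennreal C * Apq_const D p q w epowr (1 / q) *
    (if 2 \<le> q \<and> p \<le> 2 then Ainfty_const D s epowr (1 / q)
     else Ainfty_const D u epowr (max (1 / 2 - 1 / p) 0))"
    (is "_ \<le> ennreal C * ?X * ?Y")
proof (cases "?X = \<infinity> \<or> ?Y = \<infinity>")
  case True
  \<comment> \<open>If one factor is infinite, the product is infinite only once the other is known
    to be positive.\<close>
  have "0 < ?X" by (rule epowr_pos[OF Apq_pos])
  moreover have "1 \<le> Ainfty_const D s" "1 \<le> Ainfty_const D u"
    using Ainfty_ge_one[OF weights(1) less_imp_le[OF weights(2)] emeasure_weighted_pos[OF weights(1,2)]]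
      Ainfty_ge_one[OF weights(3) less_imp_le[OF weights(4)] emeasure_weighted_pos[OF weights(3,4)]]
    by simp_all
  then have "0 < Ainfty_const D s" "0 < Ainfty_const D u"
    by (auto simp: less_le_trans[OF zero_less_one])
  then have "0 < ?Y" by (simp add: epowr_pos)
  ultimately have "ennreal C * ?X * ?Y = \<infinity>"
    using True C(2) by (auto simp: ennreal_mult_eq_top_iff ennreal_zero_less_mult_iff)
  then show ?thesis by simp
next
  case False
  obtain k where k: "?X = ennreal k" "0 \<le> k" using False by (cases ?X) auto
  obtain A where A: "?Y = ennreal A" "0 \<le> A" using False by (cases ?Y) auto
  define \<kappa> where "\<kappa> = k powr q"
  have Apq: "Apq_const D p q w = ennreal \<kappa>"
    using epowr_eq_ennrealD[OF k(1) _ k(2)] pq by (simp add: \<kappa>_def)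
  have \<kappa>: "0 < \<kappa>" using Apq_pos unfolding Apq by simp
  have k_eq: "\<kappa> powr (1 / q) = k" using k(2) pq by (simp add: \<kappa>_def powr_powr)
  let ?c = "weak_const (real CARD('n)) p q (1 - \<alpha> / real CARD('n)) \<gamma>"
  show ?thesis
    unfolding weak_type_norm_def
  proof (rule Inf_lower, rule CollectI, intro allI impI)
    fix f :: "real ^ 'n \<Rightarrow> real"
    assume "f \<in> borel_measurable lebesgue \<and> (\<forall>x. 0 \<le> f x) \<and> Lp_norm p (weighted (\<lambda>x. w x powr p)) f < \<infinity>"
    then have f: "f \<in> borel_measurable lebesgue" "\<And>x. 0 \<le> f x"
      and fin: "Lp_norm p (weighted (\<lambda>x. w x powr p)) f < \<infinity>" by auto
    let ?I = "\<integral>\<^sup>+x. ennreal (f x powr p * w x powr p) \<partial>lebesgue"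
    have "?I \<noteq> \<infinity>" using fin pq unfolding Lp_norm_weighted[OF f] by (auto simp: epowr_def)
    then obtain Np where Np: "?I = ennreal Np" "0 \<le> Np" by (cases ?I) auto
    have norm: "Lp_norm p (weighted (\<lambda>x. w x powr p)) f = ennreal (Np powr (1 / p))"
      unfolding Lp_norm_weighted[OF f] Np(1) using Np(2) pq by (simp add: epowr_ennreal')
    show "weak_norm q (weighted u) (sparse_op \<alpha> \<T> f) \<le> ennreal C * ?X * ?Y * Lp_norm p (weighted (\<lambda>x. w x powr p)) f"
      unfolding weak_norm_def
    proof (rule SUP_least)
      fix t :: real assume "t \<in> {0<..}"
      then have t: "0 < t" by simp
      let ?Z = "?c * \<kappa> * A powr q * (Np / t powr p) powr (q / p)"
      have bound: "emeasure (weighted u) {x. ennreal t < sparse_op \<alpha> \<T> f x} \<le> ennreal ?Z"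
        by (rule weak_bound[OF exps Apq \<kappa> A sparse f Np t])
      \<comment> \<open>\<open>epowr_mono\<close> asks for a nonnegative bound; the truncation at 0
        provides it without discussing the sign of \<open>weak_const\<close>.\<close>
      have bound': "emeasure (weighted u) {x. ennreal t < sparse_op \<alpha> \<T> f x} \<le> ennreal (max 0 ?Z)"
        using bound by (rule order_trans) (auto intro: ennreal_leI)
      have "emeasure (weighted u) {x. ennreal t < sparse_op \<alpha> \<T> f x} epowr (1 / q) \<le> ennreal (max 0 ?Z powr (1 / q))"
        using pq by (intro epowr_mono bound') auto
      also have "max 0 ?Z powr (1 / q) \<le> C * k * A * (Np powr (1 / p) / t)"
      proof -
        have R: "0 \<le> C * k * A * (Np powr (1 / p) / t)" using C k A t by simp
        have "?Z powr (1 / q) = ?c powr (1 / q) * k * A * (Np powr (1 / p) / t)"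
          using k_eq A(2) Np(2) t pq by (simp add: powr_mult powr_divide powr_powr)
        also have "\<dots> \<le> C * k * A * (Np powr (1 / p) / t)"
          using C k A t by (intro mult_right_mono) auto
        finally show ?thesis using R by (simp add: max_def)
      qed
      then have "ennreal (max 0 ?Z powr (1 / q)) \<le> ennreal (C * k * A * (Np powr (1 / p) / t))" by (rule ennreal_leI)
      finally have "ennreal t * emeasure (weighted u) {x. ennreal t < sparse_op \<alpha> \<T> f x} epowr (1 / q)
          \<le> ennreal t * ennreal (C * k * A * (Np powr (1 / p) / t))"
        by (rule mult_left_mono) simp
      also have "\<dots> = ennreal (C * k * A * Np powr (1 / p))"
        using t C k A by (simp add: ennreal_mult[symmetric])
      also have "\<dots> = ennreal C * ennreal k * ennreal A * ennreal (Np powr (1 / p))"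
        using C k A by (simp add: ennreal_mult)
      finally show "ennreal t * emeasure (weighted u) {x \<in> space (weighted u). ennreal t < sparse_op \<alpha> \<T> f x} epowr (1 / q)
          \<le> ennreal C * ?X * ?Y * Lp_norm p (weighted (\<lambda>x. w x powr p)) f"
        unfolding k(1) A(1) norm by simp
    qed
  qed
qed

end

theorem corollary4p1:
  fixes p q \<alpha> \<gamma> :: real
  assumes "0 < \<alpha>" and "\<alpha> < real CARD('n::finite)"
    and "1 < p" and "p \<le> q"
    and "1 / q + \<alpha> / real CARD('n) = 1 / p"
    and "0 < \<gamma>" and "\<gamma> < 1"
  shows "\<exists>C::real. C > 0 \<and>
    (\<forall>(D :: (real ^ 'n) set set) S (w :: real ^ 'n \<Rightarrow> real).
       dyadic_grid D \<and> S \<subseteq> D \<and> sparse_collection \<gamma> S \<and> weight w \<longrightarrow>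
       weak_type_norm p q w (sparse_op \<alpha> S)
         \<le> ennreal C * Apq_const D p q w epowr (1 / q) *
            (if 2 \<le> q \<and> (real CARD('n) \<le> 2 * \<alpha> \<or> q \<le> 2 / (1 - 2 * \<alpha> / real CARD('n)))
             then Ainfty_const D (\<lambda>x. w x powr (- conj_exp p)) epowr (1 / q)
             else Ainfty_const D (\<lambda>x. w x powr q) epowr (max (1 / 2 - 1 / p) 0)))"
proof -
  define d where "d = real CARD('n)"
  define a where "a = \<alpha> / d"
  have d: "0 < d" by (simp add: d_def)
  have a: "0 < a" "1 / q + a = 1 / p" using assms d by (auto simp: a_def d_def)
  have q: "0 < q" "0 < p" using assms by auto
  \<comment> \<open>The inequality is strict because \<open>\<alpha> > 0\<close>.\<close>
  have p_less_q: "p < q"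
  proof -
    have "1 / q < 1 / p" using a by linarith
    then show ?thesis using q by (simp add: frac_less2 divide_less_cancel field_simps)
  qed
  have p2: "p \<le> 2 \<longleftrightarrow> 1 / 2 \<le> 1 / p" using q by (simp add: field_simps)
  \<comment> \<open>The upper bound on \<open>q\<close> amounts to
    \<open>1 / 2 \<le> 1 / q + a\<close>, and the right-hand side is \<open>1 / p\<close>.\<close>
  have "q \<le> 2 / (1 - 2 * a) \<longleftrightarrow> 1 / 2 \<le> 1 / p" if "2 * a < 1"
  proof -
    have "q \<le> 2 / (1 - 2 * a) \<longleftrightarrow> q * (1 - 2 * a) \<le> 2" using that by (simp add: le_divide_eq)
    also have "\<dots> \<longleftrightarrow> 1 - 2 * a \<le> 2 * (1 / q)" using q by (simp add: field_simps)
    also have "\<dots> \<longleftrightarrow> 1 / 2 \<le> 1 / p" unfolding a(2)[symmetric] by linarith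
    finally show ?thesis .
  qed
  \<comment> \<open>Here \<open>p \<le> 2\<close> is automatic, which agrees with reading the bound
    on \<open>q\<close> as infinite.\<close>
  moreover have "1 / 2 \<le> 1 / p" if "\<not> 2 * a < 1"
  proof -
    have "0 < 1 / q" using q by simp
    then show ?thesis using that a(2) by linarith
  qed
  moreover have "d \<le> 2 * \<alpha> \<longleftrightarrow> \<not> 2 * a < 1" using d by (simp add: a_def not_less le_divide_eq)
  ultimately have cond: "(2 \<le> q \<and> (real CARD('n) \<le> 2 * \<alpha> \<or> q \<le> 2 / (1 - 2 * \<alpha> / real CARD('n)))) \<longleftrightarrow> 2 \<le> q \<and> p \<le> 2"
    unfolding p2 d_def[symmetric] times_divide_eq_right[symmetric] a_def[symmetric] by blast
  \<comment> \<open>Fixed before the grid, the collection and the weight are chosen; adding 1 makes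
    it positive.\<close>
  define C where "C = weak_const d p q (1 - \<alpha> / d) \<gamma> powr (1 / q) + 1"
  show ?thesis
  proof (intro exI[of _ C] conjI allI impI)
    show "0 < C" by (simp add: C_def add_nonneg_pos)
    fix D :: "(real ^ 'n) set set" and S and w :: "real ^ 'n \<Rightarrow> real"
    assume H: "dyadic_grid D \<and> S \<subseteq> D \<and> sparse_collection \<gamma> S \<and> weight w"
    interpret apq_weight D w p q by unfold_locales (use H assms(3) q in auto)
    show "weak_type_norm p q w (sparse_op \<alpha> S)
         \<le> ennreal C * Apq_const D p q w epowr (1 / q) *
            (if 2 \<le> q \<and> (real CARD('n) \<le> 2 * \<alpha> \<or> q \<le> 2 / (1 - 2 * \<alpha> / real CARD('n)))
             then Ainfty_const D (\<lambda>x. w x powr (- conj_exp p)) epowr (1 / q)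
             else Ainfty_const D (\<lambda>x. w x powr q) epowr (max (1 / 2 - 1 / p) 0))"
      unfolding cond
    proof (rule weak_type_norm_le[OF p_less_q])
      show "1 - \<alpha> / real CARD('n) = 1 - 1 / p + 1 / q" "1 - \<alpha> / real CARD('n) < 1"
        using a by (auto simp: a_def d_def)
    qed (use H assms(6) in \<open>auto simp: C_def d_def add_nonneg_pos\<close>)
  qed
qed

end
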